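(* (a) For Pythagorean $\mathbb F$ it holds that $\mathrm{sat}_{\mathrm L(\mathbb F^* )}\in\mathrm{BP}(\mathcal{NP}_{\mathrm{Re}\,\mathbb F})$. In particular, $\mathrm{sat}_{\mathrm L(\mathbb R^* )},\ \mathrm{sat}_{\mathrm L(\mathbb C^* )}\in\mathrm{BP}(\mathcal{NP}_{\mathbb R})$. (b) An ortholattice term is weakly (resp. strongly) satisfiable either in both or in none of $\mathrm L(\mathbb F^* )$ and $\mathrm L((\mathrm{Re}\,\mathbb F)^* )$; i.e. $\mathrm{SAT}_{\mathrm L(\mathbb F^* )}=\mathrm{SAT}_{\mathrm L((\mathrm{Re}\,\mathbb F)^* )}$ and $\mathrm{sat}_{\mathrm L(\mathbb F^* )}=\mathrm{sat}_{\mathrm L((\mathrm{Re}\,\mathbb F)^* )}$.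
   Context: $\mathbb F$ is a $*$-subfield of $\mathbb C$, i.e. a subfield closed under complex conjugation; it is assumed that $\mathbb F\subseteq\mathbb R$ or $\mathbb F=\mathbb F'+i\mathbb F'$ with $\mathbb F'=\mathbb F\cap\mathbb R$. $\mathrm{Re}\,\mathbb F=\{x:x,y\in\mathbb R,\ x+iy\in\mathbb F\}$. $\mathbb F$ is Pythagorean if in $\mathbb F\cap\mathbb R$ every sum of squares is a square. $\mathrm L(\mathbb F^d)$ is the ortholattice of linear subspaces of $\mathbb F^d$ under $\cap$, $+$, $^\perp$ (with respect to $\sum_i\overline{x_i}y_i$), $\{\vec0\}$ (as $0$), $\mathbb F^d$ (as $1$). An ortholattice term is built from variables with $\wedge,\vee,\neg,0,1$. It is strongly (weakly) satisfiable in an ortholattice $L$ if $t_L(\bar a)=1$ (resp. $\ne0$) for some assignment $\bar a$ in $L$; it is strongly (weakly) satisfiable in $\mathrm L(\mathbb F^* )$ if it is so in $\mathrm L(\mathbb F^d)$ for some $d\in\mathbb N=\{1,2,\ldots\}$. $\mathrm{SAT}_{\mathrm L(\mathbb F^* )}$ and $\mathrm{sat}_{\mathrm L(\mathbb F^* )}\subseteq\{0,1\}^*$ are the sets of binary encodings of terms strongly, resp. weakly, satisfiable in $\mathrm L(\mathbb F^* )$. A Blum-Shub-Smale (BSS) machine over a commutative ring $R$ stores, operates on ($+,-,\times$, and $\div$ over a field) and compares ($=$, and also $<$ in the ordered case) elements of $R$ at unit cost, with input in $R^*=\bigcup_nR^n$ and finitely many constants from $R$. $\mathcal{NP}_R$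 is the class of sets decidable by nondeterministic polynomial-time BSS machines over $R$ (guessing elements of $R$), and $\mathrm{BP}(\mathcal{NP}_R)=\{\mathcal L\cap\{0,1\}^*:\mathcal L\in\mathcal{NP}_R\}$. *)

theory Defs
  imports Complex_Main "HOL-Computational_Algebra.Polynomial" "Jordan_Normal_Form.Matrix"
begin

section \<open>Subfields of the complex numbers\<close>

definition star_subfield :: "complex set \<Rightarrow> bool" where
  "star_subfield F \<longleftrightarrow>
     0 \<in> F \<and> 1 \<in> F \<and>
     (\<forall>x\<in>F. \<forall>y\<in>F. x + y \<in> F \<and> x * y \<in> F) \<and>
     (\<forall>x\<in>F. - x \<in> F \<and> inverse x \<in> F \<and> cnj x \<in> F)"

text \<open>The standing assumption: \<open>F\<close> is real, or \<open>F = F' + i F'\<close> for \<open>F' = F \<inter> \<real>\<close>.\<close>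
definition admissible_field :: "complex set \<Rightarrow> bool" where
  "admissible_field F \<longleftrightarrow>
     star_subfield F \<and>
     (F \<subseteq> \<real> \<or> F = {x + \<i> * y | x y. x \<in> F \<inter> \<real> \<and> y \<in> F \<inter> \<real>})"

definition Re_field :: "complex set \<Rightarrow> real set" where
  "Re_field F = {x. \<exists>y. Complex x y \<in> F}"

definition pythagorean :: "complex set \<Rightarrow> bool" where
  "pythagorean F \<longleftrightarrow>
     (\<forall>xs. set xs \<subseteq> F \<inter> \<real> \<longrightarrow> (\<exists>c \<in> F \<inter> \<real>. (\<Sum>x\<leftarrow>xs. x\<^sup>2) = c\<^sup>2))"


section \<open>Ortholattice terms and their satisfiability\<close>

datatype oterm = Var nat | Zero | One | Neg oterm | And oterm oterm | Or oterm oterm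

text \<open>An algebraic structure of ortholattice signature; \<^term>\<open>carrier\<close> is the HOL-Algebra field.\<close>
record 'a ortho_struct = "'a partial_object" +
  ol_meet :: "'a \<Rightarrow> 'a \<Rightarrow> 'a"
  ol_join :: "'a \<Rightarrow> 'a \<Rightarrow> 'a"
  ol_neg  :: "'a \<Rightarrow> 'a"
  ol_bot  :: 'a
  ol_top  :: 'a

fun eval_term :: "('a, 'b) ortho_struct_scheme \<Rightarrow> (nat \<Rightarrow> 'a) \<Rightarrow> oterm \<Rightarrow> 'a" where
  "eval_term L a (Var n) = a n"
| "eval_term L a Zero = ol_bot L"
| "eval_term L a One = ol_top L"
| "eval_term L a (Neg t) = ol_neg L (eval_term L a t)"
| "eval_term L a (And s t) = ol_meet L (eval_term L a s) (eval_term L a t)"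
| "eval_term L a (Or s t) = ol_join L (eval_term L a s) (eval_term L a t)"

definition strongly_sat_in :: "('a, 'b) ortho_struct_scheme \<Rightarrow> oterm \<Rightarrow> bool" where
  "strongly_sat_in L t \<longleftrightarrow> (\<exists>a. range a \<subseteq> carrier L \<and> eval_term L a t = ol_top L)"

definition weakly_sat_in :: "('a, 'b) ortho_struct_scheme \<Rightarrow> oterm \<Rightarrow> bool" where
  "weakly_sat_in L t \<longleftrightarrow> (\<exists>a. range a \<subseteq> carrier L \<and> eval_term L a t \<noteq> ol_bot L)"

definition space_over :: "complex set \<Rightarrow> nat \<Rightarrow> complex vec set" where
  "space_over F d = {v \<in> carrier_vec d. \<forall>i<d. v $ i \<in> F}"

definition lin_subspace :: "complex set \<Rightarrow> nat \<Rightarrow> complex vec set \<Rightarrow> bool" where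
  "lin_subspace F d U \<longleftrightarrow>
     U \<subseteq> space_over F d \<and> 0\<^sub>v d \<in> U \<and>
     (\<forall>u\<in>U. \<forall>v\<in>U. u + v \<in> U) \<and> (\<forall>c\<in>F. \<forall>u\<in>U. c \<cdot>\<^sub>v u \<in> U)"

definition subspace_lattice :: "complex set \<Rightarrow> nat \<Rightarrow> complex vec set ortho_struct" where
  "subspace_lattice F d =
     \<lparr> carrier = {U. lin_subspace F d U},
       ol_meet = (\<inter>),
       ol_join = (\<lambda>U W. {u + w | u w. u \<in> U \<and> w \<in> W}),
       ol_neg  = (\<lambda>U. {y \<in> space_over F d. \<forall>x\<in>U. conjugate x \<bullet> y = 0}),
       ol_bot  = {0\<^sub>v d},
       ol_top  = space_over F d \<rparr>"

definition strongly_sat :: "complex set \<Rightarrow> oterm \<Rightarrow> bool" where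
  "strongly_sat F t \<longleftrightarrow> (\<exists>d\<ge>1. strongly_sat_in (subspace_lattice F d) t)"

definition weakly_sat :: "complex set \<Rightarrow> oterm \<Rightarrow> bool" where
  "weakly_sat F t \<longleftrightarrow> (\<exists>d\<ge>1. weakly_sat_in (subspace_lattice F d) t)"


section \<open>Binary encoding of terms\<close>

text \<open>Little-endian binary digits of \<open>n\<close> (no digits for \<open>0\<close>).\<close>
fun digits :: "nat \<Rightarrow> bool list" where
  "digits n = (if n = 0 then [] else odd n # digits (n div 2))"

declare digits.simps [simp del]

text \<open>Reverse Polish notation over an alphabet of eight symbols of three bits each; a variable
  is the string of binary digits of its index, closed by the symbol \<open>101\<close>. The bits are the
  real numbers \<open>0\<close> and \<open>1\<close>, so that a code word is directly an input for a BSS machine over a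
  subfield of \<open>\<real>\<close>.\<close>
fun encode :: "oterm \<Rightarrow> real list" where
  "encode (Var n) =
     concat (map (\<lambda>b. if b then [1, 1, 1] else [1, 1, 0]) (digits n)) @ [1, 0, 1]"
| "encode Zero = [0, 0, 0]"
| "encode One = [0, 0, 1]"
| "encode (Neg t) = encode t @ [0, 1, 0]"
| "encode (And s t) = encode s @ encode t @ [0, 1, 1]"
| "encode (Or s t) = encode s @ encode t @ [1, 0, 0]"

definition SAT_lang :: "complex set \<Rightarrow> real list set" where
  "SAT_lang F = encode ` {t. strongly_sat F t}"

definition sat_lang :: "complex set \<Rightarrow> real list set" where
  "sat_lang F = encode ` {t. weakly_sat F t}"

text \<open>The encoding is injective: it is inverted by a stack machine that reads symbol by symbol
  and keeps the pending digits of a variable index and the stack of terms read so far.\<close>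

fun undigits :: "bool list \<Rightarrow> nat" where
  "undigits [] = 0"
| "undigits (b # bs) = of_bool b + 2 * undigits bs"

lemma undigits_digits: "undigits (digits n) = n"
proof (induction n rule: digits.induct)
  case (1 n)
  show ?case
  proof (cases "n = 0")
    case True
    then show ?thesis by (simp add: digits.simps)
  next
    case False
    then have "undigits (digits n) = of_bool (odd n) + 2 * (n div 2)"
      using 1 by (subst digits.simps) simp
    then show ?thesis by (cases "even n") (auto elim!: evenE oddE)
  qed
qed

fun decode_step :: "real \<Rightarrow> real \<Rightarrow> real \<Rightarrow> bool list \<times> oterm list \<Rightarrow> bool list \<times> oterm list" where
  "decode_step a b c (ds, ts) =
     (if a = 1 \<and> b = 1 then (ds @ [c = 1], ts)
      else if a = 1 \<and> c = 1 then ([], Var (undigits ds) # ts)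
      else if a = 1 then (ds, Or (ts ! 1) (ts ! 0) # drop 2 ts)
      else if b = 1 \<and> c = 1 then (ds, And (ts ! 1) (ts ! 0) # drop 2 ts)
      else if b = 1 then (ds, Neg (ts ! 0) # drop 1 ts)
      else if c = 1 then (ds, One # ts)
      else (ds, Zero # ts))"

fun decode :: "real list \<Rightarrow> bool list \<times> oterm list \<Rightarrow> bool list \<times> oterm list" where
  "decode (a # b # c # w) s = decode w (decode_step a b c s)"
| "decode _ s = s"

lemma decode_digits:
  "decode (concat (map (\<lambda>b. if b then [1, 1, 1] else [1, 1, 0]) bs) @ w) (ds, ts)
     = decode w (ds @ bs, ts)"
  by (induction bs arbitrary: ds) auto

lemma decode_encode: "decode (encode t @ w) ([], ts) = decode w ([], t # ts)"
  by (induction t arbitrary: w ts) (simp_all add: decode_digits undigits_digits)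

lemma inj_encode: "inj encode"
proof (rule injI)
  fix s t assume "encode s = encode t"
  then have "decode (encode s @ []) ([], []) = decode (encode t @ []) ([], [])" by simp
  then show "s = t" unfolding decode_encode by simp
qed


section \<open>Nondeterministic BSS machines over an ordered field\<close>

text \<open>Machines in random-access form. The store consists of arrays of ring elements, numbered by
  \<open>nat\<close>, together with natural-number address registers; a program mentions only finitely many of
  them. The operand \<open>(k, i)\<close> is the cell of array \<open>k\<close> whose position is the current content of
  address register \<open>i\<close>. Address registers can only be cleared, copied, compared and changed by
  one, so their contents exceed the input length by at most the number of steps executed.
  Jump targets are absolute positions in the program; leaving the program halts without accepting.
  Division by \<open>0\<close> yields \<open>0\<close>, as everywhere in HOL.\<close>

type_synonym operand = "nat \<times> nat"

datatype arith_op = Plus | Minus | Times | Divide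

datatype 'a instr =
    SetConst operand 'a
  | CopyCell operand operand
  | Arith arith_op operand operand operand
  | Guess operand
  | JumpEq operand operand nat
  | JumpLess operand operand nat
  | AddrClear nat
  | AddrInc nat
  | AddrDec nat
  | AddrCopy nat nat
  | JumpAddrEq nat nat nat
  | Accept
  | Reject

type_synonym 'a program = "'a instr list"

record 'a config =
  pc :: nat
  addr :: "nat \<Rightarrow> nat"
  mem :: "nat \<Rightarrow> nat \<Rightarrow> 'a"

fun arith :: "arith_op \<Rightarrow> 'a::field \<Rightarrow> 'a \<Rightarrow> 'a" where
  "arith Plus x y = x + y"
| "arith Minus x y = x - y"
| "arith Times x y = x * y"
| "arith Divide x y = x / y"

fun get :: "'a config \<Rightarrow> operand \<Rightarrow> 'a" where
  "get c (k, i) = mem c k (addr c i)"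

fun put :: "operand \<Rightarrow> 'a \<Rightarrow> 'a config \<Rightarrow> 'a config" where
  "put (k, i) v c = c\<lparr>mem := (mem c)(k := (mem c k)(addr c i := v))\<rparr>"

definition set_addr :: "nat \<Rightarrow> nat \<Rightarrow> 'a config \<Rightarrow> 'a config" where
  "set_addr i n c = c\<lparr>addr := (addr c)(i := n)\<rparr>"

definition advance :: "'a config \<Rightarrow> 'a config" where
  "advance c = c\<lparr>pc := Suc (pc c)\<rparr>"

definition branch :: "bool \<Rightarrow> nat \<Rightarrow> 'a config \<Rightarrow> 'a config" where
  "branch b l c = (if b then c\<lparr>pc := l\<rparr> else advance c)"

text \<open>The set of successor configurations; only guessing is nondeterministic.\<close>
fun exec_instr :: "'a::linordered_field set \<Rightarrow> 'a instr \<Rightarrow> 'a config \<Rightarrow> 'a config set" where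
  "exec_instr R (SetConst x v) c = {advance (put x v c)}"
| "exec_instr R (CopyCell x y) c = {advance (put x (get c y) c)}"
| "exec_instr R (Arith f x y z) c = {advance (put x (arith f (get c y) (get c z)) c)}"
| "exec_instr R (Guess x) c = {advance (put x v c) | v. v \<in> R}"
| "exec_instr R (JumpEq x y l) c = {branch (get c x = get c y) l c}"
| "exec_instr R (JumpLess x y l) c = {branch (get c x < get c y) l c}"
| "exec_instr R (AddrClear i) c = {advance (set_addr i 0 c)}"
| "exec_instr R (AddrInc i) c = {advance (set_addr i (addr c i + 1) c)}"
| "exec_instr R (AddrDec i) c = {advance (set_addr i (addr c i - 1) c)}"
| "exec_instr R (AddrCopy i j) c = {advance (set_addr i (addr c j) c)}"
| "exec_instr R (JumpAddrEq i j l) c = {branch (addr c i = addr c j) l c}"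
| "exec_instr R Accept c = {}"
| "exec_instr R Reject c = {}"

definition step ::
    "'a::linordered_field set \<Rightarrow> 'a program \<Rightarrow> 'a config \<Rightarrow> 'a config \<Rightarrow> bool" where
  "step R P c c' \<longleftrightarrow> pc c < length P \<and> c' \<in> exec_instr R (P ! pc c) c"

definition accepting :: "'a program \<Rightarrow> 'a config \<Rightarrow> bool" where
  "accepting P c \<longleftrightarrow> pc c < length P \<and> P ! pc c = Accept"

text \<open>The input is placed in array \<open>0\<close> and its length in address register \<open>0\<close>.\<close>
definition initial :: "'a::zero list \<Rightarrow> 'a config" where
  "initial xs =
     \<lparr> pc = 0,
       addr = (\<lambda>i. if i = 0 then length xs else 0),
       mem = (\<lambda>k n. if k = 0 \<and> n < length xs then xs ! n else 0) \<rparr>"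

definition program_over :: "'a set \<Rightarrow> 'a program \<Rightarrow> bool" where
  "program_over R P \<longleftrightarrow> (\<forall>ins \<in> set P. set_instr ins \<subseteq> R)"

definition accepts :: "'a::linordered_field set \<Rightarrow> 'a program \<Rightarrow> 'a list \<Rightarrow> bool" where
  "accepts R P xs \<longleftrightarrow> (\<exists>c. (step R P)\<^sup>*\<^sup>* (initial xs) c \<and> accepting P c)"

text \<open>Every computation path, accepting or not, halts within \<open>p (length xs)\<close> steps.\<close>
definition poly_time :: "'a::linordered_field set \<Rightarrow> 'a program \<Rightarrow> nat poly \<Rightarrow> bool" where
  "poly_time R P p \<longleftrightarrow>
     (\<forall>xs \<in> lists R. \<forall>n c. (step R P ^^ n) (initial xs) c \<longrightarrow> n \<le> poly p (length xs))"

text \<open>\<open>R\<close> is meant to be a subfield of the type \<open>'a\<close>, and \<^term>\<open>lists R\<close> is \<open>R\<^sup>*\<close>.\<close>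
definition NP_over :: "'a::linordered_field set \<Rightarrow> 'a list set set" where
  "NP_over R =
     {L. L \<subseteq> lists R \<and>
         (\<exists>P p. program_over R P \<and> poly_time R P p \<and> (\<forall>xs \<in> lists R. xs \<in> L \<longleftrightarrow> accepts R P xs))}"

definition BP :: "'a::zero_neq_one list set set \<Rightarrow> 'a list set set" where
  "BP C = {L \<inter> lists {0, 1} | L. L \<in> C}"

end

theory Submission
  imports Defs
begin

text \<open>
  (b) If \<open>F = F' + i F'\<close>, then \<open>U \<mapsto> U + i U\<close> embeds \<open>L(F'\<^sup>d)\<close> into \<open>L(F\<^sup>d)\<close>, and separating real and
  imaginary parts embeds \<open>L(F\<^sup>d)\<close> into \<open>L(F'\<^sup>2\<^sup>d)\<close>.

  (a) By (b) only a Pythagorean \<open>K \<subseteq> \<real>\<close> matters. Push a nonzero vector of the value of a term down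
  to the leaves of its negation normal form: a conjunction hands its vector on to both sides, a
  disjunction splits it into a sum. Conversely, vectors at the leaves with such a labelling of the
  inner nodes come from an assignment iff vectors at \<open>x\<close> are orthogonal to vectors at \<open>\<not> x\<close>. The
  conditions on the inner nodes are linear, hence hold coordinate by coordinate, and expanding all
  vectors in an orthonormal basis of their span bounds the dimension by the length of the term.
  A machine thus makes one pass over the term per coordinate, guesses how scalars are split, and
  accumulates the Gram matrix of the leaf vectors, which is checked at the end.
\<close>

section \<open>A machine for weak satisfiability\<close>

text \<open>Postfix code read backwards is prefix code: the label of a node is known before its
  operands are reached, so a stack of scalars suffices and the machine never builds a term. Every
  surviving pass over the same word meets the same leaves in the same order, whatever is guessed.
  Hence position (p, q) of the Gram matrix belongs to one pair of leaves throughout, and only sums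
  of products have to outlive a pass. Since the scalars are real, the root vector is nonzero iff its
  sum of squares is. The number of passes is the input length n. The obstacle is to keep coordinates
  inside the field: the basis has to be orthonormal, not merely orthogonal, for the plain sum of
  products of coordinates to be the inner product, and normalising takes exactly the square roots
  that a Pythagorean field has.\<close>

abbreviation state :: "nat \<Rightarrow> (nat \<Rightarrow> nat) \<Rightarrow> (nat \<Rightarrow> nat \<Rightarrow> 'a) \<Rightarrow> 'a config" where
  "state l a M \<equiv> \<lparr>pc = l, addr = a, mem = M\<rparr>"

section \<open>Symbolic execution of programs\<close>

definition acc ::
    "'a::linordered_field set \<Rightarrow> 'a program \<Rightarrow> nat \<Rightarrow> (nat \<Rightarrow> nat) \<Rightarrow> (nat \<Rightarrow> nat \<Rightarrow> 'a) \<Rightarrow> bool" where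
  "acc R P l a M \<longleftrightarrow> (\<exists>c. (step R P)\<^sup>*\<^sup>* (state l a M) c \<and> accepting P c)"

text \<open>One machine step as a transformer of predicates on configurations; \<open>Q\<close> is the quantifier
  over the guessed value, and \<open>y\<close>, \<open>n\<close> are the values of the two halting instructions.\<close>
fun after :: "(('a::linordered_field \<Rightarrow> bool) \<Rightarrow> bool) \<Rightarrow> bool \<Rightarrow> bool \<Rightarrow>
    (nat \<Rightarrow> (nat \<Rightarrow> nat) \<Rightarrow> (nat \<Rightarrow> nat \<Rightarrow> 'a) \<Rightarrow> bool) \<Rightarrow> 'a instr \<Rightarrow>
    nat \<Rightarrow> (nat \<Rightarrow> nat) \<Rightarrow> (nat \<Rightarrow> nat \<Rightarrow> 'a) \<Rightarrow> bool" where
  "after Q y n H (SetConst (k, i) v) l a M = H (l + 1) a (M(k := (M k)(a i := v)))"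
| "after Q y n H (CopyCell (k, i) (k', i')) l a M = H (l + 1) a (M(k := (M k)(a i := M k' (a i'))))"
| "after Q y n H (Arith f (k, i) (k', i') (k'', i'')) l a M =
     H (l + 1) a (M(k := (M k)(a i := arith f (M k' (a i')) (M k'' (a i'')))))"
| "after Q y n H (Guess (k, i)) l a M = Q (\<lambda>v. H (l + 1) a (M(k := (M k)(a i := v))))"
| "after Q y n H (JumpEq (k, i) (k', i') l') l a M =
     (if M k (a i) = M k' (a i') then H l' a M else H (l + 1) a M)"
| "after Q y n H (JumpLess (k, i) (k', i') l') l a M =
     (if M k (a i) < M k' (a i') then H l' a M else H (l + 1) a M)"
| "after Q y n H (AddrClear i) l a M = H (l + 1) (a(i := 0)) M"
| "after Q y n H (AddrInc i) l a M = H (l + 1) (a(i := a i + 1)) M"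
| "after Q y n H (AddrDec i) l a M = H (l + 1) (a(i := a i - 1)) M"
| "after Q y n H (AddrCopy i j) l a M = H (l + 1) (a(i := a j)) M"
| "after Q y n H (JumpAddrEq i j l') l a M = (if a i = a j then H l' a M else H (l + 1) a M)"
| "after Q y n H Accept l a M = y"
| "after Q y n H Reject l a M = n"

text \<open>The running time is obtained by the same symbolic execution as acceptance, with
  \<open>Ball\<close> in place of \<open>Bex\<close> and a step budget. A halting instruction is
  charged one unit although no step follows it, which is harmless for an upper bound.\<close>

primrec halts ::
    "'a::linordered_field set \<Rightarrow> 'a program \<Rightarrow> nat \<Rightarrow> nat \<Rightarrow> (nat \<Rightarrow> nat) \<Rightarrow> (nat \<Rightarrow> nat \<Rightarrow> 'a) \<Rightarrow> bool" where
  "halts R P 0 l a M \<longleftrightarrow> length P \<le> l"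
| "halts R P (Suc T) l a M \<longleftrightarrow> length P \<le> l \<or> after (Ball R) True True (halts R P T) (P ! l) l a M"

lemma acc_unfold_succ:
  assumes "l < length P" "P ! l \<noteq> Accept"
  shows "acc R P l a M \<longleftrightarrow>
    (\<exists>c\<in>exec_instr R (P ! l) (state l a M). acc R P (pc c) (addr c) (mem c))"
proof -
  have st: "c = state (pc c) (addr c) (mem c)" for c :: "'a config" by simp
  have "acc R P l a M \<longleftrightarrow> (\<exists>c. (step R P)\<^sup>+\<^sup>+ (state l a M) c \<and> accepting P c)"
    unfolding acc_def using assms
    by (metis accepting_def config.select_convs(1) rtranclpD tranclp_into_rtranclp)
  also have "\<dots> \<longleftrightarrow> (\<exists>c'. step R P (state l a M) c' \<and> (\<exists>c. (step R P)\<^sup>*\<^sup>* c' c \<and> accepting P c))"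
    by (metis tranclpD rtranclp_into_tranclp2)
  also have "\<dots> \<longleftrightarrow>
      (\<exists>c'\<in>exec_instr R (P ! l) (state l a M). \<exists>c. (step R P)\<^sup>*\<^sup>* c' c \<and> accepting P c)"
    unfolding step_def using assms by auto
  also have "\<dots> \<longleftrightarrow>
      (\<exists>c\<in>exec_instr R (P ! l) (state l a M). acc R P (pc c) (addr c) (mem c))"
    unfolding acc_def st[symmetric] ..
  finally show ?thesis .
qed

text \<open>Instantiated at each program line, this equation is the rewrite rule that replaces all
  reasoning about sequences of steps.\<close>

lemma acc_after:
  assumes "l < length P"
  shows "acc R P l a M = after (Bex R) True False (acc R P) (P ! l) l a M"
proof (cases "P ! l = Accept")
  case True
  then show ?thesis using assms by (auto simp: acc_def accepting_def)
next
  case False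
  then show ?thesis
  proof (cases "P ! l")
    case (Guess x)
    then show ?thesis by (cases x) (simp add: advance_def acc_unfold_succ[OF assms False] Bex_def,
        metis (no_types, lifting) config.select_convs)
  qed (auto simp: advance_def set_addr_def branch_def acc_unfold_succ[OF assms False])
qed

lemma halts_bound:
  assumes "halts R P T l a M" "(step R P ^^ k) (state l a M) c"
  shows "k \<le> T"
  using assms
proof (induction T arbitrary: k l a M)
  case 0
  have "\<not> step R P (state l a M) c'" for c'
    using 0 by (simp add: step_def)
  with 0 show ?case by (cases k) (auto dest!: relpowp_Suc_D2 simp del: relpowp.simps)
next
  case (Suc T)
  show ?case
  proof (cases k)
    case (Suc k')
    have st: "c = state (pc c) (addr c) (mem c)" for c :: "'a config" by simp
    obtain c' where c': "step R P (state l a M) c'" "(step R P ^^ k') c' c"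
      using Suc.prems(2) Suc by (metis relpowp_Suc_D2)
    then have "halts R P T (pc c') (addr c') (mem c')"
      using Suc.prems(1)
      by (cases "P ! l") (auto simp: step_def advance_def set_addr_def branch_def split: if_splits)
    then have "k' \<le> T" using Suc.IH c'(2) by (simp add: st[symmetric])
    then show ?thesis using Suc by simp
  qed simp
qed

lemma after_mono:
  "after (Ball R) y n H ins l a M \<Longrightarrow> (\<And>l a M. H l a M \<Longrightarrow> H' l a M) \<Longrightarrow> after (Ball R) y n H' ins l a M"
  by (cases ins) (auto split: if_splits)

lemma halts_Suc: "halts R P T l a M \<Longrightarrow> halts R P (Suc T) l a M"
proof (induction T arbitrary: l a M)
  case (Suc T)
  then show ?case using after_mono[of R True True "halts R P T" "P ! l" l a M "halts R P (Suc T)"]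
    by auto
qed simp

lemma halts_mono: "T \<le> T' \<Longrightarrow> halts R P T l a M \<Longrightarrow> halts R P T' l a M"
  by (induction rule: dec_induct) (auto simp del: halts.simps intro: halts_Suc)

declare halts.simps [simp del]

text \<open>
  Address registers: 0 input length, 2 input left to read (from its end), 3 stack height, 4 number of
  leaves, 5 number of passes made, 6 to 8 loops over pairs of leaves, 9 constantly zero, 10 auxiliary.
  Arrays: 0 input, 2 and 3 scalars and polarities on the stack, 4 to 6 scalars, variables and
  polarities of the leaves, 7 Gram matrix by rows; the others are used at position 0 only: 8 and 9 the
  constants 1 and 0, 10 to 12 the current symbol, 13 the squared norm of the root vector, 14 whether a
  digit may follow, 15 scratch.
  Main jump targets: 2 next pass, 12 next symbol, 33 binary connective, 44 symbol starting with 1,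
  63 end of a pass, 67 and 69 update of the Gram matrix, 79 final check with loops at 82 and 84.
\<close>
definition prog :: "real program" where
  "prog =
    [SetConst (8, 9) 1, SetConst (9, 9) 0,
     JumpAddrEq 5 0 79, AddrCopy 2 0, AddrClear 3, AddrClear 4, Guess (2, 3), SetConst (3, 3) 1,
     Arith Times (15, 9) (2, 3) (2, 3), Arith Plus (13, 9) (13, 9) (15, 9), AddrInc 3,
     SetConst (14, 9) 0,
     JumpAddrEq 2 9 63, AddrDec 2, CopyCell (12, 9) (0, 2), JumpAddrEq 2 9 64, AddrDec 2,
     CopyCell (11, 9) (0, 2), JumpAddrEq 2 9 64, AddrDec 2, CopyCell (10, 9) (0, 2),
     JumpEq (10, 9) (8, 9) 44, JumpAddrEq 3 9 64, AddrDec 3, SetConst (14, 9) 0,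
     JumpEq (11, 9) (8, 9) 29, JumpEq (12, 9) (3, 3) 12, JumpEq (2, 3) (9, 9) 12, Reject,
     JumpEq (12, 9) (8, 9) 33, Arith Minus (3, 3) (8, 9) (3, 3), AddrInc 3, JumpAddrEq 9 9 12,
     AddrCopy 10 3, AddrInc 3, CopyCell (3, 3) (3, 10), JumpEq (10, 9) (3, 10) 40,
     CopyCell (2, 3) (2, 10), AddrInc 3, JumpAddrEq 9 9 12,
     Guess (2, 3), Arith Minus (2, 10) (2, 10) (2, 3), AddrInc 3, JumpAddrEq 9 9 12,
     JumpEq (11, 9) (8, 9) 56, JumpAddrEq 3 9 64, AddrDec 3, SetConst (14, 9) 0,
     JumpEq (12, 9) (8, 9) 50, JumpAddrEq 9 9 33,
     CopyCell (4, 4) (2, 3), SetConst (5, 4) 0, CopyCell (6, 4) (3, 3), AddrInc 4,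
     SetConst (14, 9) 1, JumpAddrEq 9 9 12,
     JumpEq (14, 9) (9, 9) 64, AddrDec 4, Arith Plus (5, 4) (5, 4) (5, 4),
     Arith Plus (5, 4) (5, 4) (12, 9), JumpEq (5, 4) (9, 9) 64, AddrInc 4, JumpAddrEq 9 9 12,
     JumpAddrEq 3 9 65,
     Reject,
     AddrClear 8, AddrClear 6,
     JumpAddrEq 6 4 77, AddrClear 7,
     JumpAddrEq 7 4 75, Arith Times (15, 9) (4, 6) (4, 7), Arith Plus (7, 8) (7, 8) (15, 9),
     AddrInc 7, AddrInc 8, JumpAddrEq 9 9 69,
     AddrInc 6, JumpAddrEq 9 9 67,
     AddrInc 5, JumpAddrEq 9 9 2,
     JumpEq (13, 9) (9, 9) 64, AddrClear 8, AddrClear 6,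
     JumpAddrEq 6 4 95, AddrClear 7,
     JumpAddrEq 7 4 93, JumpEq (5, 6) (5, 7) 87, JumpAddrEq 9 9 90,
     JumpEq (6, 6) (6, 7) 90, JumpEq (7, 8) (9, 9) 90, Reject,
     AddrInc 7, AddrInc 8, JumpAddrEq 9 9 84,
     AddrInc 6, JumpAddrEq 9 9 82,
     Accept]"

lemma length_prog: "length prog = 96" by (simp add: prog_def)

lemmas prog_nth = prog_def[THEN arg_cong[of _ _ "\<lambda>p. p ! l" for l]]

text \<open>Jump targets are kept apart, so that rewriting with \<open>prog_line\<close> executes a stretch of
  straight-line code and stops at the next jump target.\<close>
lemmas prog_label =
  prog_nth[of 0] prog_nth[of 1] prog_nth[of 2] prog_nth[of 12] prog_nth[of 33] prog_nth[of 44]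
  prog_nth[of 63] prog_nth[of 67] prog_nth[of 69] prog_nth[of 75] prog_nth[of 77] prog_nth[of 79]
  prog_nth[of 82] prog_nth[of 84] prog_nth[of 93]

text \<open>The targets 33 and 44 are not loop heads, so acceptance is unfolded straight through
  them. For the running time they remain labels with bounds of their own in
  \<open>halts_PARSE\<close>.\<close>

lemmas prog_block = prog_nth[of 33] prog_nth[of 44]
lemmas prog_line =
  prog_nth[of 3] prog_nth[of 4] prog_nth[of 5] prog_nth[of 6] prog_nth[of 7] prog_nth[of 8]
  prog_nth[of 9] prog_nth[of 10] prog_nth[of 11] prog_nth[of 13] prog_nth[of 14] prog_nth[of 15]
  prog_nth[of 16] prog_nth[of 17] prog_nth[of 18] prog_nth[of 19] prog_nth[of 20] prog_nth[of 21]
  prog_nth[of 22] prog_nth[of 23] prog_nth[of 24] prog_nth[of 25] prog_nth[of 26] prog_nth[of 27]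
  prog_nth[of 28] prog_nth[of 29] prog_nth[of 30] prog_nth[of 31] prog_nth[of 32] prog_nth[of 34]
  prog_nth[of 35] prog_nth[of 36] prog_nth[of 37] prog_nth[of 38] prog_nth[of 39] prog_nth[of 40]
  prog_nth[of 41] prog_nth[of 42] prog_nth[of 43] prog_nth[of 45] prog_nth[of 46] prog_nth[of 47]
  prog_nth[of 48] prog_nth[of 49] prog_nth[of 50] prog_nth[of 51] prog_nth[of 52] prog_nth[of 53]
  prog_nth[of 54] prog_nth[of 55] prog_nth[of 56] prog_nth[of 57] prog_nth[of 58] prog_nth[of 59]
  prog_nth[of 60] prog_nth[of 61] prog_nth[of 62] prog_nth[of 64] prog_nth[of 65] prog_nth[of 66]
  prog_nth[of 68] prog_nth[of 70] prog_nth[of 71] prog_nth[of 72] prog_nth[of 73] prog_nth[of 74]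
  prog_nth[of 76] prog_nth[of 78] prog_nth[of 80] prog_nth[of 81] prog_nth[of 83] prog_nth[of 85]
  prog_nth[of 86] prog_nth[of 87] prog_nth[of 88] prog_nth[of 89] prog_nth[of 90] prog_nth[of 91]
  prog_nth[of 92] prog_nth[of 94] prog_nth[of 95]

lemma acc_prog:
  "prog ! l = ins \<Longrightarrow> l < length prog \<Longrightarrow>
    acc R prog l a M \<longleftrightarrow> after (Bex R) True False (acc R prog) ins l a M"
  using acc_after[of l prog] by simp

lemma halts_prog:
  "prog ! l = ins \<Longrightarrow> l < length prog \<Longrightarrow>
    halts R prog T l a M \<longleftrightarrow> 0 < T \<and> after (Ball R) True True (halts R prog (T - 1)) ins l a M"
  by (cases T) (auto simp: halts.simps)

lemmas acc_line = prog_line[simplified, THEN acc_prog, simplified length_prog, simplified]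
  prog_block[simplified, THEN acc_prog, simplified length_prog, simplified]
lemmas acc_label = prog_label[simplified, THEN acc_prog, simplified length_prog, simplified]
lemmas halts_line = prog_line[simplified, THEN halts_prog, simplified length_prog, simplified]
lemmas halts_label = prog_label[simplified, THEN halts_prog, simplified length_prog, simplified]
  prog_block[simplified, THEN halts_prog, simplified length_prog, simplified]

section \<open>Loops over pairs of leaves: final check and update of the Gram matrix\<close>

abbreviation ready :: "(nat \<Rightarrow> nat) \<Rightarrow> (nat \<Rightarrow> nat \<Rightarrow> real) \<Rightarrow> bool" where
  "ready a M \<equiv> a 9 = 0 \<and> M 8 0 = 1 \<and> M 9 0 = 0"

definition noconf :: "(nat \<Rightarrow> nat \<Rightarrow> real) \<Rightarrow> nat \<Rightarrow> nat \<Rightarrow> nat \<Rightarrow> bool" where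
  "noconf M p q d \<longleftrightarrow> (M 5 p = M 5 q \<longrightarrow> M 6 p \<noteq> M 6 q \<longrightarrow> M 7 d = 0)"

text \<open>Register 8 advances together with register 7 but is not reset at the end of a row, so it
  always holds the row-major position of the current pair.\<close>

lemma acc_QL2:
  "ready a M \<Longrightarrow> a 7 + k = a 4 \<Longrightarrow> acc R prog 84 a M \<longleftrightarrow>
    (\<forall>i<k. noconf M (a 6) (a 7 + i) (a 8 + i)) \<and>
    acc R prog 93 (a(7 := a 4, 8 := a 8 + k)) M"
proof (induction k arbitrary: a)
  case 0
  then have "a(7 := a 4, 8 := a 8 + 0) = a" by auto
  with 0 show ?case 
    by (subst acc_label) (simp_all add: acc_line)
next
  case (Suc k)
  let ?a = "a(7 := Suc (a 7), 8 := Suc (a 8))"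
  have "acc R prog 84 a M \<longleftrightarrow> noconf M (a 6) (a 7) (a 8) \<and> acc R prog 84 ?a M"
    by (subst acc_label) (use Suc.prems in \<open>simp_all add: acc_line noconf_def\<close>)
  also have "acc R prog 84 ?a M \<longleftrightarrow> (\<forall>i<k. noconf M (a 6) (Suc (a 7) + i) (Suc (a 8) + i)) \<and>
    acc R prog 93 (a(7 := a 4, 8 := a 8 + Suc k)) M"
  proof -
    have "?a(7 := ?a 4, 8 := ?a 8 + k) = a(7 := a 4, 8 := a 8 + Suc k)" by auto
    then show ?thesis by (subst Suc.IH) (use Suc.prems in \<open>simp_all only:, simp_all\<close>)
  qed
  finally show ?case unfolding All_less_Suc2 by (simp add: fun_upd_def)
qed

lemma acc_PL2:
  "ready a M \<Longrightarrow> a 6 + k = a 4 \<Longrightarrow> acc R prog 82 a M \<longleftrightarrow>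
    (\<forall>i<k. \<forall>q<a 4. noconf M (a 6 + i) q (a 8 + i * a 4 + q))"
proof (induction k arbitrary: a)
  case 0
  then show ?case 
    by (subst acc_label) (simp_all add: acc_line)
next
  case (Suc k)
  have "acc R prog 82 a M \<longleftrightarrow> acc R prog 84 (a(7 := 0)) M"
    by (subst acc_label) (use Suc.prems in \<open>simp_all add: acc_line\<close>)
  also have "\<dots> \<longleftrightarrow> (\<forall>q<a 4. noconf M (a 6) q (a 8 + q)) \<and> 
      acc R prog 93 (a(7 := a 4, 8 := a 8 + a 4)) M"
    by (subst acc_QL2[where k = "a 4"]) (use Suc.prems in simp_all)
  also have "acc R prog 93 (a(7 := a 4, 8 := a 8 + a 4)) M \<longleftrightarrow>
      acc R prog 82 (a(7 := a 4, 8 := a 8 + a 4, 6 := Suc (a 6))) M"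
    by (subst acc_label) (simp_all add: acc_line)
  also have "\<dots> \<longleftrightarrow> (\<forall>i<k. \<forall>q<a 4. noconf M (Suc (a 6) + i) q (a 8 + a 4 + i * a 4 + q))"
    by (subst Suc.IH) (use Suc.prems in simp_all)
  finally show ?case unfolding All_less_Suc2 by (simp add: algebra_simps)
qed

lemma acc_FINAL:
  assumes "ready a M"
  shows "acc R prog 79 a M \<longleftrightarrow> M 13 0 \<noteq> 0 \<and> (\<forall>p<a 4. \<forall>q<a 4. noconf M p q (p * a 4 + q))"
proof -
  have "acc R prog 79 a M \<longleftrightarrow> M 13 0 \<noteq> 0 \<and> acc R prog 82 (a(8 := 0, 6 := 0)) M"
    by (subst acc_label) (use assms in \<open>simp_all add: acc_line\<close>)
  then show ?thesis
    by (subst (asm) acc_PL2[where k = "a 4"]) (use assms in simp_all)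
qed

text \<open>The new memory is only claimed to exist, because the scratch array 15 ends up with some
  last product; all arrays except 7 and 15 are retained.\<close>

lemma acc_QL:
  "ready a M \<Longrightarrow> a 7 + k = a 4 \<Longrightarrow>
    \<exists>M'. (\<forall>x. x \<noteq> 7 \<longrightarrow> x \<noteq> 15 \<longrightarrow> M' x = M x) \<and>
      M' 7 = (\<lambda>d. if a 8 \<le> d \<and> d < a 8 + k then M 7 d + M 4 (a 6) * M 4 (a 7 + (d - a 8)) else M 7 d) \<and>
      acc R prog 69 a M = acc R prog 75 (a(7 := a 4, 8 := a 8 + k)) M'"
proof (induction k arbitrary: a M)
  case 0
  then have "a(7 := a 4, 8 := a 8 + 0) = a" by auto
  with 0 show ?case 
    by (intro exI[of _ M], subst acc_label) (auto simp add: acc_line)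
next
  case (Suc k)
  let ?a = "a(7 := Suc (a 7), 8 := Suc (a 8))"
  let ?M = "M(15 := (M 15)(0 := M 4 (a 6) * M 4 (a 7)), 7 := (M 7)(a 8 := M 7 (a 8) + M 4 (a 6) * M 4 (a 7)))"
  have 1: "acc R prog 69 a M \<longleftrightarrow> acc R prog 69 ?a ?M"
    by (subst acc_label) (use Suc.prems in \<open>simp_all add: acc_line\<close>)
  have "ready ?a ?M" "?a 7 + k = ?a 4" using Suc.prems by auto
  from Suc.IH[of ?a ?M, OF this] obtain M' where M': "\<forall>x. x \<noteq> 7 \<longrightarrow> x \<noteq> 15 \<longrightarrow> M' x = ?M x"
     "M' 7 = (\<lambda>d. if ?a 8 \<le> d \<and> d < ?a 8 + k then ?M 7 d + ?M 4 (?a 6) * ?M 4 (?a 7 + (d - ?a 8)) else ?M 7 d)"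
     "acc R prog 69 ?a ?M = acc R prog 75 (?a(7 := ?a 4, 8 := ?a 8 + k)) M'" by blast
  have 2: "?a(7 := ?a 4, 8 := ?a 8 + k) = a(7 := a 4, 8 := a 8 + Suc k)" by auto
  have 3: "M' 7 d = (if a 8 \<le> d \<and> d < a 8 + Suc k
      then M 7 d + M 4 (a 6) * M 4 (a 7 + (d - a 8)) else M 7 d)" for d
  proof (cases "a 8 < d")
    case True
    then obtain e where "d = Suc (a 8 + e)" by (auto simp: less_iff_Suc_add)
    then show ?thesis unfolding M'(2) by auto
  qed (auto simp: M'(2))
  show ?case
    by (rule exI[of _ M']) (use 1 M'(1,3) 2 3 in \<open>auto simp: fun_upd_def\<close>)
qed

lemma acc_PL:
  "ready a M \<Longrightarrow> a 6 + k = a 4 \<Longrightarrow> 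
    \<exists>M' a'. (\<forall>x. x \<noteq> 7 \<longrightarrow> x \<noteq> 15 \<longrightarrow> M' x = M x) \<and>
      M' 7 = (\<lambda>d. if a 8 \<le> d \<and> d < a 8 + k * a 4
         then M 7 d + M 4 (a 6 + (d - a 8) div a 4) * M 4 ((d - a 8) mod a 4) else M 7 d) \<and>
      (\<forall>x. x \<notin> {6, 7, 8} \<longrightarrow> a' x = a x) \<and>
      acc R prog 67 a M = acc R prog 77 a' M'"
proof (induction k arbitrary: a M)
  case 0
  then show ?case 
    by (intro exI[of _ M] exI[of _ a], subst acc_label) (auto simp add: acc_line)
next
  case (Suc k)
  let ?m = "a 4"
  have 1: "acc R prog 67 a M \<longleftrightarrow> acc R prog 69 (a(7 := 0)) M"
    by (subst acc_label) (use Suc.prems in \<open>simp_all add: acc_line\<close>)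
  have "ready (a(7 := 0)) M" "(a(7 := 0)) 7 + ?m = (a(7 := 0)) 4" using Suc.prems by auto
  from acc_QL[of "a(7 := 0)" M ?m R, OF this] obtain M1 where M1: "\<forall>x. x \<noteq> 7 \<longrightarrow> x \<noteq> 15 \<longrightarrow> M1 x = M x"
     "M1 7 = (\<lambda>d. if a 8 \<le> d \<and> d < a 8 + ?m then M 7 d + M 4 (a 6) * M 4 (d - a 8) else M 7 d)"
     "acc R prog 69 (a(7 := 0)) M = acc R prog 75 (a(7 := ?m, 8 := a 8 + ?m)) M1" 
    by (auto cong del: if_weak_cong)
  let ?a = "a(7 := ?m, 8 := a 8 + ?m, 6 := Suc (a 6))"
  have 2: "acc R prog 75 (a(7 := ?m, 8 := a 8 + ?m)) M1 = acc R prog 67 ?a M1"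
    by (subst acc_label) (simp_all add: acc_line)
  have "ready ?a M1" "?a 6 + k = ?a 4" using Suc.prems M1(1) by auto
  from Suc.IH[of ?a M1, OF this] obtain M' a' where M': 
     "\<forall>x. x \<noteq> 7 \<longrightarrow> x \<noteq> 15 \<longrightarrow> M' x = M1 x"
     "M' 7 = (\<lambda>d. if ?a 8 \<le> d \<and> d < ?a 8 + k * ?a 4
         then M1 7 d + M1 4 (?a 6 + (d - ?a 8) div ?a 4) * M1 4 ((d - ?a 8) mod ?a 4) else M1 7 d)"
     "\<forall>x. x \<notin> {6, 7, 8} \<longrightarrow> a' x = ?a x"
     "acc R prog 67 ?a M1 = acc R prog 77 a' M'" by blast
  have 3: "M' 7 d = (if a 8 \<le> d \<and> d < a 8 + Suc k * a 4
         then M 7 d + M 4 (a 6 + (d - a 8) div a 4) * M 4 ((d - a 8) mod a 4) else M 7 d)" for d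
  \<comment> \<open>The first row is written by the inner loop. For the later rows, removing one row
    of length \<open>?m\<close> lowers the quotient by one and keeps the remainder.\<close>
  proof (cases "a 8 \<le> d \<and> d < a 8 + ?m")
    case True
    then have "d - a 8 < ?m" by auto
    then have "(d - a 8) div ?m = 0" "(d - a 8) mod ?m = d - a 8" by auto
    then show ?thesis using True unfolding M'(2) M1(2) by auto
  next
    case False
    show ?thesis
    proof (cases "a 8 + ?m \<le> d \<and> d < a 8 + ?m + k * ?m")
      case True
      then have "?m > 0" by (cases "?m") auto
      moreover have "d - a 8 = (d - (a 8 + ?m)) + ?m" using True by auto
      ultimately have "(d - a 8) div ?m = Suc ((d - (a 8 + ?m)) div ?m)"
        "(d - a 8) mod ?m = (d - (a 8 + ?m)) mod ?m"
        by (metis Suc_eq_plus1 div_add_self2 less_not_refl2, metis mod_add_self2)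
      then show ?thesis using True M1(1) unfolding M'(2) M1(2) by auto
    qed (use False in \<open>auto simp: M'(2) M1(2)\<close>)
  qed
  show ?case
    by (rule exI[of _ M'], rule exI[of _ a']) (use 1 2 M1 M' 3 in auto)
qed

section \<open>Scalar-level meaning of a pass\<close>

definition leaves ::
    "nat \<Rightarrow> (nat \<Rightarrow> real) \<Rightarrow> (nat \<Rightarrow> real) \<Rightarrow> (nat \<Rightarrow> real) \<Rightarrow> (real \<times> real \<times> real) list" where
  "leaves m X V P = map (\<lambda>i. (X i, V i, P i)) [0..<m]"

definition stack :: "nat \<Rightarrow> (nat \<Rightarrow> real) \<Rightarrow> (nat \<Rightarrow> real) \<Rightarrow> (real \<times> real) list" where
  "stack s X P = rev (map (\<lambda>i. (X i, P i)) [0..<s])"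

lemma leaves_0 [simp]: "leaves 0 X V P = []" and stack_0 [simp]: "stack 0 X P = []"
  by (simp_all add: leaves_def stack_def)

lemma leaves_Suc [simp]: "leaves (Suc m) X V P = leaves m X V P @ [(X m, V m, P m)]"
  by (simp add: leaves_def)

lemma stack_Suc [simp]: "stack (Suc s) X P = (X s, P s) # stack s X P"
  by (simp add: stack_def)

lemma leaves_upd [simp]:
  assumes "m \<le> i"
  shows "leaves m (X(i := x)) V P = leaves m X V P"
    and "leaves m X (V(i := x)) P = leaves m X V P"
    and "leaves m X V (P(i := x)) = leaves m X V P"
  using assms by (simp_all add: leaves_def)

lemma stack_upd [simp]:
  assumes "s \<le> i"
  shows "stack s (X(i := x)) P = stack s X P" and "stack s X (P(i := x)) = stack s X P"
  using assms by (simp_all add: stack_def)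

lemma length_leaves [simp]: "length (leaves m X V P) = m"
  by (simp add: leaves_def)

lemma nth_leaves [simp]: "i < m \<Longrightarrow> leaves m X V P ! i = (X i, V i, P i)"
  by (simp add: leaves_def)

text \<open>The scalar-level meaning of one pass over the reversed input: all leaf lists that some sequence
  of guesses can produce, given the stack and the leaves so far. The flag tells whether the last
  symbol read belongs to a variable, so that a digit may follow; the test \<open>2 * v + c = 0\<close> rejects
  leading zeros.\<close>
fun parse :: "real set \<Rightarrow> real list \<Rightarrow> bool \<Rightarrow> (real \<times> real) list \<Rightarrow> (real \<times> real \<times> real) list
    \<Rightarrow> (real \<times> real \<times> real) list set" where
  "parse R (c # b # a # w) fl st ls =
    (if a = 1 \<and> b = 1 then
       (if fl then
          (case last ls of (x, v, p) \<Rightarrow>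
             if 2 * v + c = 0 then {} else parse R w True st (butlast ls @ [(x, 2 * v + c, p)]))
        else {})
     else
       (case st of [] \<Rightarrow> {}
        | (x, p) # st \<Rightarrow>
            if a = 1 \<and> c = 1 then parse R w True st (ls @ [(x, 0, p)])
            else if a = 1 \<or> b = 1 \<and> c = 1 then
              (if a = p then \<Union>y\<in>R. parse R w False ((y, p) # (x - y, p) # st) ls
               else parse R w False ((x, p) # (x, p) # st) ls)
            else if b = 1 then parse R w False ((x, 1 - p) # st) ls
            else if c = p \<or> x = 0 then parse R w False st ls
            else {}))"
| "parse R [] fl st ls = (if st = [] then {ls} else {})"
| "parse R _ fl st ls = {}"

definition add_gram :: "(real \<times> real \<times> real) list \<Rightarrow> (nat \<Rightarrow> real) \<Rightarrow> nat \<Rightarrow> real" where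
  "add_gram ls D d =
    (let m = length ls in if d < m * m then D d + fst (ls ! (d div m)) * fst (ls ! (d mod m)) else D d)"

definition final :: "real \<Rightarrow> (nat \<Rightarrow> real) \<Rightarrow> (real \<times> real \<times> real) list \<Rightarrow> bool" where
  "final E D ls \<longleftrightarrow> E \<noteq> 0 \<and>
    (\<forall>i<length ls. \<forall>j<length ls. case (ls ! i, ls ! j) of ((x, v, p), (y, u, q)) \<Rightarrow>
       v = u \<longrightarrow> p \<noteq> q \<longrightarrow> D (i * length ls + j) = 0)"

text \<open>\<open>E\<close> and \<open>D\<close> are the squared norm of the root vector and the
  Gram matrix accumulated so far. The list argument is the leaf list of the latest pass;
  \<open>final\<close> takes variables and polarities from it, while the scalars reach
  \<open>final\<close> only through \<open>D\<close>.\<close>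

fun passes :: "real set \<Rightarrow> real list \<Rightarrow> nat \<Rightarrow> real \<Rightarrow> (nat \<Rightarrow> real) \<Rightarrow> (real \<times> real \<times> real) list \<Rightarrow> bool" where
  "passes R w 0 E D ls = final E D ls"
| "passes R w (Suc k) E D _ =
    (\<exists>r\<in>R. \<exists>ls\<in>parse R w False [(r, 1)] []. passes R w k (E + r * r) (add_gram ls D) ls)"

lemma acc_FINAL': "ready a M \<Longrightarrow> acc R prog 79 a M = final (M 13 0) (M 7) (leaves (a 4) (M 4) (M 5) (M 6))"
  by (auto simp add: acc_FINAL final_def noconf_def)

lemma acc_PEND:
  assumes "ready a M"
  shows "\<exists>M' a'. (\<forall>x. x \<noteq> 7 \<longrightarrow> x \<noteq> 15 \<longrightarrow> M' x = M x) \<and> M' 7 = add_gram (leaves (a 4) (M 4) (M 5) (M 6)) (M 7) \<and>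
      (\<forall>x. x \<notin> {5, 6, 7, 8} \<longrightarrow> a' x = a x) \<and> a' 5 = Suc (a 5) \<and>
      acc R prog 63 a M = (a 3 = 0 \<and> acc R prog 2 a' M')"
proof -
  let ?a = "a(8 := 0, 6 := 0)"
  have 1: "acc R prog 63 a M = (a 3 = 0 \<and> acc R prog 67 ?a M)"
    by (subst acc_label) (use assms in \<open>simp_all add: acc_line\<close>)
  have "ready ?a M" "?a 6 + a 4 = ?a 4" using assms by auto
  from acc_PL[of ?a M "a 4" R, OF this] obtain M' a' where M': 
      "\<forall>x. x \<noteq> 7 \<longrightarrow> x \<noteq> 15 \<longrightarrow> M' x = M x"
      "M' 7 = (\<lambda>d. if d < a 4 * a 4 then M 7 d + M 4 (d div a 4) * M 4 (d mod a 4) else M 7 d)"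
      "\<forall>x. x \<notin> {6, 7, 8} \<longrightarrow> a' x = ?a x"
      "acc R prog 67 ?a M = acc R prog 77 a' M'" by (auto cong del: if_weak_cong)
  have 2: "acc R prog 77 a' M' = acc R prog 2 (a'(5 := Suc (a 5))) M'"
    by (subst acc_label) (use M'(3) in \<open>simp_all add: acc_line\<close>)
  have "M' 7 d = add_gram (leaves (a 4) (M 4) (M 5) (M 6)) (M 7) d" for d
  proof (cases "d < a 4 * a 4")
    case True
    then have "d div a 4 < a 4" "d mod a 4 < a 4" 
      by (auto simp: less_mult_imp_div_less intro: mod_less_divisor dest: gr_implies_not0)
    then show ?thesis using True by (simp add: M' add_gram_def Let_def)
  qed (simp add: M' add_gram_def Let_def)
  then have "M' 7 = add_gram (leaves (a 4) (M 4) (M 5) (M 6)) (M 7)" ..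
  then show ?thesis
    by (intro exI[of _ M'] exI[of _ "a'(5 := Suc (a 5))"]) (use 1 2 M' in simp)
qed

text \<open>The invariant of reading symbols: constants, input, pass counter, Gram matrix and
  squared norm change only between passes.\<close>

definition keeps where
  "keeps n j I D E a M \<longleftrightarrow> ready a M \<and> a 0 = (n::nat) \<and> a 5 = (j::nat) \<and> M 0 = I \<and> M 7 = D \<and> M 13 0 = (E::real)"

text \<open>Continuation style: \<open>A\<close> stands for whatever happens to the finished leaf
  list from label 63 on, so one pass can be analysed without knowing the later ones. The condition
  on the flag guarantees that decrementing the leaf counter, to revisit the last leaf, is not
  truncated at 0.\<close>

lemma acc_PARSE:
  assumes fin: "\<And>a M. keeps n j I D E a M \<Longrightarrow> acc R prog 63 a M = (a 3 = 0 \<and> A (leaves (a 4) (M 4) (M 5) (M 6)))"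
  assumes "keeps n j I D E a M" "M 14 0 \<noteq> 0 \<Longrightarrow> a 4 > 0"
  shows "acc R prog 12 a M = (\<exists>ls\<in>parse R (rev (map I [0..<a 2])) (M 14 0 \<noteq> 0) (stack (a 3) (M 2) (M 3)) (leaves (a 4) (M 4) (M 5) (M 6)). A ls)"
  using assms(2-)
proof (induction "a 2" arbitrary: a M rule: less_induct)
  case less
  consider "a 2 = 0" | "a 2 = 1" | "a 2 = 2" | "a 2 \<ge> 3" by linarith
  then show ?case
  proof cases
    case 1
    then have "acc R prog 12 a M = acc R prog 63 a M"
      by (subst acc_label) (use less.prems in \<open>simp_all add: acc_line keeps_def\<close>)
    then show ?thesis using fin[OF less.prems(1)] 1 by (cases "a 3") (auto)
  next
    \<comment> \<open>One or two left-over bits form no symbol; the machine rejects and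
      \<open>parse\<close> is empty.\<close>
    case 2
    have "\<not> acc R prog 12 a M"
      by (subst acc_label) (use less.prems 2 in \<open>simp_all add: acc_line keeps_def\<close>)
    then show ?thesis using 2 by simp
  next
    case 3
    have "\<not> acc R prog 12 a M"
      by (subst acc_label) (use less.prems 3 in \<open>simp_all add: acc_line keeps_def\<close>)
    then show ?thesis using 3 by (simp add: numeral_2_eq_2)
  next
    case 4
    then have "a 2 = Suc (Suc (Suc (a 2 - 3)))" by simp
    then obtain i where i: "a 2 = Suc (Suc (Suc i))" ..
    have w: "rev (map I [0..<a 2]) = I (Suc (Suc i)) # I (Suc i) # I i # rev (map I [0..<i])"
      by (simp add: i)
    have IH: "a' 2 = i \<Longrightarrow> a' 9 = 0 \<Longrightarrow> M' 8 0 = 1 \<Longrightarrow> M' 9 0 = 0 \<Longrightarrow> a' 0 = n \<Longrightarrow> a' 5 = j \<Longrightarrow>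
        M' 0 = I \<Longrightarrow> M' 7 = D \<Longrightarrow> M' 13 0 = E \<Longrightarrow> M' 14 0 = 0 \<or> a' 4 > 0 \<Longrightarrow>
        acc R prog 12 a' M' = (\<exists>ls\<in>parse R (rev (map I [0..<i])) (M' 14 0 \<noteq> 0)
          (stack (a' 3) (M' 2) (M' 3)) (leaves (a' 4) (M' 4) (M' 5) (M' 6)). A ls)" for a' M'
      using less.hyps[of a' M'] i by (auto simp: keeps_def)
    have "M 14 0 = 0 \<or> a 4 > 0" using less.prems(2) by (cases "M 14 0 = 0") auto
    then have pr: "a 9 = 0" "M 8 0 = 1" "M 9 0 = 0" "a 0 = n" "a 5 = j" "M 0 = I" "M 7 = D" "M 13 0 = E"
      "M 14 0 = 0 \<or> a 4 > 0"
      using less.prems(1) by (auto simp: keeps_def)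
    show ?thesis unfolding w
    proof (cases "I i = 1 \<and> I (Suc i) = 1")
      case True
      show "acc R prog 12 a M =
         (\<exists>ls\<in>parse R (I (Suc (Suc i)) # I (Suc i) # I i # rev (map I [0..<i])) (M 14 0 \<noteq> 0)
           (stack (a 3) (M 2) (M 3)) (leaves (a 4) (M 4) (M 5) (M 6)). A ls)"
      \<comment> \<open>A digit extends the index of the last leaf, so the machine steps back by one
        leaf. Without any leaf the flag is down and it rejects.\<close>
      proof (cases "a 4")
        case 0
        then show ?thesis using pr(1-8) pr(9) True
          by (subst acc_label) (simp_all add: acc_line i)
      next
        case (Suc m)
        then show ?thesis using pr(1-8) True
          by (subst acc_label) (simp_all add: acc_line i IH algebra_simps)
      qed
    next
      case False
      show "acc R prog 12 a M =
         (\<exists>ls\<in>parse R (I (Suc (Suc i)) # I (Suc i) # I i # rev (map I [0..<i])) (M 14 0 \<noteq> 0)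
           (stack (a 3) (M 2) (M 3)) (leaves (a 4) (M 4) (M 5) (M 6)). A ls)"
      \<comment> \<open>Every symbol that is not a digit pops the stack, so an empty stack means
        rejection.\<close>
      proof (cases "a 3")
        case 0
        then show ?thesis using pr(1-8) False
          by (subst acc_label) (simp_all add: acc_line i)
      next
        case (Suc s)
        then show ?thesis using pr(1-8) False
          by (subst acc_label) (simp_all add: acc_line i IH)
      qed
    qed
  qed
qed

text \<open>Register 5 is compared with the input length, which is where the number of passes comes
  from. \<open>acc_PARSE\<close> is applied with \<open>A\<close> saying that the remaining passes
  succeed, which the induction hypothesis turns into acceptance.\<close>

lemma acc_PASS:
  assumes "ready a M" "a 5 + k = a 0"
  shows "acc R prog 2 a M =
    passes R (rev (map (M 0) [0..<a 0])) k (M 13 0) (M 7) (leaves (a 4) (M 4) (M 5) (M 6))"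
  using assms
proof (induction k arbitrary: a M)
  case 0
  then have "acc R prog 2 a M = acc R prog 79 a M"
    by (subst acc_label) (simp_all add: acc_line)
  then show ?case using acc_FINAL' 0 by simp
next
  case (Suc k)
  let ?w = "rev (map (M 0) [0..<a 0])"
  let ?M = "\<lambda>r. M(2 := (M 2)(0 := r), 3 := (M 3)(0 := 1), 15 := (M 15)(0 := r * r),
     13 := (M 13)(0 := M 13 0 + r * r), 14 := (M 14)(0 := 0))"
  let ?a = "a(2 := a 0, 3 := 0, 4 := 0, 3 := Suc 0)"
  have start: "acc R prog 2 a M = (\<exists>r\<in>R. acc R prog 12 ?a (?M r))"
    by (subst acc_label) (use Suc.prems in \<open>simp_all add: acc_line\<close>)
  have "acc R prog 12 ?a (?M r) \<longleftrightarrow>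
      (\<exists>ls\<in>parse R ?w False [(r, 1)] []. passes R ?w k (M 13 0 + r * r) (add_gram ls (M 7)) ls)" for r
  proof -
    have k: "keeps (a 0) (a 5) (M 0) (M 7) (M 13 0 + r * r) ?a (?M r)"
      using Suc.prems(1) by (simp add: keeps_def)
    have flag: "?M r 14 0 \<noteq> 0 \<Longrightarrow> ?a 4 > 0" by simp
    have eqs: "?a 2 = a 0" "(?M r 14 0 \<noteq> 0) = False" "stack (?a 3) (?M r 2) (?M r 3) = [(r, 1)]"
      "leaves (?a 4) (?M r 4) (?M r 5) (?M r 6) = []" by simp_all
    have "acc R prog 63 b N = (b 3 = 0 \<and> passes R ?w k (M 13 0 + r * r)
          (add_gram (leaves (b 4) (N 4) (N 5) (N 6)) (M 7)) (leaves (b 4) (N 4) (N 5) (N 6)))"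
      if "keeps (a 0) (a 5) (M 0) (M 7) (M 13 0 + r * r) b N" for b N
    proof -
      have N: "ready b N" "b 0 = a 0" "b 5 = a 5" "N 0 = M 0" "N 7 = M 7" "N 13 0 = M 13 0 + r * r"
        using that by (auto simp: keeps_def)
      from acc_PEND[of b N R, OF N(1)] obtain N' b' where N':
        "\<forall>x. x \<noteq> 7 \<longrightarrow> x \<noteq> 15 \<longrightarrow> N' x = N x"
        "N' 7 = add_gram (leaves (b 4) (N 4) (N 5) (N 6)) (N 7)"
        "\<forall>x. x \<notin> {5, 6, 7, 8} \<longrightarrow> b' x = b x" "b' 5 = Suc (b 5)"
        "acc R prog 63 b N = (b 3 = 0 \<and> acc R prog 2 b' N')" by blast
      have eqs': "b' 0 = a 0" "b' 4 = b 4" "N' 0 = M 0" "N' 13 = N 13" "N' 4 = N 4" "N' 5 = N 5" "N' 6 = N 6"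
        using N' N by auto
      have "ready b' N'" "b' 5 + k = b' 0" using N' N Suc.prems by auto
      from Suc.IH[of b' N', OF this] show ?thesis
        unfolding N'(5) eqs' N'(2) N by (simp only:)
    qed
    note acc_PARSE[where n = "a 0" and j = "a 5" and I = "M 0" and D = "M 7" and E = "M 13 0 + r * r"
        and A = "\<lambda>ls. passes R ?w k (M 13 0 + r * r) (add_gram ls (M 7)) ls" and a = ?a and M = "?M r",
        OF this k flag]
    then show ?thesis unfolding eqs .
  qed
  then show ?case unfolding start passes.simps by (intro bex_cong refl)
qed

lemma accepts_prog:
  "accepts R prog xs \<longleftrightarrow> passes R (rev xs) (length xs) 0 (\<lambda>_. 0) []"
proof -
  let ?M = "\<lambda>(k::nat) n. if k = 0 \<and> n < length xs then xs ! n else 0 :: real"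
  let ?N = "?M(8 := (?M 8)(0 := 1), 9 := (?M 9)(0 := 0))"
  let ?a = "\<lambda>i. if i = 0 then length xs else 0 :: nat"
  have 0: "acc R prog 0 ?a ?M = acc R prog 2 ?a ?N"
    by (subst acc_label(1), subst acc_label(2)) (simp add: numeral_2_eq_2)
  have 1: "map (?N 0) [0..<length xs] = xs"
    by (rule nth_equalityI) auto
  have "accepts R prog xs = acc R prog 0 ?a ?M"
    by (simp add: accepts_def acc_def initial_def)
  also have "\<dots> = passes R (rev (map (?N 0) [0..<length xs])) (length xs) 0 (\<lambda>_. 0) []"
    unfolding 0 by (subst acc_PASS[where k = "length xs"]) auto
  finally show ?thesis unfolding 1 .
qed

subsection \<open>Running time\<close>

text \<open>Time bounds are composed backwards: \<open>T\<close> is a budget that suffices from the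
  exit of the loop on. Ten steps per round is a rounded-up count.\<close>

lemma halts_QL2:
  "a 7 + k = a 4 \<Longrightarrow> (\<And>b. (\<forall>x. x \<notin> {7, 8} \<longrightarrow> b x = a x) \<Longrightarrow> halts R prog T 93 b M) \<Longrightarrow>
    10 * k + 2 + T \<le> T' \<Longrightarrow> halts R prog T' 84 a M"
proof (induction k arbitrary: a T')
  case 0
  have "halts R prog (T' - 1) 93 a M" by (rule halts_mono[of T]) (use 0 in auto)
  with 0 show ?case by (subst halts_label) (simp_all add: halts_line)
next
  case (Suc k)
  have IH: "10 * k + 2 + T \<le> T'' \<Longrightarrow> halts R prog T'' 84 (a(7 := Suc (a 7), 8 := Suc (a 8))) M" for T''
    by (rule Suc.IH) (use Suc.prems in auto)
  show ?case
    by (subst halts_label) (use Suc.prems(1,3) in \<open>simp_all add: halts_line IH\<close>)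
qed

lemma halts_PL2:
  "a 6 + k = a 4 \<Longrightarrow> k * (10 * a 4 + 10) + 2 \<le> T \<Longrightarrow> halts R prog T 82 a M"
proof (induction k arbitrary: a T)
  case 0
  then show ?case by (subst halts_label) (simp_all add: halts_line)
next
  case (Suc k)
  have IH: "k * (10 * a 4 + 10) + 2 \<le> T'' \<Longrightarrow> \<forall>x. x \<notin> {6, 7, 8} \<longrightarrow> b x = a x \<Longrightarrow> b 6 = Suc (a 6) \<Longrightarrow>
      halts R prog T'' 82 b M" for b T''
    by (rule Suc.IH) (use Suc.prems in auto)
  have 1: "halts R prog (k * (10 * a 4 + 10) + 4) 93 b M" if "\<forall>x. x \<notin> {7, 8} \<longrightarrow> b x = a x" for b
    by (subst halts_label) (use that in \<open>simp_all add: halts_line IH\<close>)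
  have 2: "halts R prog T'' 84 (a(7 := 0)) M" if "10 * a 4 + 2 + (k * (10 * a 4 + 10) + 4) \<le> T''" for T''
    by (rule halts_QL2[OF _ 1 that]) auto
  show ?case
    by (subst halts_label) (use Suc.prems in \<open>simp_all add: halts_line 2\<close>)
qed

lemma halts_QL:
  "a 7 + k = a 4 \<Longrightarrow> (\<And>b N. (\<forall>x. x \<notin> {7, 8} \<longrightarrow> b x = a x) \<Longrightarrow> halts R prog T 75 b N) \<Longrightarrow>
    10 * k + 2 + T \<le> T' \<Longrightarrow> halts R prog T' 69 a M"
proof (induction k arbitrary: a T' M)
  case 0
  have "halts R prog (T' - 1) 75 a N" for N by (rule halts_mono[of T]) (use 0 in auto)
  with 0 show ?case by (subst halts_label) (simp_all add: halts_line)
next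
  case (Suc k)
  have IH: "10 * k + 2 + T \<le> T'' \<Longrightarrow> halts R prog T'' 69 (a(7 := Suc (a 7), 8 := Suc (a 8))) N" for T'' N
    by (rule Suc.IH) (use Suc.prems in auto)
  show ?case
    by (subst halts_label) (use Suc.prems(1,3) in \<open>simp_all add: halts_line IH\<close>)
qed

lemma halts_PL:
  "a 6 + k = a 4 \<Longrightarrow> (\<And>b N. (\<forall>x. x \<notin> {6, 7, 8} \<longrightarrow> b x = a x) \<Longrightarrow> halts R prog T 77 b N) \<Longrightarrow>
    k * (10 * a 4 + 10) + 2 + T \<le> T' \<Longrightarrow> halts R prog T' 67 a M"
proof (induction k arbitrary: a T' M)
  case 0
  have "halts R prog (T' - 1) 77 a N" for N by (rule halts_mono[of T]) (use 0 in auto)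
  with 0 show ?case by (subst halts_label) (simp_all add: halts_line)
next
  case (Suc k)
  have IH: "k * (10 * a 4 + 10) + 2 + T \<le> T'' \<Longrightarrow> \<forall>x. x \<notin> {6, 7, 8} \<longrightarrow> b x = a x \<Longrightarrow> b 6 = Suc (a 6) \<Longrightarrow>
      halts R prog T'' 67 b N" for b T'' N
    by (rule Suc.IH) (use Suc.prems in auto)
  have 1: "halts R prog (k * (10 * a 4 + 10) + 4 + T) 75 b N" if "\<forall>x. x \<notin> {7, 8} \<longrightarrow> b x = a x" for b N
    by (subst halts_label) (use that in \<open>simp_all add: halts_line IH\<close>)
  have 2: "halts R prog T'' 69 (a(7 := 0)) N"
    if "10 * a 4 + 2 + (k * (10 * a 4 + 10) + 4 + T) \<le> T''" for T'' N
    by (rule halts_QL[OF _ 1 that]) auto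
  show ?case
    by (subst halts_label) (use Suc.prems(1,3) in \<open>simp_all add: halts_line 2\<close>)
qed

text \<open>A symbol consumes three bits and adds at most one leaf, so \<open>n\<close> keeps
  bounding unread bits plus leaves. At the end of a pass there are thus at most as many leaves as
  input cells, which makes the loops over pairs quadratic. Thirty steps per bit is generous.\<close>

lemma halts_PARSE:
  assumes "\<And>b N. b 4 \<le> n \<Longrightarrow> (\<forall>x\<in>{0, 5, 9}. b x = a x) \<Longrightarrow> halts R prog T 63 b N"
    and "a 2 + a 4 \<le> n" "a 9 = 0" "30 * a 2 + 10 + T \<le> T'"
  shows "halts R prog T' 12 a M"
  using assms
proof (induction "a 2" arbitrary: a T' M rule: less_induct)
  case less
  consider "a 2 = 0" | "a 2 = 1" | "a 2 = 2" | "a 2 \<ge> 3" by linarith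
  then show ?case
  proof cases
    case 1
    have "halts R prog (T' - 1) 63 a N" for N by (rule halts_mono[of T]) (use less.prems 1 in auto)
    with 1 show ?thesis by (subst halts_label) (use less.prems in \<open>simp_all add: halts_line\<close>)
  next
    case 4
    then have "a 2 = Suc (Suc (Suc (a 2 - 3)))" by simp
    then obtain i where i: "a 2 = Suc (Suc (Suc i))" ..
    define X where "X = 30 * i + 10 + T"
    have IH: "halts R prog T'' 12 b N"
      if "b 2 = i" "b 4 \<le> Suc (a 4)" "X \<le> T''" "b 0 = a 0" "b 5 = a 5" "b 9 = 0" for b N T''
      by (rule less.hyps) (use less.prems that i X_def in auto)
    have 0: "a 9 = 0" by (rule less.prems)
    have 1: "halts R prog T'' 33 b N"
      if "12 + X \<le> T''" "b 2 = i" "b 4 = a 4" "b 0 = a 0" "b 5 = a 5" "b 9 = 0" for b N T''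
      by (subst halts_label) (use that in \<open>simp_all add: halts_line IH\<close>)
    have 2: "halts R prog T'' 44 b N"
      if "20 + X \<le> T''" "b 2 = i" "b 4 = a 4" "b 0 = a 0" "b 5 = a 5" "b 9 = 0" for b N T''
      by (subst halts_label) (use that in \<open>simp_all add: halts_line IH 1\<close>)
    have "halts R prog (40 + X) 12 a N" for N
      by (subst halts_label) (use 0 in \<open>simp_all add: halts_line i IH 1 2\<close>)
    then show ?thesis
      by (rule halts_mono[rotated]) (use less.prems(4) i X_def in simp)
  qed (subst halts_label; use less.prems(3,4) in \<open>simp_all add: halts_line\<close>)+
qed

text \<open>Each remaining pass pays for a linear scan and a quadratic update of the Gram matrix;
  the summands outside the product pay for the final check.\<close>

lemma halts_PASS:
  "a 5 + k = a 0 \<Longrightarrow> a 9 = 0 \<Longrightarrow> a 4 \<le> a 0 \<Longrightarrow>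
    k * (10 * a 0 * a 0 + 40 * a 0 + 40) + 10 * a 0 * a 0 + 10 * a 0 + 10 \<le> T \<Longrightarrow> halts R prog T 2 a M"
proof (induction k arbitrary: a T M)
  case 0
  have 1: "halts R prog T'' 82 b N" if "b 6 = 0" "b 4 = a 4" "10 * a 0 * a 0 + 10 * a 0 + 2 \<le> T''" for b N T''
  proof (rule halts_PL2[where k = "b 4"])
    have "b 4 * (10 * b 4 + 10) \<le> a 0 * (10 * a 0 + 10)"
      by (intro mult_le_mono) (use that 0 in auto)
    then show "b 4 * (10 * b 4 + 10) + 2 \<le> T''" using that by (simp add: algebra_simps)
  qed (use that in simp)
  have 2: "halts R prog T'' 79 a N" if "10 * a 0 * a 0 + 10 * a 0 + 5 \<le> T''" for N T''
    by (subst halts_label) (use that in \<open>simp_all add: halts_line 1\<close>)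
  show ?case
    by (subst halts_label) (use 0 in \<open>simp_all add: halts_line 2\<close>)
next
  case (Suc k)
  define n where "n = a 0"
  define S where "S = k * (10 * n * n + 40 * n + 40) + 10 * n * n + 10 * n + 10"
  have IH: "halts R prog T'' 2 b N" if "b 5 = Suc (a 5)" "b 0 = n" "b 9 = 0" "b 4 \<le> n" "S \<le> T''" for b N T''
    by (rule Suc.IH) (use that Suc.prems in \<open>auto simp: n_def S_def\<close>)
  have 1: "halts R prog (S + 2) 77 b N" if "b 5 = a 5" "b 0 = n" "b 9 = 0" "b 4 \<le> n" for b N
    by (subst halts_label) (use that in \<open>simp_all add: halts_line IH\<close>)
  have 2: "halts R prog T'' 67 b N" if "b 6 = 0" "b 5 = a 5" "b 0 = n" "b 9 = 0" "b 4 \<le> n"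
      "10 * n * n + 10 * n + 4 + S \<le> T''" for b N T''
  proof (rule halts_PL[where k = "b 4" and T = "S + 2"])
    have "b 4 * (10 * b 4 + 10) \<le> n * (10 * n + 10)"
      by (intro mult_le_mono) (use that in auto)
    then show "b 4 * (10 * b 4 + 10) + 2 + (S + 2) \<le> T''" using that by (simp add: algebra_simps)
  qed (use that in \<open>auto intro: 1[simplified]\<close>)
  have 3: "halts R prog (10 * n * n + 10 * n + 8 + S) 63 b N" if "b 4 \<le> n" "b 5 = a 5" "b 0 = n" "b 9 = 0" for b N
    by (subst halts_label) (use that in \<open>simp_all add: halts_line 2\<close>)
  have 4: "halts R prog T'' 12 b N" if "b 5 = a 5" "b 0 = n" "b 9 = 0" "b 4 = 0" "b 2 = n"
      "40 * n + 10 * n * n + 18 + S \<le> T''" for b N T''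
  proof (rule halts_PARSE[where n = n and T = "10 * n * n + 10 * n + 8 + S"])
    fix c N'
    assume "c 4 \<le> n" "\<forall>x\<in>{0, 5, 9}. c x = b x"
    then show "halts R prog (10 * n * n + 10 * n + 8 + S) 63 c N'"
      by (intro 3) (use that in auto)
  qed (use that in auto)
  have "40 * n + 10 * n * n + 40 + S \<le> T"
    using Suc.prems(4) by (simp add: S_def n_def)
  then show ?case
    by (subst halts_label) (use Suc.prems(1-3) in \<open>simp_all add: halts_line 4 n_def[symmetric]\<close>)
qed

text \<open>The coefficients are those of n (10 n^2 + 40 n + 40) + 10 n^2 + 10 n + 10, the bound of
  \<open>halts_PASS\<close> for n passes, plus 2 steps that set the constants.\<close>

lemma poly_time_prog: "poly_time R prog [:12, 50, 50, 10:]"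
  unfolding poly_time_def
proof (intro ballI allI impI)
  fix xs :: "real list" and k c
  assume k: "(step R prog ^^ k) (initial xs) c"
  let ?n = "length xs"
  have "halts R prog T 2 a M" if "a 0 = ?n" "a 4 = 0" "a 5 = 0" "a 9 = 0"
      "10 + ?n * (50 + ?n * (50 + ?n * 10)) \<le> T" for a M T
    by (rule halts_PASS[where k = ?n]) (use that in \<open>auto simp: algebra_simps\<close>)
  then have "halts R prog (12 + ?n * (50 + ?n * (50 + ?n * 10))) 0 a M"
    if "a 0 = ?n" "a 4 = 0" "a 5 = 0" "a 9 = 0" for a M
    by (subst halts_label(1), subst halts_label(2)) (use that in \<open>simp add: numeral_2_eq_2\<close>)
  from halts_bound[OF this k[unfolded initial_def]]
  show "k \<le> poly [:12, 50, 50, 10:] ?n" by simp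
qed

section \<open>Parsing encoded terms\<close>

text \<open>\<open>lits b t\<close> lists the literals of the negation normal form of \<open>t\<close> (of \<open>\<not> t\<close> for \<open>\<not> b\<close>) from right
  to left, and \<open>lin R b t x\<close> the possible labels of these leaves for a root labelled \<open>x\<close>.\<close>
definition splits :: "real set \<Rightarrow> bool \<Rightarrow> real \<Rightarrow> (real \<times> real) set" where
  "splits R b x = (if b then {(x, x)} else {(y, x - y) | y. y \<in> R})"

fun lits :: "bool \<Rightarrow> oterm \<Rightarrow> (nat \<times> bool) list" where
  "lits b (Var n) = [(n, b)]"
| "lits b Zero = []"
| "lits b One = []"
| "lits b (Neg t) = lits (\<not> b) t"
| "lits b (And s t) = lits b t @ lits b s"
| "lits b (Or s t) = lits b t @ lits b s"

fun lin :: "real set \<Rightarrow> bool \<Rightarrow> oterm \<Rightarrow> real \<Rightarrow> real list set" where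
  "lin R b (Var n) x = {[x]}"
| "lin R b Zero x = (if b \<and> x \<noteq> 0 then {} else {[]})"
| "lin R b One x = (if \<not> b \<and> x \<noteq> 0 then {} else {[]})"
| "lin R b (Neg t) x = lin R (\<not> b) t x"
| "lin R b (And s t) x =
     (\<Union>(y, z)\<in>splits R b x. {us @ ws | us ws. us \<in> lin R b t y \<and> ws \<in> lin R b s z})"
| "lin R b (Or s t) x =
     (\<Union>(y, z)\<in>splits R (\<not> b) x. {us @ ws | us ws. us \<in> lin R b t y \<and> ws \<in> lin R b s z})"

lemma length_lin: "us \<in> lin R b t x \<Longrightarrow> length us = length (lits b t)"
  by (induction t arbitrary: b x us) (fastforce split: if_splits)+

definition recs :: "(nat \<times> bool) list \<Rightarrow> real list \<Rightarrow> (real \<times> real \<times> real) list" where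
  "recs L us = map (\<lambda>((n, b), x). (x, real n, of_bool b)) (zip L us)"

lemma recs_append: "length us = length L \<Longrightarrow> recs (L @ L') (us @ ws) = recs L us @ recs L' ws"
  by (simp add: recs_def)

lemma length_recs [simp]: "length us = length L \<Longrightarrow> length (recs L us) = length L"
  by (simp add: recs_def)

lemma nth_recs [simp]:
  "length us = length L \<Longrightarrow> i < length L \<Longrightarrow>
    recs L us ! i = (us ! i, real (fst (L ! i)), of_bool (snd (L ! i)))"
  by (simp add: recs_def split_beta)

abbreviation digit_code :: "nat \<Rightarrow> real list" where
  "digit_code n \<equiv> concat (map (\<lambda>b. if b then [1, 1, 1] else [1, 1, 0]) (digits n))"

lemma digits_0 [simp]: "digits 0 = []"
  by (simp add: digits.simps)

text \<open>Horner's scheme: read backwards, the little-endian digits arrive most significant first.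
  The leading digit of a positive index is 1, so the test against leading zeros never fires
  here.\<close>

lemma parse_digits:
  "parse R (rev (digit_code n) @ w) True st (ls @ [(x, 0, p)]) = parse R w True st (ls @ [(x, real n, p)])"
proof (induction n arbitrary: w rule: digits.induct)
  case (1 n)
  show ?case
  proof (cases "n = 0")
    case False
    have "digit_code n = (if odd n then [1, 1, 1] else [1, 1, 0]) @ digit_code (n div 2)"
      using False by (subst digits.simps) simp
    moreover have "real n = 2 * real (n div 2) + of_bool (odd n)"
      by (cases "even n") (auto elim!: evenE oddE)
    ultimately show ?thesis
      using 1 False by (auto split: if_splits)
  qed simp
qed

text \<open>Read backwards, the code of a term ends with its leftmost leaf, which therefore
  determines the digit flag after the term.\<close>

fun ends_var :: "oterm \<Rightarrow> bool" where
  "ends_var (Var n) = True"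
| "ends_var Zero = False"
| "ends_var One = False"
| "ends_var (Neg t) = ends_var t"
| "ends_var (And s t) = ends_var s"
| "ends_var (Or s t) = ends_var s"

text \<open>Backwards, the connective comes first and then the right operand, which is why
  \<open>lits\<close> and \<open>lin\<close> list \<open>t\<close> before \<open>s\<close>. The
  machine splits a scalar iff the first bit of the connective equals the polarity: \<open>Or\<close>
  (bit 1) at positive and \<open>And\<close> (bit 0) at negative polarity are the disjunctions of
  the negation normal form.\<close>

lemma parse_encode:
  "parse R (rev (encode t) @ w) fl ((x, of_bool b) # st) ls =
    (\<Union>us\<in>lin R b t x. parse R w (ends_var t) st (ls @ recs (lits b t) us))"
proof (induction t arbitrary: w fl x b st ls)
  case (Var n)
  show ?case by (simp add: parse_digits recs_def)
next
  case (Neg t)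
  have "1 - of_bool b = (of_bool (\<not> b) :: real)" by simp
  with Neg show ?case by simp
next
  case (And s t)
  have "parse R (rev (encode (And s t)) @ w) fl ((x, of_bool b) # st) ls =
      (\<Union>(y, z)\<in>splits R b x. parse R (rev (encode t) @ rev (encode s) @ w) False
         ((y, of_bool b) # (z, of_bool b) # st) ls)"
    by (cases b) (auto simp: splits_def)
  also have "\<dots> = (\<Union>(y, z)\<in>splits R b x. \<Union>us\<in>lin R b t y. \<Union>ws\<in>lin R b s z.
      parse R w (ends_var s) st (ls @ recs (lits b t @ lits b s) (us @ ws)))"
    unfolding And.IH by (intro SUP_cong refl) (auto simp: recs_append length_lin)
  also have "\<dots> = (\<Union>us\<in>lin R b (And s t) x.
      parse R w (ends_var (And s t)) st (ls @ recs (lits b (And s t)) us))"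
    by (auto; blast)
  finally show ?case .
next
  case (Or s t)
  have "parse R (rev (encode (Or s t)) @ w) fl ((x, of_bool b) # st) ls =
      (\<Union>(y, z)\<in>splits R (\<not> b) x. parse R (rev (encode t) @ rev (encode s) @ w) False
         ((y, of_bool b) # (z, of_bool b) # st) ls)"
    by (cases b) (auto simp: splits_def)
  also have "\<dots> = (\<Union>(y, z)\<in>splits R (\<not> b) x. \<Union>us\<in>lin R b t y. \<Union>ws\<in>lin R b s z.
      parse R w (ends_var s) st (ls @ recs (lits b t @ lits b s) (us @ ws)))"
    unfolding Or.IH by (intro SUP_cong refl) (auto simp: recs_append length_lin)
  also have "\<dots> = (\<Union>us\<in>lin R b (Or s t) x.
      parse R w (ends_var (Or s t)) st (ls @ recs (lits b (Or s t)) us))"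
    by (auto; blast)
  finally show ?case .
qed (auto simp: recs_def)

corollary parse_encode_top:
  "parse R (rev (encode t)) False [(r, 1)] [] = recs (lits True t) ` lin R True t r"
  using parse_encode[of R t "[]" False r True "[]" "[]"] by auto

text \<open>Converse of \<open>parse_encode\<close>, needed to reject bit strings that are no code
  words: the stack height counts the terms still to be read. With the flag up, reading may be inside
  a variable; then \<open>k\<close> is the index read so far, \<open>u\<close> the digit symbols
  still to come and \<open>n\<close> the complete index.\<close>

lemma parse_sound:
  assumes "set w \<subseteq> {0, 1}" "parse R w fl st ls \<noteq> {}"
    and "fl \<Longrightarrow> fst (snd (last ls)) = real k"
  shows "\<exists>n u ts. length ts = length st \<and> w = u @ concat (map (\<lambda>t. rev (encode t)) ts) \<and>
    (if fl then digit_code n = rev u @ digit_code k else u = [])"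
  using assms
proof (induction "length w" arbitrary: w fl st ls k rule: less_induct)
  case less
  consider "w = []" | x where "w = [x]" | x y where "w = [x, y]" | c b a w' where "w = c # b # a # w'"
    by (metis neq_Nil_conv)
  then show ?case
  proof cases
    case 1
    then show ?thesis using less.prems(2) by (auto split: if_splits intro!: exI[of _ k])
  next
    case (4 c b a w')
    have bits: "a = 0 \<or> a = 1" "b = 0 \<or> b = 1" "c = 0 \<or> c = 1" and w': "set w' \<subseteq> {0, 1}"
      using less.prems(1) 4 by auto
    have IHF: "\<exists>ts. length ts = length st' \<and> w' = concat (map (\<lambda>t. rev (encode t)) ts)"
      if "parse R w' False st' ls' \<noteq> {}" for st' ls'
      using less.hyps[OF _ w' that] 4 by auto
    have IHT: "\<exists>n u ts. length ts = length st' \<and> w' = u @ concat (map (\<lambda>t. rev (encode t)) ts) \<and>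
        digit_code n = rev u @ digit_code k'"
      if "parse R w' True st' ls' \<noteq> {}" "fst (snd (last ls')) = real k'" for st' ls' k'
      using less.hyps[OF _ w' that(1), of k'] that(2) 4 by auto
    note p = less.prems(2)[unfolded 4]
    show ?thesis
    proof (cases "a = 1 \<and> b = 1")
      case True
      obtain x v q where l: "last ls = (x, v, q)" by (cases "last ls")
      from p True l have fl: "fl" and nz: "2 * v + c \<noteq> 0"
        and p': "parse R w' True st (butlast ls @ [(x, 2 * v + c, q)]) \<noteq> {}"
        by (auto split: if_splits)
      \<comment> \<open>The index after one more digit. It is nonzero by the test in
        \<open>parse\<close>, so \<open>digits k'\<close> unfolds to this digit followed by
        \<open>digits k\<close>; without that test, padded codes of variables would be
        accepted.\<close>
      define k' where "k' = 2 * k + of_bool (c = 1)"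
      have v: "2 * v + c = real k'" using less.prems(3)[OF fl] l bits(3) by (auto simp: k'_def)
      then have "k' \<noteq> 0" using nz by auto
      moreover have "odd k' \<longleftrightarrow> c = 1" "k' div 2 = k" by (auto simp: k'_def)
      ultimately have dk: "digit_code k' = [1, 1, c] @ digit_code k"
        using bits(3) by (subst digits.simps) auto
      from IHT[OF p', of k'] v obtain n u ts where "length ts = length st"
        "w' = u @ concat (map (\<lambda>t. rev (encode t)) ts)" "digit_code n = rev u @ digit_code k'"
        by auto
      then show ?thesis using fl True dk 4
        by (intro exI[of _ n] exI[of _ "c # 1 # 1 # u"] exI[of _ ts]) auto
    next
      case False
      with p obtain x q st' where st: "st = (x, q) # st'" by (cases st) auto
      have "\<exists>ts. length ts = length st \<and> w = concat (map (\<lambda>t. rev (encode t)) ts)"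
      proof (cases "a = 1 \<and> c = 1")
        case True
        with p False st have "parse R w' True st' (ls @ [(x, 0, q)]) \<noteq> {}" by auto
        \<comment> \<open>The closing symbol of a variable is met before its digits, so the index
          read so far is 0.\<close>
        from IHT[OF this, of 0] obtain n u ts where "length ts = length st'"
          "w' = u @ concat (map (\<lambda>t. rev (encode t)) ts)" "digit_code n = rev u" by auto
        then show ?thesis using True False st 4 bits by (intro exI[of _ "Var n # ts"]) auto
      next
        case nvar: False
        show ?thesis
        proof (cases "a = 1 \<or> b = 1 \<and> c = 1")
          case True
          with p False nvar st obtain y z where "parse R w' False ((y, q) # (z, q) # st') ls \<noteq> {}"
            by (auto split: if_splits)
          from IHF[OF this] obtain ts where ts: "length ts = Suc (Suc (length st'))"
            "w' = concat (map (\<lambda>t. rev (encode t)) ts)" by auto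
          then obtain t1 t2 ts' where "ts = t1 # t2 # ts'" by (auto simp: length_Suc_conv)
          then show ?thesis using ts True False nvar st 4 bits
            by (intro exI[of _ "(if a = 1 then Or t2 t1 else And t2 t1) # ts'"]) auto
        next
          case nbin: False
          show ?thesis
          proof (cases "b = 1")
            case True
            with p False nvar nbin st have "parse R w' False ((x, 1 - q) # st') ls \<noteq> {}" by auto
            from IHF[OF this] obtain t ts where "length ts = length st'"
              "w' = concat (map (\<lambda>t. rev (encode t)) (t # ts))" by (auto simp: length_Suc_conv)
            then show ?thesis using True False nvar nbin st 4 bits
              by (intro exI[of _ "Neg t # ts"]) auto
          next
            case nneg: False
            with p False nvar nbin st have "parse R w' False st' ls \<noteq> {}" by (auto split: if_splits)
            from IHF[OF this] obtain ts where "length ts = length st'"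
              "w' = concat (map (\<lambda>t. rev (encode t)) ts)" by auto
            then show ?thesis using False nvar nbin nneg st 4 bits
              by (intro exI[of _ "(if c = 1 then One else Zero) # ts"]) auto
          qed
        qed
      qed
      then obtain ts where "length ts = length st" "w = concat (map (\<lambda>t. rev (encode t)) ts)" by blast
      \<comment> \<open>A symbol other than a digit completes a pending index: no digit symbols
        remain and the index is \<open>k\<close>.\<close>
      then show ?thesis by (intro exI[of _ k] exI[of _ "[]"] exI[of _ ts]) auto
    qed
  qed (use less.prems(2) in auto)
qed

lemma set_encode: "set (encode t) \<subseteq> {0, 1}"
  by (induction t) auto

corollary parse_imp_encode:
  assumes "set xs \<subseteq> {0, 1}" "parse R (rev xs) False [o1] [] \<noteq> {}"
  obtains t where "xs = encode t"
proof -
  from parse_sound[of "rev xs" R False "[o1]" "[]" 0] assms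
  obtain ts where "length ts = 1" "rev xs = concat (map (\<lambda>t. rev (encode t)) ts)" by auto
  then obtain t where "rev xs = rev (encode t)" by (auto simp: length_Suc_conv)
  then show ?thesis using that by simp
qed

section \<open>Feasibility, the condition decided by the machine\<close>

definition conflict :: "nat \<times> bool \<Rightarrow> nat \<times> bool \<Rightarrow> bool" where
  "conflict l l' \<longleftrightarrow> fst l = fst l' \<and> snd l \<noteq> snd l'"

lemma add_gram_recs:
  fixes i j :: nat
  assumes "length us = length L" "i < length L" "j < length L"
  shows "add_gram (recs L us) D (i * length L + j) = D (i * length L + j) + us ! i * us ! j"
proof -
  have "i * length L + j < Suc i * length L" using assms by simp
  also have "\<dots> \<le> length L * length L" using assms by (intro mult_right_mono) auto
  finally have "i * length L + j < length L * length L" .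
  moreover have "length L \<noteq> 0" using assms by auto
  then have "(i * length L + j) div length L = i" "(i * length L + j) mod length L = j"
    using assms by (simp_all add: div_add1_eq[of "i * length L"])
  ultimately show ?thesis using assms by (simp add: add_gram_def Let_def)
qed

text \<open>\<open>X j\<close> is the leaf labelling produced in pass \<open>j\<close>. All
  labellings share the literals \<open>L\<close>, so every pass hands the same variables and
  polarities on to \<open>final\<close>, and the guesses add up in \<open>E\<close> and
  \<open>D\<close>; \<open>us\<close> supplies the list when no pass remains.\<close>

lemma passes_encode:
  assumes "length us = length (lits True t)"
  defines "L \<equiv> lits True t"
  shows "passes R (rev (encode t)) k E D (recs L us) \<longleftrightarrow>
    (\<exists>r X. (\<forall>j<k. r j \<in> R \<and> X j \<in> lin R True t (r j)) \<and> E + (\<Sum>j<k. r j * r j) \<noteq> 0 \<and>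
      (\<forall>p<length L. \<forall>q<length L. conflict (L ! p) (L ! q) \<longrightarrow>
        D (p * length L + q) + (\<Sum>j<k. X j ! p * X j ! q) = 0))"
  using assms(1)
proof (induction k arbitrary: E D us)
  case 0
  then show ?case by (auto simp: final_def conflict_def L_def)
next
  case (Suc k)
  let ?P = "\<lambda>k E D r X. (\<forall>j<k. r j \<in> R \<and> X j \<in> lin R True t (r j)) \<and> E + (\<Sum>j<k. r j * r j) \<noteq> 0 \<and>
      (\<forall>p<length L. \<forall>q<length L. conflict (L ! p) (L ! q) \<longrightarrow>
        D (p * length L + q) + (\<Sum>j<k. X j ! p * X j ! q) = 0)"
  have split: "?P (Suc k) E D r X \<longleftrightarrow> r 0 \<in> R \<and> X 0 \<in> lin R True t (r 0) \<and>
      ?P k (E + r 0 * r 0) (add_gram (recs L (X 0)) D) (\<lambda>j. r (Suc j)) (\<lambda>j. X (Suc j))" for r X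
  proof (cases "X 0 \<in> lin R True t (r 0)")
    case True
    from length_lin[OF this] show ?thesis
      by (simp add: All_less_Suc2 sum.lessThan_Suc_shift add_gram_recs L_def add.assoc del: sum.lessThan_Suc)
  qed auto
  have "passes R (rev (encode t)) (Suc k) E D (recs L us) \<longleftrightarrow>
      (\<exists>r0\<in>R. \<exists>X0\<in>lin R True t r0. \<exists>r X. ?P k (E + r0 * r0) (add_gram (recs L X0) D) r X)"
    by (simp add: parse_encode_top Suc.IH length_lin flip: L_def)
  also have "\<dots> \<longleftrightarrow> (\<exists>r X. ?P (Suc k) E D r X)" unfolding split
  proof (intro iffI; elim bexE exE)
    fix r0 X0 r X
    assume "r0 \<in> R" "X0 \<in> lin R True t r0" "?P k (E + r0 * r0) (add_gram (recs L X0) D) r X"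
    then show "\<exists>r X. r 0 \<in> R \<and> X 0 \<in> lin R True t (r 0) \<and>
        ?P k (E + r 0 * r 0) (add_gram (recs L (X 0)) D) (\<lambda>j. r (Suc j)) (\<lambda>j. X (Suc j))"
      by (intro exI[of _ "case_nat r0 r"] exI[of _ "case_nat X0 X"]) simp
  next
    fix r X
    assume "r 0 \<in> R \<and> X 0 \<in> lin R True t (r 0) \<and>
        ?P k (E + r 0 * r 0) (add_gram (recs L (X 0)) D) (\<lambda>j. r (Suc j)) (\<lambda>j. X (Suc j))"
    then show "\<exists>r0\<in>R. \<exists>X0\<in>lin R True t r0. \<exists>r X. ?P k (E + r0 * r0) (add_gram (recs L X0) D) r X"
      by (intro bexI[of _ "r 0"] bexI[of _ "X 0"] exI[of _ "\<lambda>j. r (Suc j)"] exI[of _ "\<lambda>j. X (Suc j)"]) auto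
  qed
  finally show ?case .
qed

text \<open>\<open>r\<close> is the root vector and \<open>X j ! p\<close> the coordinate
  \<open>j\<close> of the vector at leaf \<open>p\<close>, so the last sum is an entry of the Gram
  matrix of the leaf vectors.\<close>

definition feasible :: "real set \<Rightarrow> nat \<Rightarrow> oterm \<Rightarrow> bool" where
  "feasible R d t \<longleftrightarrow> (\<exists>r X. (\<forall>j<d. r j \<in> R \<and> X j \<in> lin R True t (r j)) \<and> (\<exists>j<d. r j \<noteq> 0) \<and>
      (\<forall>p<length (lits True t). \<forall>q<length (lits True t). conflict (lits True t ! p) (lits True t ! q) \<longrightarrow>
        (\<Sum>j<d. X j ! p * X j ! q) = 0))"

lemma passes_feasible:
  assumes "set xs \<subseteq> {0, 1}"
  shows "passes R (rev xs) (length xs) 0 (\<lambda>_. 0) [] \<longleftrightarrow> (\<exists>t. xs = encode t \<and> feasible R (length xs) t)"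
proof (cases "length xs")
  case 0
  then show ?thesis by (auto simp: final_def feasible_def)
next
  case (Suc k)
  show ?thesis
  proof (cases "\<exists>t. xs = encode t")
    case True
    then obtain t where t: "xs = encode t" by blast
    \<comment> \<open>At least one pass follows and overwrites the leaf list, so \<open>[]\<close>
      may be exchanged for a list of the shape that \<open>passes_encode\<close> expects.\<close>
    obtain us :: "real list" where us: "length us = length (lits True t)" using Ex_list_of_length by blast
    have "passes R (rev xs) (length xs) 0 (\<lambda>_. 0) [] =
        passes R (rev (encode t)) (length xs) 0 (\<lambda>_. 0) (recs (lits True t) us)"
      unfolding Suc unfolding t by simp
    \<comment> \<open>Over the reals, the sum of squares tested by the machine vanishes only if all
      its terms do.\<close>
    also have "\<dots> = feasible R (length xs) t"
      unfolding passes_encode[OF us] feasible_def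
      by (simp add: sum_nonneg_eq_0_iff Bex_def)
    finally show ?thesis using t inj_encode by (auto dest: injD)
  next
    case False
    then have "parse R (rev xs) False [(r, 1)] [] = {}" for r
      using parse_imp_encode[OF assms] by blast
    then show ?thesis using False by (simp add: Suc)
  qed
qed

section \<open>Embeddings of subspace lattices\<close>

lemma scalar_prod_sum:
  fixes x y :: "complex vec"
  assumes "x \<in> carrier_vec d" "y \<in> carrier_vec d"
  shows "conjugate x \<bullet> y = (\<Sum>i<d. cnj (x $ i) * y $ i)"
  using assms by (simp add: scalar_prod_def atLeast0LessThan)

lemma star_subfieldD:
  assumes "star_subfield F"
  shows "0 \<in> F" "1 \<in> F" "x \<in> F \<Longrightarrow> y \<in> F \<Longrightarrow> x + y \<in> F" "x \<in> F \<Longrightarrow> y \<in> F \<Longrightarrow> x * y \<in> F"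
    "x \<in> F \<Longrightarrow> - x \<in> F" "x \<in> F \<Longrightarrow> inverse x \<in> F" "x \<in> F \<Longrightarrow> cnj x \<in> F"
  using assms unfolding star_subfield_def by blast+

lemma space_over_carrier: "v \<in> space_over F d \<Longrightarrow> v \<in> carrier_vec d"
  unfolding space_over_def by blast

lemma lin_subspace_subset: "lin_subspace F d U \<Longrightarrow> U \<subseteq> space_over F d"
  unfolding lin_subspace_def by (rule conjunct1)

lemma lin_subspaceD:
  assumes "lin_subspace F d U"
  shows "0\<^sub>v d \<in> U" "u \<in> U \<Longrightarrow> v \<in> U \<Longrightarrow> u + v \<in> U" "c \<in> F \<Longrightarrow> u \<in> U \<Longrightarrow> c \<cdot>\<^sub>v u \<in> U"
  using assms unfolding lin_subspace_def by blast+

lemma lin_subspace_carrier: "lin_subspace F d U \<Longrightarrow> u \<in> U \<Longrightarrow> u \<in> carrier_vec d"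
  using lin_subspace_subset[of F d U] space_over_carrier[of u F d] by blast

lemma space_over_add:
  assumes "star_subfield F" "u \<in> space_over F d" "v \<in> space_over F d"
  shows "u + v \<in> space_over F d"
proof -
  have "(u + v) $ i = u $ i + v $ i" if "i < d" for i
    using that space_over_carrier[OF assms(3)] by simp
  then show ?thesis
    using assms(2,3) star_subfieldD(3)[OF assms(1)] by (simp add: space_over_def)
qed

lemma space_over_smult:
  assumes "star_subfield F" "c \<in> F" "v \<in> space_over F d"
  shows "c \<cdot>\<^sub>v v \<in> space_over F d"
proof -
  have "(c \<cdot>\<^sub>v v) $ i = c * v $ i" if "i < d" for i
    using that space_over_carrier[OF assms(3)] by simp
  then show ?thesis
    using assms(2,3) star_subfieldD(4)[OF assms(1)] by (simp add: space_over_def)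
qed

lemma space_over_zero: "star_subfield F \<Longrightarrow> 0\<^sub>v d \<in> space_over F d"
  by (simp add: space_over_def star_subfieldD(1))

lemma lin_subspace_zero: "star_subfield F \<Longrightarrow> lin_subspace F d {0\<^sub>v d}"
  by (auto simp: lin_subspace_def space_over_zero intro!: eq_vecI)

lemma lin_subspace_space: "star_subfield F \<Longrightarrow> lin_subspace F d (space_over F d)"
  by (simp add: lin_subspace_def space_over_zero space_over_add space_over_smult)

lemma lin_subspace_Int: "lin_subspace F d U \<Longrightarrow> lin_subspace F d W \<Longrightarrow> lin_subspace F d (U \<inter> W)"
  by (simp add: lin_subspace_def le_infI1)

lemma lin_subspace_sum:
  assumes "star_subfield F" "lin_subspace F d U" "lin_subspace F d W"
  shows "lin_subspace F d {u + w | u w. u \<in> U \<and> w \<in> W}"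
  unfolding lin_subspace_def
proof (intro conjI ballI subsetI)
  note U = lin_subspaceD[OF assms(2)] and W = lin_subspaceD[OF assms(3)]
  note cU = lin_subspace_carrier[OF assms(2)] and cW = lin_subspace_carrier[OF assms(3)]
  have "0\<^sub>v d = 0\<^sub>v d + (0\<^sub>v d :: complex vec)" by simp
  then show "0\<^sub>v d \<in> {u + w | u w. u \<in> U \<and> w \<in> W}"
    using U(1) W(1) by blast
  fix x assume "x \<in> {u + w | u w. u \<in> U \<and> w \<in> W}"
  then obtain u w where x: "x = u + w" "u \<in> U" "w \<in> W" by blast
  show "x \<in> space_over F d"
    unfolding x(1) using lin_subspace_subset[OF assms(2)] lin_subspace_subset[OF assms(3)] x(2,3)
    by (intro space_over_add[OF assms(1)]) blast+
  {
    fix y assume "y \<in> {u + w | u w. u \<in> U \<and> w \<in> W}"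
    then obtain u' w' where y: "y = u' + w'" "u' \<in> U" "w' \<in> W" by blast
    have "x + y = (u + u') + (w + w')"
      unfolding x(1) y(1) using cU[OF x(2)] cW[OF x(3)] cU[OF y(2)] cW[OF y(3)]
      by (intro eq_vecI) (simp_all add: algebra_simps)
    then show "x + y \<in> {u + w | u w. u \<in> U \<and> w \<in> W}"
      using U(2)[OF x(2) y(2)] W(2)[OF x(3) y(3)] by blast
  }
  fix c assume c: "c \<in> F"
  have "c \<cdot>\<^sub>v x = c \<cdot>\<^sub>v u + c \<cdot>\<^sub>v w"
    unfolding x(1) using smult_add_distrib_vec[OF cU[OF x(2)] cW[OF x(3)]] .
  then show "c \<cdot>\<^sub>v x \<in> {u + w | u w. u \<in> U \<and> w \<in> W}"
    using U(3)[OF c x(2)] W(3)[OF c x(3)] by blast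
qed

lemma lin_subspace_orth:
  assumes "star_subfield F" "U \<subseteq> space_over F d"
  shows "lin_subspace F d {y \<in> space_over F d. \<forall>x\<in>U. conjugate x \<bullet> y = 0}"
proof -
  have c: "conjugate x \<in> carrier_vec d" if "x \<in> U" for x
    using that assms(2) space_over_carrier by auto
  show ?thesis
    unfolding lin_subspace_def
  proof (intro conjI ballI)
    fix y z
    assume "y \<in> {y \<in> space_over F d. \<forall>x\<in>U. conjugate x \<bullet> y = 0}"
      "z \<in> {y \<in> space_over F d. \<forall>x\<in>U. conjugate x \<bullet> y = 0}"
    then show "y + z \<in> {y \<in> space_over F d. \<forall>x\<in>U. conjugate x \<bullet> y = 0}"
      using scalar_prod_add_distrib[OF c, of _ y z] space_over_carrier[of y F d] space_over_carrier[of z F d]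
      by (simp add: space_over_add[OF assms(1)])
  next
    fix a y
    assume "a \<in> F" "y \<in> {y \<in> space_over F d. \<forall>x\<in>U. conjugate x \<bullet> y = 0}"
    then show "a \<cdot>\<^sub>v y \<in> {y \<in> space_over F d. \<forall>x\<in>U. conjugate x \<bullet> y = 0}"
      using scalar_prod_smult_distrib[OF c, of _ y a] space_over_carrier[of y F d]
      by (simp add: space_over_smult[OF assms(1)])
  qed (use c in \<open>auto simp: space_over_zero[OF assms(1)]\<close>)
qed

text \<open>Preserving the operations transfers strong satisfiability; \<open>bot_inj\<close> is the
  part of injectivity that keeps a nonzero value nonzero. Transfer goes from \<open>L\<close> to
  \<open>L'\<close> only, so an equivalence takes two embeddings, which may change the
  dimension.\<close>

locale ortho_embedding =
  fixes L :: "'a ortho_struct" and L' :: "'b ortho_struct" and f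
  assumes closed: "ol_bot L \<in> carrier L" "ol_top L \<in> carrier L"
      "\<And>U. U \<in> carrier L \<Longrightarrow> ol_neg L U \<in> carrier L"
      "\<And>U W. U \<in> carrier L \<Longrightarrow> W \<in> carrier L \<Longrightarrow> ol_meet L U W \<in> carrier L"
      "\<And>U W. U \<in> carrier L \<Longrightarrow> W \<in> carrier L \<Longrightarrow> ol_join L U W \<in> carrier L"
    and carr: "\<And>U. U \<in> carrier L \<Longrightarrow> f U \<in> carrier L'"
    and bot: "f (ol_bot L) = ol_bot L'"
    and top: "f (ol_top L) = ol_top L'"
    and neg: "\<And>U. U \<in> carrier L \<Longrightarrow> f (ol_neg L U) = ol_neg L' (f U)"
    and meet: "\<And>U W. U \<in> carrier L \<Longrightarrow> W \<in> carrier L \<Longrightarrow> f (ol_meet L U W) = ol_meet L' (f U) (f W)"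
    and join: "\<And>U W. U \<in> carrier L \<Longrightarrow> W \<in> carrier L \<Longrightarrow> f (ol_join L U W) = ol_join L' (f U) (f W)"
    and bot_inj: "\<And>U. U \<in> carrier L \<Longrightarrow> f U = ol_bot L' \<Longrightarrow> U = ol_bot L"
begin

lemma eval_term_embedding:
  assumes "range a \<subseteq> carrier L"
  shows "eval_term L a t \<in> carrier L \<and> f (eval_term L a t) = eval_term L' (f \<circ> a) t"
  using assms by (induction t) (auto simp: closed bot top neg meet join)

lemma strongly_sat_in_embedding: "strongly_sat_in L t \<Longrightarrow> strongly_sat_in L' t"
  unfolding strongly_sat_in_def
proof (elim exE conjE)
  fix a assume a: "range a \<subseteq> carrier L" "eval_term L a t = ol_top L"
  have "range (f \<circ> a) \<subseteq> carrier L'" using a(1) carr by auto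
  moreover have "eval_term L' (f \<circ> a) t = ol_top L'"
    using eval_term_embedding[OF a(1), of t] a(2) top by simp
  ultimately show "\<exists>a. range a \<subseteq> carrier L' \<and> eval_term L' a t = ol_top L'" by blast
qed

lemma weakly_sat_in_embedding: "weakly_sat_in L t \<Longrightarrow> weakly_sat_in L' t"
  unfolding weakly_sat_in_def
proof (elim exE conjE)
  fix a assume a: "range a \<subseteq> carrier L" "eval_term L a t \<noteq> ol_bot L"
  have "range (f \<circ> a) \<subseteq> carrier L'" using a(1) carr by auto
  moreover have "eval_term L' (f \<circ> a) t \<noteq> ol_bot L'"
  proof
    assume "eval_term L' (f \<circ> a) t = ol_bot L'"
    then have "f (eval_term L a t) = ol_bot L'" using eval_term_embedding[OF a(1), of t] by simp
    then have "eval_term L a t = ol_bot L" using eval_term_embedding[OF a(1), of t] by (intro bot_inj) simp_all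
    then show False using a(2) by simp
  qed
  ultimately show "\<exists>a. range a \<subseteq> carrier L' \<and> eval_term L' a t \<noteq> ol_bot L'" by blast
qed

end

lemma subspace_lattice_simps [simp]:
  "carrier (subspace_lattice F d) = {U. lin_subspace F d U}"
  "ol_meet (subspace_lattice F d) = (\<inter>)"
  "ol_join (subspace_lattice F d) U W = {u + w | u w. u \<in> U \<and> w \<in> W}"
  "ol_neg (subspace_lattice F d) U = {y \<in> space_over F d. \<forall>x\<in>U. conjugate x \<bullet> y = 0}"
  "ol_bot (subspace_lattice F d) = {0\<^sub>v d}"
  "ol_top (subspace_lattice F d) = space_over F d"
  by (simp_all add: subspace_lattice_def)

lemma subspace_lattice_closed:
  fixes d :: nat
  assumes F: "star_subfield F"
  defines "L \<equiv> subspace_lattice F d"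
  shows "ol_bot L \<in> carrier L" "ol_top L \<in> carrier L"
    "U \<in> carrier L \<Longrightarrow> ol_neg L U \<in> carrier L"
    "U \<in> carrier L \<Longrightarrow> W \<in> carrier L \<Longrightarrow> ol_meet L U W \<in> carrier L"
    "U \<in> carrier L \<Longrightarrow> W \<in> carrier L \<Longrightarrow> ol_join L U W \<in> carrier L"
  unfolding L_def subspace_lattice_simps mem_Collect_eq
  subgoal by (rule lin_subspace_zero[OF F])
  subgoal by (rule lin_subspace_space[OF F])
  subgoal by (rule lin_subspace_orth[OF F lin_subspace_subset])
  subgoal by (rule lin_subspace_Int)
  subgoal by (rule lin_subspace_sum[OF F])
  done

section \<open>Complexification\<close>

definition re_vec :: "complex vec \<Rightarrow> complex vec" where
  "re_vec v = vec (dim_vec v) (\<lambda>i. of_real (Re (v $ i)))"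

definition im_vec :: "complex vec \<Rightarrow> complex vec" where
  "im_vec v = vec (dim_vec v) (\<lambda>i. of_real (Im (v $ i)))"

lemma re_im_carrier [simp]:
  "re_vec v \<in> carrier_vec d \<longleftrightarrow> v \<in> carrier_vec d" "im_vec v \<in> carrier_vec d \<longleftrightarrow> v \<in> carrier_vec d"
  unfolding carrier_dim_vec re_vec_def im_vec_def dim_vec by (rule refl)+

lemma re_im_add:
  assumes "u \<in> carrier_vec d" "v \<in> carrier_vec d"
  shows "re_vec (u + v) = re_vec u + re_vec v" "im_vec (u + v) = im_vec u + im_vec v"
  subgoal by (rule eq_vecI) (use assms in \<open>simp_all add: re_vec_def\<close>)
  subgoal by (rule eq_vecI) (use assms in \<open>simp_all add: im_vec_def\<close>)
  done

lemma re_im_smult: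
  "re_vec (c \<cdot>\<^sub>v v) = of_real (Re c) \<cdot>\<^sub>v re_vec v + of_real (- Im c) \<cdot>\<^sub>v im_vec v"
  "im_vec (c \<cdot>\<^sub>v v) = of_real (Re c) \<cdot>\<^sub>v im_vec v + of_real (Im c) \<cdot>\<^sub>v re_vec v"
  subgoal by (rule eq_vecI) (simp_all add: re_vec_def im_vec_def)
  subgoal by (rule eq_vecI) (simp_all add: re_vec_def im_vec_def)
  done

lemma re_im_decomp: "v = re_vec v + \<i> \<cdot>\<^sub>v im_vec v"
  by (rule eq_vecI) (simp_all add: re_vec_def im_vec_def complex_eq_iff)

lemma re_im_of_real:
  assumes "u \<in> space_over (F \<inter> \<real>) d" "w \<in> space_over (F \<inter> \<real>) d"
  shows "re_vec (u + \<i> \<cdot>\<^sub>v w) = u" "im_vec (u + \<i> \<cdot>\<^sub>v w) = w"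
proof -
  have u: "u \<in> carrier_vec d" and w: "w \<in> carrier_vec d"
    using assms by (simp_all add: space_over_def)
  have "u $ i \<in> \<real>" "w $ i \<in> \<real>" if "i < d" for i
    using assms that by (simp_all add: space_over_def)
  then have i: "Im (u $ i) = 0" "Im (w $ i) = 0" if "i < d" for i
    using that by (simp_all add: complex_is_Real_iff)
  show "re_vec (u + \<i> \<cdot>\<^sub>v w) = u"
    by (rule eq_vecI) (use u w i in \<open>simp_all add: re_vec_def complex_eq_iff\<close>)
  show "im_vec (u + \<i> \<cdot>\<^sub>v w) = w"
    by (rule eq_vecI) (use u w i in \<open>simp_all add: im_vec_def complex_eq_iff\<close>)
qed

text \<open>For a subspace \<open>U\<close> of real vectors this is \<open>U + \<i> U\<close>. In
  terms of real and imaginary parts, preservation of meets is immediate.\<close>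

definition complexify :: "nat \<Rightarrow> complex vec set \<Rightarrow> complex vec set" where
  "complexify d U = {v \<in> carrier_vec d. re_vec v \<in> U \<and> im_vec v \<in> U}"

text \<open>Cells \<open>i\<close> and \<open>d + i\<close> hold the real and imaginary part of
  entry \<open>i\<close>; on real vectors this is the usual identification of 2d real with d complex
  coordinates.\<close>

definition merge :: "nat \<Rightarrow> complex vec \<Rightarrow> complex vec" where
  "merge d v = vec d (\<lambda>i. v $ i + \<i> * v $ (d + i))"

definition unmerge :: "nat \<Rightarrow> complex vec \<Rightarrow> complex vec" where
  "unmerge d z = vec (d + d) (\<lambda>i. of_real (if i < d then Re (z $ i) else Im (z $ (i - d))))"

text \<open>The second alternative of the standing assumption, restated through real and imaginary
  parts of elements; it forces \<open>\<i>\<close> into \<open>F\<close>.\<close>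

locale complex_field =
  fixes F :: "complex set"
  assumes sub: "star_subfield F"
    and mem: "\<And>z. z \<in> F \<longleftrightarrow> complex_of_real (Re z) \<in> F \<and> complex_of_real (Im z) \<in> F"
begin

abbreviation "K \<equiv> F \<inter> \<real>"

lemma subK: "star_subfield K"
  using star_subfieldD[OF sub] by (simp add: star_subfield_def Reals_cnj_iff)

lemma mem_iff: "z \<in> F \<longleftrightarrow> of_real (Re z) \<in> K \<and> of_real (Im z) \<in> K"
  by (subst mem) simp

lemma i_mem: "\<i> \<in> F"
  using star_subfieldD(1,2)[OF sub] mem[of \<i>] by simp

lemma space_iff:
  "v \<in> space_over F d \<longleftrightarrow> v \<in> carrier_vec d \<and> re_vec v \<in> space_over K d \<and> im_vec v \<in> space_over K d"
  by (auto simp: space_over_def re_vec_def im_vec_def mem[of "v $ i" for i])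

lemma uminus_K: "of_real x \<in> K \<Longrightarrow> of_real (- x) \<in> K"
  using star_subfieldD(5)[OF subK, of "of_real x"] by simp

lemma complexify_subspace:
  assumes U: "lin_subspace K d U"
  shows "lin_subspace F d (complexify d U)"
  unfolding lin_subspace_def
proof (intro conjI ballI)
  show "complexify d U \<subseteq> space_over F d"
    using lin_subspace_subset[OF U] by (auto simp: complexify_def space_iff)
  have "re_vec (0\<^sub>v d) = 0\<^sub>v d" "im_vec (0\<^sub>v d) = 0\<^sub>v d"
    by (auto simp: re_vec_def im_vec_def)
  then show "0\<^sub>v d \<in> complexify d U" using lin_subspaceD(1)[OF U] by (simp add: complexify_def)
next
  fix u v assume "u \<in> complexify d U" "v \<in> complexify d U"
  then show "u + v \<in> complexify d U"
    using lin_subspaceD(2)[OF U] by (simp add: complexify_def re_im_add[of _ d])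
next
  fix c u assume c: "c \<in> F" and u: "u \<in> complexify d U"
  have "of_real (Re c) \<in> K" "of_real (Im c) \<in> K" "of_real (- Im c) \<in> K"
    using c mem_iff uminus_K by blast+
  note lin_subspaceD(3)[OF U this(1)] lin_subspaceD(3)[OF U this(2)] lin_subspaceD(3)[OF U this(3)]
  with u show "c \<cdot>\<^sub>v u \<in> complexify d U"
    using lin_subspaceD(2)[OF U] by (simp add: complexify_def re_im_smult)
qed

lemma complexify_mem:
  assumes "lin_subspace K d U" "u \<in> U" "w \<in> U"
  shows "u + \<i> \<cdot>\<^sub>v w \<in> complexify d U"
proof -
  have "u \<in> space_over K d" "w \<in> space_over K d" using assms lin_subspace_subset by blast+
  then show ?thesis
    using re_im_of_real[of u F d w] assms by (auto simp: complexify_def space_over_def)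
qed

lemma complexify_neg:
  assumes U: "lin_subspace K d U"
  shows "complexify d (ol_neg (subspace_lattice K d) U) = ol_neg (subspace_lattice F d) (complexify d U)"
proof -
  \<comment> \<open>As \<open>u\<close> and \<open>w\<close> have real entries, conjugation only
    changes the sign in front of \<open>w\<close>, and the product sorts into products of real
    vectors.\<close>
  have ip: "conjugate (u + \<i> \<cdot>\<^sub>v w) \<bullet> v = conjugate u \<bullet> re_vec v + conjugate w \<bullet> im_vec v
      + \<i> * (conjugate u \<bullet> im_vec v - conjugate w \<bullet> re_vec v)"
    if uK: "u \<in> space_over K d" and wK: "w \<in> space_over K d" and vC: "v \<in> carrier_vec d" for u w v
  proof -
    have "(\<Sum>i<d. cnj ((u + \<i> \<cdot>\<^sub>v w) $ i) * v $ i) =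
       (\<Sum>i<d. cnj (u $ i) * re_vec v $ i + cnj (w $ i) * im_vec v $ i
         + \<i> * (cnj (u $ i) * im_vec v $ i - cnj (w $ i) * re_vec v $ i))"
    proof (rule sum.cong)
      fix i assume "i \<in> {..<d}"
      then have i: "i < d" by simp
      then have "u $ i \<in> \<real>" "w $ i \<in> \<real>" using uK wK by (auto simp: space_over_def)
      then obtain a b where "u $ i = of_real a" "w $ i = of_real b" by (metis Reals_cases)
      moreover have "(u + \<i> \<cdot>\<^sub>v w) $ i = u $ i + \<i> * w $ i" using i uK wK by (auto simp: space_over_def)
      ultimately show "cnj ((u + \<i> \<cdot>\<^sub>v w) $ i) * v $ i = cnj (u $ i) * re_vec v $ i + cnj (w $ i) * im_vec v $ i
         + \<i> * (cnj (u $ i) * im_vec v $ i - cnj (w $ i) * re_vec v $ i)"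
        using i uK wK vC by (simp add: space_over_def re_vec_def im_vec_def complex_eq_iff algebra_simps)
    qed simp
    then show ?thesis using uK wK vC
      by (simp add: space_over_def scalar_prod_sum[of _ d] sum.distrib sum_subtractf sum_distrib_left algebra_simps)
  qed
  show ?thesis
  proof (intro equalityI subsetI)
    fix v assume "v \<in> complexify d (ol_neg (subspace_lattice K d) U)"
    then have v: "v \<in> carrier_vec d" "re_vec v \<in> space_over K d" "im_vec v \<in> space_over K d"
       "\<forall>x\<in>U. conjugate x \<bullet> re_vec v = 0" "\<forall>x\<in>U. conjugate x \<bullet> im_vec v = 0"
      by (auto simp: complexify_def)
    have "conjugate x \<bullet> v = 0" if "x \<in> complexify d U" for x
    proof -
      have "re_vec x \<in> U" "im_vec x \<in> U" using that by (auto simp: complexify_def)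
      then have "re_vec x \<in> space_over K d" "im_vec x \<in> space_over K d"
        and "conjugate (re_vec x) \<bullet> re_vec v = 0" "conjugate (re_vec x) \<bullet> im_vec v = 0"
        "conjugate (im_vec x) \<bullet> re_vec v = 0" "conjugate (im_vec x) \<bullet> im_vec v = 0"
        using v subsetD[OF lin_subspace_subset[OF U]] by blast+
      then have "conjugate (re_vec x + \<i> \<cdot>\<^sub>v im_vec x) \<bullet> v = 0"
        by (subst ip) (simp_all add: v(1))
      then show ?thesis by (simp only: re_im_decomp[of x, symmetric])
    qed
    then show "v \<in> ol_neg (subspace_lattice F d) (complexify d U)" using v by (auto simp: space_iff)
  next
    fix v assume "v \<in> ol_neg (subspace_lattice F d) (complexify d U)"
    then have v: "v \<in> carrier_vec d" "re_vec v \<in> space_over K d" "im_vec v \<in> space_over K d"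
      "\<forall>x\<in>complexify d U. conjugate x \<bullet> v = 0" by (auto simp: space_iff)
    have "conjugate x \<bullet> re_vec v = 0 \<and> conjugate x \<bullet> im_vec v = 0" if "x \<in> U" for x
    proof -
      have 0: "0\<^sub>v d \<in> U" using lin_subspaceD(1)[OF U] .
      have x: "x \<in> space_over K d" and z0: "0\<^sub>v d \<in> space_over K d" using lin_subspace_subset[OF U] that 0 by blast+
      \<comment> \<open>Testing against real vectors is enough: with second part 0 the product is a
        real number plus \<open>\<i>\<close> times a real number, so both vanish.\<close>
      have "conjugate (x + \<i> \<cdot>\<^sub>v 0\<^sub>v d) \<bullet> v = 0" using v complexify_mem[OF U that 0] by blast
      then have eq: "conjugate x \<bullet> re_vec v + \<i> * (conjugate x \<bullet> im_vec v) = 0"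
        unfolding ip[OF x z0 v(1)] using v by (simp add: scalar_prod_sum[of _ d])
      have "conjugate x \<bullet> w \<in> \<real>" if "w \<in> space_over K d" for w
        using x that
        by (auto simp: scalar_prod_sum[of _ d] space_over_def Reals_cnj_iff intro!: sum_in_Reals Reals_mult)
      with v have "conjugate x \<bullet> re_vec v \<in> \<real>" "conjugate x \<bullet> im_vec v \<in> \<real>" by auto
      with eq show ?thesis by (auto elim!: Reals_cases simp: complex_eq_iff)
    qed
    then show "v \<in> complexify d (ol_neg (subspace_lattice K d) U)" using v by (auto simp: complexify_def)
  qed
qed

lemma complexify_join:
  assumes U: "lin_subspace K d U" and W: "lin_subspace K d W"
  shows "complexify d (ol_join (subspace_lattice K d) U W) =
    ol_join (subspace_lattice F d) (complexify d U) (complexify d W)"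
proof -
  show ?thesis
  proof (intro equalityI subsetI)
    fix v assume "v \<in> complexify d (ol_join (subspace_lattice K d) U W)"
    then obtain u w u' w' where v: "re_vec v = u + w" "im_vec v = u' + w'" and
      m: "u \<in> U" "w \<in> W" "u' \<in> U" "w' \<in> W" 
      by (auto simp: complexify_def)
    have "u \<in> carrier_vec d" "w \<in> carrier_vec d" "u' \<in> carrier_vec d" "w' \<in> carrier_vec d"
      using m lin_subspace_carrier[OF U] lin_subspace_carrier[OF W] by auto
    then have "v = (u + \<i> \<cdot>\<^sub>v u') + (w + \<i> \<cdot>\<^sub>v w')"
      by (subst re_im_decomp[of v]) (auto simp: v algebra_simps intro!: eq_vecI)
    then show "v \<in> ol_join (subspace_lattice F d) (complexify d U) (complexify d W)"
      using complexify_mem[OF U m(1,3)] complexify_mem[OF W m(2,4)] by simp blast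
  next
    fix v assume "v \<in> ol_join (subspace_lattice F d) (complexify d U) (complexify d W)"
    then show "v \<in> complexify d (ol_join (subspace_lattice K d) U W)"
      by (auto simp: complexify_def re_im_add[of _ d]; blast)
  qed
qed

lemma complexify_eq_zero:
  assumes U: "lin_subspace K d U" and 0: "complexify d U = {0\<^sub>v d}"
  shows "U = {0\<^sub>v d}"
proof -
  have "u = 0\<^sub>v d" if "u \<in> U" for u
  proof -
    have "0\<^sub>v d \<in> U" using lin_subspaceD(1)[OF U] .
    from complexify_mem[OF U that this] 0 have "u + \<i> \<cdot>\<^sub>v 0\<^sub>v d = 0\<^sub>v d" by simp
    moreover have "u \<in> carrier_vec d" using lin_subspace_carrier[OF U that] .
    moreover have "\<i> \<cdot>\<^sub>v 0\<^sub>v d = (0\<^sub>v d :: complex vec)" by (rule eq_vecI) simp_all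
    ultimately show ?thesis by simp
  qed
  then show ?thesis using lin_subspaceD(1)[OF U] by blast
qed

lemma complexify_embedding:
  "ortho_embedding (subspace_lattice K d) (subspace_lattice F d) (complexify d)"
proof (unfold_locales, goal_cases)
  case 7
  have "v = 0\<^sub>v d" if "re_vec v = 0\<^sub>v d" "im_vec v = 0\<^sub>v d" for v
  proof -
    have "v = re_vec v + \<i> \<cdot>\<^sub>v im_vec v" by (rule re_im_decomp)
    also have "\<dots> = 0\<^sub>v d" unfolding that by (rule eq_vecI) simp_all
    finally show ?thesis .
  qed
  moreover have "re_vec (0\<^sub>v d) = 0\<^sub>v d" "im_vec (0\<^sub>v d) = 0\<^sub>v d"
    by (auto simp: re_vec_def im_vec_def)
  ultimately show ?case by (auto simp: complexify_def)
next
  case 8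
  show ?case by (auto simp: complexify_def space_iff)
next
  case (9 U)
  then show ?case by (intro complexify_neg) simp
next
  case (10 U W)
  show ?case by (auto simp: complexify_def)
next
  case (11 U W)
  then show ?case by (intro complexify_join) simp_all
next
  case (12 U)
  then show ?case using complexify_eq_zero by simp
qed (use subspace_lattice_closed[OF subK, where d = d] complexify_subspace in auto)

section \<open>Separating real and imaginary parts\<close>

definition realify :: "nat \<Rightarrow> complex vec set \<Rightarrow> complex vec set" where
  "realify d U = {v \<in> space_over K (d + d). merge d v \<in> U}"

lemma merge_carrier [simp]: "merge d v \<in> carrier_vec d"
  by (simp add: merge_def)

lemma merge_add: "w \<in> carrier_vec (d + d) \<Longrightarrow> merge d (v + w) = merge d v + merge d w"
  by (rule eq_vecI) (simp_all add: merge_def algebra_simps)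

lemma merge_smult: "v \<in> carrier_vec (d + d) \<Longrightarrow> merge d (c \<cdot>\<^sub>v v) = c \<cdot>\<^sub>v merge d v"
  by (rule eq_vecI) (simp_all add: merge_def algebra_simps)

lemma merge_zero: "merge d (0\<^sub>v (d + d)) = 0\<^sub>v d"
  by (rule eq_vecI) (simp_all add: merge_def)

lemma unmerge_space: "z \<in> space_over F d \<Longrightarrow> unmerge d z \<in> space_over K (d + d)"
  by (auto simp: space_over_def unmerge_def mem[of "z $ i" for i])

lemma merge_unmerge: "z \<in> carrier_vec d \<Longrightarrow> merge d (unmerge d z) = z"
  by (rule eq_vecI) (simp_all add: merge_def unmerge_def complex_eq_iff)

lemma merge_space:
  assumes "v \<in> space_over K (d + d)"
  shows "merge d v \<in> space_over F d"
proof -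
  have "v $ i + \<i> * v $ (d + i) \<in> F" if "i < d" for i
  proof -
    have "v $ i \<in> F" "v $ (d + i) \<in> F" using assms that by (auto simp: space_over_def)
    then show ?thesis using star_subfieldD(3,4)[OF sub] i_mem by blast
  qed
  then show ?thesis by (simp add: space_over_def merge_def)
qed

lemma unmerge_merge:
  assumes "v \<in> space_over K (d + d)"
  shows "unmerge d (merge d v) = v"
proof (rule eq_vecI)
  fix i assume "i < dim_vec v"
  then have i: "i < d + d" using assms by (auto simp: space_over_def)
  have r: "Im (v $ k) = 0" if "k < d + d" for k
    using assms that by (auto simp: space_over_def complex_is_Real_iff)
  show "unmerge d (merge d v) $ i = v $ i"
  proof (cases "i < d")
    case True
    then show ?thesis using r[of i] r[of "d + i"] by (simp add: unmerge_def merge_def complex_eq_iff)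
  next
    case False
    then have "i - d < d" "d + (i - d) = i" using i by auto
    then show ?thesis using False r[of i] r[of "i - d"] i by (simp add: unmerge_def merge_def complex_eq_iff)
  qed
qed (use assms in \<open>auto simp: space_over_def unmerge_def\<close>)

lemma sum_double:
  fixes f :: "nat \<Rightarrow> 'b::comm_monoid_add"
  shows "(\<Sum>i<d + d. f i) = (\<Sum>i<d. f i) + (\<Sum>i<d. f (d + i))"
proof -
  have "(\<Sum>i<d + k. f i) = (\<Sum>i<d. f i) + (\<Sum>i<k. f (d + i))" for k
    by (induction k) (simp_all add: add.assoc)
  then show ?thesis .
qed

lemma scalar_prod_merge:
  assumes "v \<in> space_over K (d + d)" "w \<in> space_over K (d + d)"
  shows "conjugate v \<bullet> w = of_real (Re (conjugate (merge d v) \<bullet> merge d w))"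
proof -
  have "cnj (v $ i) * w $ i + cnj (v $ (d + i)) * w $ (d + i)
      = of_real (Re (cnj (merge d v $ i) * merge d w $ i))" if "i < d" for i
  proof -
    have r: "Im (v $ k) = 0" "Im (w $ k) = 0" if "k < d + d" for k
      using assms that by (auto simp: space_over_def complex_is_Real_iff)
    show ?thesis using that r[of i] r[of "d + i"]
      by (simp add: merge_def complex_eq_iff)
  qed
  then have "(\<Sum>i<d. cnj (v $ i) * w $ i + cnj (v $ (d + i)) * w $ (d + i)) =
      (\<Sum>i<d. of_real (Re (cnj (merge d v $ i) * merge d w $ i)))"
    by (intro sum.cong) auto
  then show ?thesis
    using scalar_prod_sum[OF space_over_carrier[OF assms(1)] space_over_carrier[OF assms(2)]]
    unfolding scalar_prod_sum[OF merge_carrier merge_carrier] sum_double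
    by (simp add: sum.distrib Re_sum)
qed

lemma realify_subspace:
  assumes U: "lin_subspace F d U"
  shows "lin_subspace K (d + d) (realify d U)"
  unfolding lin_subspace_def
proof (intro conjI ballI)
  show "realify d U \<subseteq> space_over K (d + d)" by (auto simp: realify_def)
  show "0\<^sub>v (d + d) \<in> realify d U"
    using lin_subspaceD(1)[OF U] by (simp add: realify_def merge_zero space_over_zero[OF subK])
next
  fix u v assume "u \<in> realify d U" "v \<in> realify d U"
  then show "u + v \<in> realify d U"
    using lin_subspaceD(2)[OF U] space_over_carrier[of v K "d + d"]
    by (simp add: realify_def merge_add space_over_add[OF subK])
next
  fix c u assume "c \<in> K" "u \<in> realify d U"
  then show "c \<cdot>\<^sub>v u \<in> realify d U"
    using lin_subspaceD(3)[OF U] space_over_carrier[of u K "d + d"]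
    by (simp add: realify_def merge_smult space_over_smult[OF subK])
qed

lemma unmerge_realify:
  assumes "lin_subspace F d U" "u \<in> U"
  shows "unmerge d u \<in> realify d U" "merge d (unmerge d u) = u"
proof -
  have "u \<in> space_over F d" using assms lin_subspace_subset by blast
  then show "merge d (unmerge d u) = u" "unmerge d u \<in> realify d U"
    using assms(2) by (simp_all add: realify_def unmerge_space merge_unmerge space_over_carrier)
qed

text \<open>Orthogonality in 2d real coordinates controls only the real part of the hermitian
  product, by \<open>scalar_prod_merge\<close>. Since \<open>U\<close> is closed under
  multiplication by \<open>\<i>\<close>, the imaginary part for \<open>x\<close> is covered by the
  real part for \<open>\<i>\<close> times \<open>x\<close>.\<close>

lemma realify_neg:
  assumes U: "lin_subspace F d U"
  shows "realify d (ol_neg (subspace_lattice F d) U) = ol_neg (subspace_lattice K (d + d)) (realify d U)"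
proof -
  have "(\<forall>x\<in>U. conjugate x \<bullet> merge d y = 0) \<longleftrightarrow> (\<forall>x\<in>realify d U. conjugate x \<bullet> y = 0)"
    if y: "y \<in> space_over K (d + d)" for y
  proof
    assume "\<forall>x\<in>U. conjugate x \<bullet> merge d y = 0"
    then show "\<forall>x\<in>realify d U. conjugate x \<bullet> y = 0"
      using scalar_prod_merge[OF _ y] by (simp add: realify_def)
  next
    assume *: "\<forall>x\<in>realify d U. conjugate x \<bullet> y = 0"
    have re: "Re (conjugate x \<bullet> merge d y) = 0" if "x \<in> U" for x
    proof -
      have "unmerge d x \<in> space_over K (d + d)" using unmerge_realify[OF U that] by (simp add: realify_def)
      from scalar_prod_merge[OF this y] show ?thesis
        using * unmerge_realify[OF U that] by (simp add: complex_eq_iff)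
    qed
    show "\<forall>x\<in>U. conjugate x \<bullet> merge d y = 0"
    proof
      fix x assume x: "x \<in> U"
      have "conjugate (\<i> \<cdot>\<^sub>v x) \<bullet> merge d y = - \<i> * (conjugate x \<bullet> merge d y)"
        using lin_subspace_carrier[OF U x] 
        by (simp add: scalar_prod_sum[of _ d] sum_distrib_left sum_negf[symmetric] mult.assoc)
      then have "Im (conjugate x \<bullet> merge d y) = 0"
        using re[OF lin_subspaceD(3)[OF U i_mem x]] by simp
      then show "conjugate x \<bullet> merge d y = 0" using re[OF x] by (simp add: complex_eq_iff)
    qed
  qed
  then show ?thesis by (auto simp: realify_def merge_space)
qed

lemma realify_join:
  assumes U: "lin_subspace F d U" and W: "lin_subspace F d W"
  shows "realify d (ol_join (subspace_lattice F d) U W) =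
    ol_join (subspace_lattice K (d + d)) (realify d U) (realify d W)"
proof (intro equalityI subsetI)
  fix v assume "v \<in> realify d (ol_join (subspace_lattice F d) U W)"
  then obtain u w where v: "v \<in> space_over K (d + d)" "merge d v = u + w" and m: "u \<in> U" "w \<in> W"
    by (auto simp: realify_def)
  have s: "unmerge d u \<in> space_over K (d + d)" "unmerge d w \<in> space_over K (d + d)"
    using unmerge_realify(1)[OF U m(1)] unmerge_realify(1)[OF W m(2)] by (auto simp: realify_def)
  have "merge d (unmerge d u + unmerge d w) = merge d v"
    using unmerge_realify(2)[OF U m(1)] unmerge_realify(2)[OF W m(2)] v(2)
    by (simp add: merge_add[OF space_over_carrier[OF s(2)]])
  then have "v = unmerge d u + unmerge d w"
    using unmerge_merge[OF v(1)] unmerge_merge[OF space_over_add[OF subK s]] by simp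
  then show "v \<in> ol_join (subspace_lattice K (d + d)) (realify d U) (realify d W)"
    using unmerge_realify(1)[OF U m(1)] unmerge_realify(1)[OF W m(2)] by simp blast
next
  fix v assume "v \<in> ol_join (subspace_lattice K (d + d)) (realify d U) (realify d W)"
  then obtain u w where "v = u + w" "u \<in> space_over K (d + d)" "w \<in> space_over K (d + d)"
     "merge d u \<in> U" "merge d w \<in> W" by (auto simp: realify_def)
  then show "v \<in> realify d (ol_join (subspace_lattice F d) U W)"
    using merge_add[OF space_over_carrier, of w K d u] space_over_add[OF subK, of u _ w]
    by (simp add: realify_def) blast
qed

lemma realify_embedding:
  "ortho_embedding (subspace_lattice F d) (subspace_lattice K (d + d)) (realify d)"
proof (unfold_locales, goal_cases)
  case 7
  have "v = 0\<^sub>v (d + d)" if "v \<in> space_over K (d + d)" "merge d v = 0\<^sub>v d" for v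
    using unmerge_merge[OF that(1)] unmerge_merge[OF space_over_zero[OF subK]] that(2) merge_zero by metis
  then show ?case using merge_zero space_over_zero[OF subK] by (auto simp: realify_def)
next
  case 8
  show ?case by (auto simp: realify_def merge_space)
next
  case (9 U)
  then show ?case by (intro realify_neg) simp
next
  case (10 U W)
  show ?case by (auto simp: realify_def)
next
  case (11 U W)
  then show ?case by (intro realify_join) simp_all
next
  case (12 U)
  then have U: "lin_subspace F d U" and 0: "realify d U = {0\<^sub>v (d + d)}" by auto
  have "u = 0\<^sub>v d" if "u \<in> U" for u
  proof -
    have "unmerge d u = 0\<^sub>v (d + d)" using unmerge_realify(1)[OF U that] unfolding 0 by simp
    then show ?thesis using unmerge_realify(2)[OF U that] merge_zero by simp
  qed
  then have "U = {0\<^sub>v d}" using lin_subspaceD(1)[OF U] by blast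
  then show ?case by simp
qed (use subspace_lattice_closed[OF sub, where d = d] realify_subspace in auto)

lemma strongly_sat_iff: "strongly_sat F t \<longleftrightarrow> strongly_sat K t"
proof
  assume "strongly_sat F t"
  then obtain d where d: "1 \<le> d" "strongly_sat_in (subspace_lattice F d) t" unfolding strongly_sat_def by blast
  from ortho_embedding.strongly_sat_in_embedding[OF realify_embedding d(2)] d(1)
  show "strongly_sat K t" unfolding strongly_sat_def by (intro exI[of _ "d + d"]) simp
next
  assume "strongly_sat K t"
  then obtain d where d: "1 \<le> d" "strongly_sat_in (subspace_lattice K d) t" unfolding strongly_sat_def by blast
  from ortho_embedding.strongly_sat_in_embedding[OF complexify_embedding d(2)] d(1)
  show "strongly_sat F t" unfolding strongly_sat_def by (intro exI[of _ d]) simp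
qed

lemma weakly_sat_iff: "weakly_sat F t \<longleftrightarrow> weakly_sat K t"
proof
  assume "weakly_sat F t"
  then obtain d where d: "1 \<le> d" "weakly_sat_in (subspace_lattice F d) t" unfolding weakly_sat_def by blast
  from ortho_embedding.weakly_sat_in_embedding[OF realify_embedding d(2)] d(1)
  show "weakly_sat K t" unfolding weakly_sat_def by (intro exI[of _ "d + d"]) simp
next
  assume "weakly_sat K t"
  then obtain d where d: "1 \<le> d" "weakly_sat_in (subspace_lattice K d) t" unfolding weakly_sat_def by blast
  from ortho_embedding.weakly_sat_in_embedding[OF complexify_embedding d(2)] d(1)
  show "weakly_sat F t" unfolding weakly_sat_def by (intro exI[of _ d]) simp
qed

end

lemma Re_field_real:
  assumes "F \<subseteq> \<real>"
  shows "complex_of_real ` Re_field F = F"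
proof (intro equalityI subsetI)
  fix z assume "z \<in> complex_of_real ` Re_field F"
  then obtain x y where z: "z = of_real x" "Complex x y \<in> F" by (auto simp: Re_field_def)
  then have "y = 0" using assms by (auto simp: complex_is_Real_iff)
  then show "z \<in> F" using z by (simp add: complex_of_real_def)
next
  fix z assume "z \<in> F"
  moreover from this assms have "z = of_real (Re z)" by (auto simp: complex_is_Real_iff complex_eq_iff)
  ultimately show "z \<in> complex_of_real ` Re_field F"
    by (auto simp: Re_field_def intro!: image_eqI[of _ _ "Re z"] exI[of _ "Im z"])
qed

text \<open>For real \<open>F\<close>, passing to \<open>Re_field F\<close> changes nothing;
  otherwise the two embeddings of \<open>complex_field\<close> become available.\<close>

lemma admissible_cases:
  assumes "admissible_field F"
  obtains "F \<subseteq> \<real>" "complex_of_real ` Re_field F = F"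
  | "complex_field F" "complex_of_real ` Re_field F = F \<inter> \<real>"
proof (cases "F \<subseteq> \<real>")
  case True
  then show ?thesis using that(1) Re_field_real by blast
next
  case False
  note adm = assms[unfolded admissible_field_def]
  have sub: "star_subfield F" by (rule conjunct1[OF adm])
  have dec: "F = {x + \<i> * y | x y. x \<in> F \<inter> \<real> \<and> y \<in> F \<inter> \<real>}"
    by (rule disjE[OF conjunct2[OF adm]]) (erule notE[OF False], assumption)
  have 1: "complex_of_real (Re z) \<in> F \<and> complex_of_real (Im z) \<in> F" if z: "z \<in> F" for z
  proof -
    from z have "z \<in> {x + \<i> * y | x y. x \<in> F \<inter> \<real> \<and> y \<in> F \<inter> \<real>}" by (subst (asm) dec)
    then obtain x y where xy: "z = x + \<i> * y" "x \<in> F" "y \<in> F" "x \<in> \<real>" "y \<in> \<real>" by blast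
    from xy(4,5) obtain a b where "x = of_real a" "y = of_real b" by (auto elim!: Reals_cases)
    with xy(1-3) show ?thesis by simp
  qed
  have 2: "z \<in> F" if z: "complex_of_real (Re z) \<in> F" "complex_of_real (Im z) \<in> F" for z
  proof -
    have "complex_of_real (Re z) + \<i> * complex_of_real (Im z) \<in> F"
      by (subst dec, rule CollectI, rule exI[of _ "complex_of_real (Re z)"],
          rule exI[of _ "complex_of_real (Im z)"]) (use z in simp)
    then show ?thesis using complex_eq[of z] by simp
  qed
  have "complex_field F" by unfold_locales (use sub 1 2 in blast)+
  moreover have "complex_of_real ` Re_field F = F \<inter> \<real>"
  proof (intro equalityI subsetI)
    fix z assume "z \<in> complex_of_real ` Re_field F"
    then obtain x y where x: "z = of_real x" "Complex x y \<in> F" by (auto simp: Re_field_def)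
    from 1[OF x(2)] show "z \<in> F \<inter> \<real>" by (simp add: x(1))
  next
    fix z assume "z \<in> F \<inter> \<real>"
    then obtain x where "z = of_real x" "of_real x \<in> F" by (auto elim!: Reals_cases)
    then show "z \<in> complex_of_real ` Re_field F"
      by (auto simp: Re_field_def complex_of_real_def intro!: image_eqI[of _ _ x] exI[of _ 0])
  qed
  ultimately show ?thesis using that(2) by blast
qed

lemma sat_Re_field:
  assumes "admissible_field F"
  shows "strongly_sat F t \<longleftrightarrow> strongly_sat (complex_of_real ` Re_field F) t"
    and "weakly_sat F t \<longleftrightarrow> weakly_sat (complex_of_real ` Re_field F) t"
  using assms by (cases rule: admissible_cases;
      simp add: complex_field.strongly_sat_iff complex_field.weakly_sat_iff)+

section \<open>Weak satisfiability over real Pythagorean fields\<close>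

definition dot :: "nat \<Rightarrow> (nat \<Rightarrow> real) \<Rightarrow> (nat \<Rightarrow> real) \<Rightarrow> real" where
  "dot d u v = (\<Sum>i<d. u i * v i)"

lemma dot_commute: "dot d u v = dot d v u"
  by (simp add: dot_def mult.commute)

lemma dot_diff_right: "dot d u (\<lambda>i. v i - w i) = dot d u v - dot d u w"
  by (simp add: dot_def right_diff_distrib sum_subtractf)

lemma dot_add_right: "dot d u (\<lambda>i. v i + w i) = dot d u v + dot d u w"
  by (simp add: dot_def distrib_left sum.distrib)

lemma dot_scale_right: "dot d u (\<lambda>i. c * v i) = c * dot d u v"
  by (simp add: dot_def sum_distrib_left mult_ac)

lemma dot_sum_right: "dot d u (\<lambda>j. \<Sum>i<m. c i * e i j) = (\<Sum>i<m. c i * dot d u (e i))"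
proof -
  have "dot d u (\<lambda>j. \<Sum>i<m. c i * e i j) = (\<Sum>j<d. \<Sum>i<m. c i * (u j * e i j))"
    by (simp add: dot_def sum_distrib_left mult_ac)
  also have "\<dots> = (\<Sum>i<m. \<Sum>j<d. c i * (u j * e i j))" by (rule sum.swap)
  also have "\<dots> = (\<Sum>i<m. c i * dot d u (e i))" by (simp add: dot_def sum_distrib_left)
  finally show ?thesis .
qed

lemma dot_cong: "(\<And>i. i < d \<Longrightarrow> u i = u' i) \<Longrightarrow> (\<And>i. i < d \<Longrightarrow> v i = v' i) \<Longrightarrow> dot d u v = dot d u' v'"
  by (simp add: dot_def)

lemma dot_self_eq_0: "dot d u u = 0 \<longleftrightarrow> (\<forall>i<d. u i = 0)"
  by (auto simp: dot_def sum_nonneg_eq_0_iff)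

locale real_subfield =
  fixes K :: "real set"
  assumes zero: "0 \<in> K" and one: "1 \<in> K" and add: "x \<in> K \<Longrightarrow> y \<in> K \<Longrightarrow> x + y \<in> K"
    and mult: "x \<in> K \<Longrightarrow> y \<in> K \<Longrightarrow> x * y \<in> K" and uminus: "x \<in> K \<Longrightarrow> - x \<in> K"
    and inverse: "x \<in> K \<Longrightarrow> inverse x \<in> K"
begin

lemma diff: "x \<in> K \<Longrightarrow> y \<in> K \<Longrightarrow> x - y \<in> K"
  using add[of x "- y"] uminus by simp

lemma divide: "x \<in> K \<Longrightarrow> y \<in> K \<Longrightarrow> x / y \<in> K"
  using mult[of x "inverse y"] inverse by (simp add: divide_inverse)

lemma sum: "(\<And>i. i \<in> A \<Longrightarrow> f i \<in> K) \<Longrightarrow> sum f A \<in> K"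
  by (induction A rule: infinite_finite_induct) (auto simp: zero add)

lemma dot: "(\<And>i. i < d \<Longrightarrow> u i \<in> K) \<Longrightarrow> (\<And>i. i < d \<Longrightarrow> v i \<in> K) \<Longrightarrow> dot d u v \<in> K"
  unfolding dot_def by (intro sum mult) auto

text \<open>Induction on the dimension: the vectors of \<open>U\<close> with last coordinate 0 form
  \<open>U0\<close>, and \<open>U\<close> exceeds \<open>U0\<close> by at most one direction
  \<open>e\<close>, made orthogonal to \<open>U0\<close> by subtracting a projection. No square root
  occurs, so this holds over every real subfield; division by \<open>dot (Suc d) e e\<close> is safe
  by positive definiteness.\<close>

lemma orthogonal_projection:
  assumes "(\<lambda>_. 0) \<in> U" "\<And>u v. u \<in> U \<Longrightarrow> v \<in> U \<Longrightarrow> (\<lambda>i. u i + v i) \<in> U"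
    and "\<And>c u. c \<in> K \<Longrightarrow> u \<in> U \<Longrightarrow> (\<lambda>i. c * u i) \<in> U"
    and "\<And>u i. u \<in> U \<Longrightarrow> i < d \<Longrightarrow> u i \<in> K" "\<And>i. i < d \<Longrightarrow> v i \<in> K"
  shows "\<exists>u\<in>U. \<forall>x\<in>U. dot d x (\<lambda>i. v i - u i) = 0"
  using assms
proof (induction d arbitrary: U v)
  case 0
  then show ?case by (auto simp: dot_def)
next
  case (Suc d)
  define U0 where "U0 = {u \<in> U. u d = 0}"
  have ex: "\<exists>u\<in>U0. \<forall>x\<in>U0. dot d x (\<lambda>i. v i - u i) = 0" if "\<And>i. i < d \<Longrightarrow> v i \<in> K" for v
    by (rule Suc.IH) (use Suc.prems that in \<open>auto simp: U0_def\<close>)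
  have proj: "\<exists>u\<in>U0. \<forall>x\<in>U0. dot (Suc d) x (\<lambda>i. v i - u i) = 0" if v: "\<And>i. i < d \<Longrightarrow> v i \<in> K" for v
  proof -
    from ex[of v] v obtain u where "u \<in> U0" "\<forall>x\<in>U0. dot d x (\<lambda>i. v i - u i) = 0" by blast
    moreover have "dot (Suc d) x w = dot d x w" if "x \<in> U0" for x w
      using that by (simp add: dot_def U0_def)
    ultimately show ?thesis by auto
  qed
  have minus: "(\<lambda>i. u i - c * w i) \<in> U" if "u \<in> U" "w \<in> U" "c \<in> K" for u w c
    using Suc.prems(2)[OF that(1) Suc.prems(3)[OF uminus[OF that(3)] that(2)]] by simp
  obtain p where p: "p \<in> U0" "\<forall>x\<in>U0. dot (Suc d) x (\<lambda>i. v i - p i) = 0"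
    using proj[of v] Suc.prems(5) by auto
  show ?case
  proof (cases "U = U0")
    case True
    then show ?thesis using p by blast
  next
    case False
    then obtain u1 where u1: "u1 \<in> U" "u1 d \<noteq> 0" by (auto simp: U0_def)
    obtain q where q: "q \<in> U0" "\<forall>x\<in>U0. dot (Suc d) x (\<lambda>i. u1 i - q i) = 0"
      using proj[of u1] Suc.prems(4)[OF u1(1)] by auto
    define e where "e = (\<lambda>i. u1 i - q i)"
    have e: "e \<in> U" "e d \<noteq> 0" "\<forall>x\<in>U0. dot (Suc d) x e = 0"
      using minus[OF u1(1), of q 1] q u1 one by (auto simp: e_def U0_def)
    have ee: "dot (Suc d) e e \<noteq> 0" using e(2) by (auto simp: dot_self_eq_0)
    define c where "c = dot (Suc d) e v / dot (Suc d) e e"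
    have c: "c \<in> K" unfolding c_def
      by (intro divide dot) (use Suc.prems(4)[OF e(1)] Suc.prems(5) in auto)
    define u where "u = (\<lambda>i. p i + c * e i)"
    have u: "u \<in> U" unfolding u_def using Suc.prems(2)[OF _ Suc.prems(3)[OF c e(1)]] p(1) by (auto simp: U0_def)
    have vu: "dot (Suc d) x (\<lambda>i. v i - u i) = dot (Suc d) x (\<lambda>i. v i - p i) - c * dot (Suc d) x e" for x
      unfolding u_def dot_diff_right dot_add_right dot_scale_right by simp
    have "dot (Suc d) x (\<lambda>i. v i - u i) = 0" if x: "x \<in> U" for x
    proof -
      \<comment> \<open>The multiple of \<open>e\<close> that cancels the last coordinate of
        \<open>x\<close>, so that the rest lies in \<open>U0\<close>.\<close>
      define b where "b = x d / e d"
      have "b \<in> K" unfolding b_def using Suc.prems(4)[OF x] Suc.prems(4)[OF e(1)] by (intro divide) auto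
      define x0 where "x0 = (\<lambda>i. x i - b * e i)"
      have x0: "x0 \<in> U0" using minus[OF x e(1) \<open>b \<in> K\<close>] e(2) by (auto simp: U0_def x0_def b_def)
      have "dot (Suc d) p e = 0" using e(3) p(1) by blast
      then have "dot (Suc d) e p = 0" by (simp add: dot_commute)
      then have "dot (Suc d) e (\<lambda>i. v i - p i) = dot (Suc d) e v" by (simp add: dot_diff_right)
      then have "dot (Suc d) e (\<lambda>i. v i - u i) = 0"
        unfolding vu using ee by (simp add: c_def)
      moreover have "dot (Suc d) x0 (\<lambda>i. v i - u i) = 0"
        unfolding vu using p(2) e(3) x0 by simp
      moreover have "dot (Suc d) x w = dot (Suc d) x0 w + b * dot (Suc d) e w" for w
        unfolding x0_def dot_commute[of _ _ w] dot_diff_right dot_scale_right by simp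
      ultimately show ?thesis by simp
    qed
    then show ?thesis using u by blast
  qed
qed

text \<open>A vector that depends on the others contributes a zero vector instead of being dropped,
  so the system has one member per given vector. Normalising divides the residual \<open>r\<close>
  by the root that \<open>pyth\<close> provides.\<close>

lemma gram_schmidt:
  assumes pyth: "\<And>v. (\<And>i. i < d \<Longrightarrow> v i \<in> K) \<Longrightarrow> \<exists>c\<in>K. dot d v v = c\<^sup>2"
    and "\<And>v i. v \<in> set vs \<Longrightarrow> i < d \<Longrightarrow> v i \<in> K"
  shows "\<exists>e. (\<forall>i. \<forall>j<d. e i j \<in> K) \<and>
    (\<forall>i<length vs. \<forall>k<length vs. i \<noteq> k \<longrightarrow> dot d (e i) (e k) = 0) \<and>
    (\<forall>i<length vs. dot d (e i) (e i) = 1 \<or> (\<forall>j<d. e i j = 0)) \<and>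
    (\<forall>v\<in>set vs. \<forall>j<d. v j = (\<Sum>i<length vs. dot d (e i) v * e i j))"
  using assms(2)
proof (induction vs)
  case Nil
  then show ?case using zero by (intro exI[of _ "\<lambda>_ _. 0"]) auto
next
  case (Cons v vs)
  let ?m = "length vs"
  have "\<exists>e. (\<forall>i. \<forall>j<d. e i j \<in> K) \<and>
    (\<forall>i<?m. \<forall>k<?m. i \<noteq> k \<longrightarrow> dot d (e i) (e k) = 0) \<and>
    (\<forall>i<?m. dot d (e i) (e i) = 1 \<or> (\<forall>j<d. e i j = 0)) \<and>
    (\<forall>v\<in>set vs. \<forall>j<d. v j = (\<Sum>i<?m. dot d (e i) v * e i j))"
    by (rule Cons.IH) (rule Cons.prems, simp_all)
  then obtain e where E: "\<forall>i. \<forall>j<d. e i j \<in> K"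
    "\<forall>i<?m. \<forall>k<?m. i \<noteq> k \<longrightarrow> dot d (e i) (e k) = 0"
    "\<forall>i<?m. dot d (e i) (e i) = 1 \<or> (\<forall>j<d. e i j = 0)"
    "\<forall>v\<in>set vs. \<forall>j<d. v j = (\<Sum>i<?m. dot d (e i) v * e i j)"
    by (elim exE conjE) (rule that)
  have e: "\<And>i j. j < d \<Longrightarrow> e i j \<in> K"
    "\<And>i k. i < ?m \<Longrightarrow> k < ?m \<Longrightarrow> i \<noteq> k \<Longrightarrow> dot d (e i) (e k) = 0"
    "\<And>i. i < ?m \<Longrightarrow> dot d (e i) (e i) = 1 \<or> (\<forall>j<d. e i j = 0)"
    "\<And>v j. v \<in> set vs \<Longrightarrow> j < d \<Longrightarrow> v j = (\<Sum>i<?m. dot d (e i) v * e i j)"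
    subgoal using E(1) by simp
    subgoal using E(2) by simp
    subgoal using E(3) by simp
    subgoal using E(4) by blast
    done
  have v: "v i \<in> K" if "i < d" for i using Cons.prems that by simp
  define r where "r = (\<lambda>j. v j - (\<Sum>i<?m. dot d (e i) v * e i j))"
  have rK: "r j \<in> K" if "j < d" for j
    unfolding r_def using that v e(1) by (intro diff sum mult dot) auto
  have er: "dot d (e k) r = 0" if k: "k < ?m" for k
  proof -
    have "dot d (e k) r = dot d (e k) v - (\<Sum>i<?m. dot d (e i) v * dot d (e k) (e i))"
      unfolding r_def dot_diff_right dot_sum_right ..
    also have "(\<Sum>i<?m. dot d (e i) v * dot d (e k) (e i)) = dot d (e k) v * dot d (e k) (e k)"
      using k e(2)[OF k] by (subst sum.remove[of _ k]) auto
    also have "dot d (e k) v - dot d (e k) v * dot d (e k) (e k) = 0"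
      using e(3)[OF k] by (auto simp: dot_def)
    finally show ?thesis .
  qed
  obtain c where c: "c \<in> K" "dot d r r = c\<^sup>2" using pyth[of r] rK by blast
  \<comment> \<open>If \<open>c = 0\<close>, the residual vanishes on all coordinates below
    \<open>d\<close>. As \<open>inverse 0 = 0\<close>, both cases read
    \<open>inverse c * r j\<close>.\<close>
  define f where "f = (\<lambda>j. if c = 0 then 0 else r j / c)"
  have fr: "f j = inverse c * r j" for j by (simp add: f_def divide_inverse)
  have ef: "dot d (e k) f = 0" "dot d f (e k) = 0" if "k < ?m" for k
    using er[OF that] unfolding fr dot_commute[of d f] by (simp_all add: dot_scale_right fr[abs_def])
  have ff: "dot d f f = 1 \<or> (\<forall>j<d. f j = 0)"
  proof (cases "c = 0")
    case False
    have "dot d f f = inverse c * (inverse c * dot d r r)"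
      unfolding fr[abs_def] dot_scale_right by (subst dot_commute) (simp add: dot_scale_right)
    then have "dot d f f = 1" using False c(2) by (simp add: power2_eq_square field_simps)
    then show ?thesis by blast
  qed (simp add: f_def)
  have vr: "v = (\<lambda>j. r j + (\<Sum>i<?m. dot d (e i) v * e i j))" by (simp add: r_def)
  have fv: "dot d f v * f j = r j" if "j < d" for j
  proof -
    have "dot d f v = dot d f r"
      by (subst vr) (simp add: dot_add_right dot_sum_right ef)
    also have "\<dots> = inverse c * dot d r r"
      unfolding fr[abs_def] by (subst dot_commute) (simp add: dot_scale_right)
    finally show ?thesis
      using c(2) that dot_self_eq_0[of d r] by (cases "c = 0") (auto simp: f_def power2_eq_square field_simps)
  qed
  have fw: "dot d f w = 0" if "w \<in> set vs" for w
  proof -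
    have "dot d f w = dot d f (\<lambda>j. \<Sum>i<?m. dot d (e i) w * e i j)"
      by (rule dot_cong) (use e(4)[OF that] in auto)
    then show ?thesis by (simp add: dot_sum_right ef)
  qed
  have fK: "f j \<in> K" if "j < d" for j unfolding fr using that rK c(1) by (intro mult inverse) auto
  let ?e = "e(?m := f)"
  have expand: "(\<Sum>i<Suc ?m. dot d (?e i) w * ?e i j) = (\<Sum>i<?m. dot d (e i) w * e i j) + dot d f w * f j" for w j
    by simp
  show ?case
  proof (intro exI[of _ ?e] conjI allI impI ballI)
    fix i j assume "j < d" then show "?e i j \<in> K" using e(1) fK by simp
  next
    fix i k assume "i < length (v # vs)" "k < length (v # vs)" "i \<noteq> k"
    then show "dot d (?e i) (?e k) = 0" using e(2) ef by (auto simp: less_Suc_eq)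
  next
    fix i assume "i < length (v # vs)"
    then show "dot d (?e i) (?e i) = 1 \<or> (\<forall>j<d. ?e i j = 0)" using e(3) ff by (auto simp: less_Suc_eq)
  next
    fix w j assume w: "w \<in> set (v # vs)" and j: "j < d"
    show "w j = (\<Sum>i<length (v # vs). dot d (?e i) w * ?e i j)"
      unfolding list.size(4) add_0_right One_nat_def add_Suc_right expand
    proof (cases "w = v")
      case True
      then show "w j = (\<Sum>i<?m. dot d (e i) w * e i j) + dot d f w * f j"
        using fv[OF j] by (simp add: r_def)
    next
      case False
      then have "w \<in> set vs" using w by simp
      then show "w j = (\<Sum>i<?m. dot d (e i) w * e i j) + dot d f w * f j"
        using e(4)[OF _ j] fw by simp
    qed
  qed
qed

end

lemma star_subfield_imp_real_subfield:
  assumes "star_subfield (complex_of_real ` K)"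
  shows "real_subfield K"
proof
  note D = star_subfieldD[OF assms]
  have m: "complex_of_real x \<in> complex_of_real ` K \<longleftrightarrow> x \<in> K" for x by auto
  show "0 \<in> K" using D(1) m[of 0] by simp
  show "1 \<in> K" using D(2) m[of 1] by simp
  fix x y assume x: "x \<in> K"
  show "- x \<in> K" using D(5)[of "of_real x"] m[of "- x"] x by simp
  show "inverse x \<in> K" using D(6)[of "of_real x"] m[of "inverse x"] x by simp
  assume y: "y \<in> K"
  show "x + y \<in> K" using D(3)[of "of_real x" "of_real y"] m[of "x + y"] x y by simp
  show "x * y \<in> K" using D(4)[of "of_real x" "of_real y"] m[of "x * y"] x y by simp
qed

text \<open>The labellings \<open>lin\<close> taken coordinate by coordinate, with vectors at the
  leaves. The length is demanded separately because for \<open>d = 0\<close> no coordinate would fix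
  it.\<close>

definition vlin :: "real set \<Rightarrow> nat \<Rightarrow> bool \<Rightarrow> oterm \<Rightarrow> (nat \<Rightarrow> real) \<Rightarrow> (nat \<Rightarrow> real) list set" where
  "vlin K d b t r = {us. length us = length (lits b t) \<and> (\<forall>j<d. map (\<lambda>u. u j) us \<in> lin K b t (r j))}"

lemma vlin_Var: "us \<in> vlin K d b (Var n) r \<longleftrightarrow> (\<exists>u. us = [u] \<and> (\<forall>j<d. u j = r j))"
  by (auto simp: vlin_def length_Suc_conv)

lemma vlin_Zero: "us \<in> vlin K d b Zero r \<longleftrightarrow> us = [] \<and> (b \<longrightarrow> (\<forall>j<d. r j = 0))"
  by (auto simp: vlin_def)

lemma vlin_One: "us \<in> vlin K d b One r \<longleftrightarrow> us = [] \<and> (b \<or> (\<forall>j<d. r j = 0))"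
  by (auto simp: vlin_def)

lemma vlin_Neg: "us \<in> vlin K d b (Neg t) r \<longleftrightarrow> us \<in> vlin K d (\<not> b) t r"
  by (simp add: vlin_def)

text \<open>Each coordinate cuts the list on its own, but the common length of the members of
  \<open>A x\<close> puts every cut at position \<open>m\<close>, so the list of vectors itself can
  be cut there. The labels chosen per coordinate assemble to the vectors \<open>y\<close> and
  \<open>z\<close>.\<close>

lemma coordinatewise_append:
  fixes us :: "(nat \<Rightarrow> real) list"
  assumes len: "\<And>x ws. ws \<in> A x \<Longrightarrow> length ws = m"
  shows "length us = m + m' \<and>
      (\<forall>j<d. map (\<lambda>u. u j) us \<in> (\<Union>(y, z)\<in>S j. {as @ bs | as bs. as \<in> A y \<and> bs \<in> B z})) \<longleftrightarrow>
    (\<exists>y z us1 us2. us = us1 @ us2 \<and> (\<forall>j<d. (y j, z j) \<in> S j) \<and>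
      (length us1 = m \<and> (\<forall>j<d. map (\<lambda>u. u j) us1 \<in> A (y j))) \<and>
      (length us2 = m' \<and> (\<forall>j<d. map (\<lambda>u. u j) us2 \<in> B (z j))))"
  (is "?lhs \<longleftrightarrow> ?rhs")
proof
  assume l: ?lhs
  then have "\<forall>j. \<exists>yz. j < d \<longrightarrow> yz \<in> S j \<and>
      (\<exists>as bs. map (\<lambda>u. u j) us = as @ bs \<and> as \<in> A (fst yz) \<and> bs \<in> B (snd yz))"
    by fastforce
  then obtain yz where yz: "\<And>j. j < d \<Longrightarrow> yz j \<in> S j"
    "\<And>j. j < d \<Longrightarrow> \<exists>as bs. map (\<lambda>u. u j) us = as @ bs \<and> as \<in> A (fst (yz j)) \<and> bs \<in> B (snd (yz j))"
    by metis
  have "map (\<lambda>u. u j) (take m us) \<in> A (fst (yz j)) \<and> map (\<lambda>u. u j) (drop m us) \<in> B (snd (yz j))"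
    if "j < d" for j
  proof -
    obtain as bs where *: "map (\<lambda>u. u j) us = as @ bs" "as \<in> A (fst (yz j))" "bs \<in> B (snd (yz j))"
      using yz(2)[OF \<open>j < d\<close>] by blast
    have "length as = m" by (rule len[OF *(2)])
    then have "map (\<lambda>u. u j) (take m us) = as" "map (\<lambda>u. u j) (drop m us) = bs"
      by (simp_all add: take_map[symmetric] drop_map[symmetric] *(1))
    then show ?thesis using * by simp
  qed
  then show ?rhs using l yz(1)
    by (intro exI[of _ "\<lambda>j. fst (yz j)"] exI[of _ "\<lambda>j. snd (yz j)"] exI[of _ "take m us"]
        exI[of _ "drop m us"]) simp
next
  assume ?rhs
  then obtain y z us1 us2 where r: "us = us1 @ us2" "\<forall>j<d. (y j, z j) \<in> S j"
      "length us1 = m" "\<forall>j<d. map (\<lambda>u. u j) us1 \<in> A (y j)"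
      "length us2 = m'" "\<forall>j<d. map (\<lambda>u. u j) us2 \<in> B (z j)" by blast
  have "map (\<lambda>u. u j) us \<in> (\<Union>(y, z)\<in>S j. {as @ bs | as bs. as \<in> A y \<and> bs \<in> B z})" if "j < d" for j
  proof (rule UN_I[of "(y j, z j)"])
    show "map (\<lambda>u. u j) us \<in> (case (y j, z j) of (y, z) \<Rightarrow> {as @ bs | as bs. as \<in> A y \<and> bs \<in> B z})"
      unfolding r(1) map_append prod.case using r(4,6) that by blast
  qed (use r(2) that in blast)
  then show ?lhs using r by simp
qed

lemma vlin_And:
  "us \<in> vlin K d b (And s t) r \<longleftrightarrow> (\<exists>y z us1 us2. us = us1 @ us2 \<and>
    (\<forall>j<d. (y j, z j) \<in> splits K b (r j)) \<and> us1 \<in> vlin K d b t y \<and> us2 \<in> vlin K d b s z)"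
  unfolding vlin_def mem_Collect_eq lits.simps length_append lin.simps
  by (rule coordinatewise_append) (rule length_lin)

lemma vlin_Or:
  "us \<in> vlin K d b (Or s t) r \<longleftrightarrow> (\<exists>y z us1 us2. us = us1 @ us2 \<and>
    (\<forall>j<d. (y j, z j) \<in> splits K (\<not> b) (r j)) \<and> us1 \<in> vlin K d b t y \<and> us2 \<in> vlin K d b s z)"
  unfolding vlin_def mem_Collect_eq lits.simps length_append lin.simps
  by (rule coordinatewise_append) (rule length_lin)

text \<open>Transposition: one labelling per coordinate, as guessed by the machine, against one
  vector per leaf, as used by linear algebra.\<close>

lemma feasible_iff:
  "feasible K d t \<longleftrightarrow> (\<exists>r us. (\<forall>j<d. r j \<in> K) \<and> us \<in> vlin K d True t r \<and> (\<exists>j<d. r j \<noteq> 0) \<and>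
    (\<forall>p<length us. \<forall>q<length us. conflict (lits True t ! p) (lits True t ! q) \<longrightarrow> dot d (us ! p) (us ! q) = 0))"
proof
  let ?m = "length (lits True t)"
  assume "feasible K d t"
  then obtain r X where rX: "\<And>j. j < d \<Longrightarrow> r j \<in> K" "\<And>j. j < d \<Longrightarrow> X j \<in> lin K True t (r j)"
    "\<exists>j<d. r j \<noteq> 0"
    "\<And>p q. p < ?m \<Longrightarrow> q < ?m \<Longrightarrow> conflict (lits True t ! p) (lits True t ! q) \<Longrightarrow>
        (\<Sum>j<d. X j ! p * X j ! q) = 0"
    unfolding feasible_def by blast
  let ?us = "map (\<lambda>p j. X j ! p) [0..<?m]"
  have "map (\<lambda>u. u j) ?us = X j" if "j < d" for j
    using length_lin[OF rX(2)[OF that]] by (intro nth_equalityI) simp_all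
  then have "?us \<in> vlin K d True t r" using rX(2) by (simp add: vlin_def)
  then show "\<exists>r us. (\<forall>j<d. r j \<in> K) \<and> us \<in> vlin K d True t r \<and> (\<exists>j<d. r j \<noteq> 0) \<and>
    (\<forall>p<length us. \<forall>q<length us. conflict (lits True t ! p) (lits True t ! q) \<longrightarrow> dot d (us ! p) (us ! q) = 0)"
    using rX by (intro exI[of _ r] exI[of _ ?us]) (simp add: dot_def)
next
  assume "\<exists>r us. (\<forall>j<d. r j \<in> K) \<and> us \<in> vlin K d True t r \<and> (\<exists>j<d. r j \<noteq> 0) \<and>
    (\<forall>p<length us. \<forall>q<length us. conflict (lits True t ! p) (lits True t ! q) \<longrightarrow> dot d (us ! p) (us ! q) = 0)"
  then obtain r us where "\<forall>j<d. r j \<in> K" "us \<in> vlin K d True t r" "\<exists>j<d. r j \<noteq> 0"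
    "\<forall>p<length us. \<forall>q<length us. conflict (lits True t ! p) (lits True t ! q) \<longrightarrow> dot d (us ! p) (us ! q) = 0"
    by blast
  then show "feasible K d t"
    unfolding feasible_def
    by (intro exI[of _ r] exI[of _ "\<lambda>j. map (\<lambda>u. u j) us"]) (simp add: vlin_def dot_def)
qed

text \<open>Strictness leaves room for the root vector: it and the leaf vectors span no more
  dimensions than the machine makes passes.\<close>

lemma length_lits_less: "length (lits b t) < length (encode t)"
proof (induction t arbitrary: b)
  case (And s t)
  from And.IH(1)[of b] And.IH(2)[of b] show ?case by simp
next
  case (Or s t)
  from Or.IH(1)[of b] Or.IH(2)[of b] show ?case by simp
next
  case (Neg t)
  from Neg.IH[of "\<not> b"] show ?case by simp
qed simp_all

section \<open>The ortholattice of subspaces over a real subfield\<close>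

definition cv :: "nat \<Rightarrow> (nat \<Rightarrow> real) \<Rightarrow> complex vec" where
  "cv d u = vec d (\<lambda>j. of_real (u j))"

lemma cv_carrier [simp]: "cv d u \<in> carrier_vec d"
  by (simp add: cv_def)

lemma cv_eq: "cv d u = cv d w \<longleftrightarrow> (\<forall>j<d. u j = w j)"
proof
  assume e: "cv d u = cv d w"
  show "\<forall>j<d. u j = w j"
  proof (intro allI impI)
    fix j assume "j < d"
    then show "u j = w j" using arg_cong[OF e, of "\<lambda>v. v $ j"] by (simp add: cv_def)
  qed
qed (auto simp: cv_def intro!: eq_vecI)

lemma cv_zero: "0\<^sub>v d = cv d (\<lambda>_. 0)"
  by (rule eq_vecI) (simp_all add: cv_def)

lemma cv_add: "cv d u + cv d w = cv d (\<lambda>j. u j + w j)"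
  by (rule eq_vecI) (simp_all add: cv_def)

lemma cv_scale: "of_real c \<cdot>\<^sub>v cv d u = cv d (\<lambda>j. c * u j)"
  by (rule eq_vecI) (simp_all add: cv_def)

lemma cv_prod: "conjugate (cv d u) \<bullet> cv d w = of_real (dot d u w)"
  unfolding scalar_prod_sum[OF cv_carrier cv_carrier] dot_def by (simp add: cv_def)

context real_subfield
begin

abbreviation "F \<equiv> complex_of_real ` K"
abbreviation "L d \<equiv> subspace_lattice F d"
abbreviation "N d \<equiv> ol_neg (subspace_lattice F d)"

lemma star_subfield_F: "star_subfield F"
  unfolding star_subfield_def
proof (intro conjI ballI)
  show "0 \<in> F" using zero image_eqI[of 0 complex_of_real 0 K] by simp
  show "1 \<in> F" using one image_eqI[of 1 complex_of_real 1 K] by simp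
  fix x assume "x \<in> F"
  then obtain a where a: "x = of_real a" "a \<in> K" by blast
  show "- x \<in> F" "inverse x \<in> F" "cnj x \<in> F"
    unfolding a(1) of_real_minus[symmetric] of_real_inverse[symmetric] complex_cnj_complex_of_real
    using uminus inverse a(2) by blast+
  fix y assume "y \<in> F"
  then obtain b where b: "y = of_real b" "b \<in> K" by blast
  show "x + y \<in> F" "x * y \<in> F"
    unfolding a(1) b(1) of_real_add[symmetric] of_real_mult[symmetric]
    using add mult a(2) b(2) by blast+
qed

lemma cv_space: "cv d u \<in> space_over F d \<longleftrightarrow> (\<forall>j<d. u j \<in> K)"
  by (auto simp: space_over_def cv_def)

lemma space_cv:
  assumes "v \<in> space_over F d"
  shows "\<exists>u. v = cv d u \<and> (\<forall>j<d. u j \<in> K)"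
proof -
  have v: "v = cv d (\<lambda>j. Re (v $ j))"
    by (rule eq_vecI) (use assms in \<open>auto simp: space_over_def cv_def\<close>)
  have "\<forall>j<d. Re (v $ j) \<in> K" using assms by (auto simp: space_over_def)
  then show ?thesis using v by blast
qed

lemma neg_mem: "y \<in> N d U \<longleftrightarrow> y \<in> space_over F d \<and> (\<forall>x\<in>U. conjugate x \<bullet> y = 0)"
  by simp

lemma neg_zero: "N d {0\<^sub>v d} = space_over F d"
proof (intro equalityI subsetI)
  fix v assume v: "v \<in> space_over F d"
  obtain u where u: "v = cv d u" using space_cv[OF v] by blast
  have "conjugate (0\<^sub>v d) \<bullet> v = 0" unfolding u cv_zero cv_prod by (simp add: dot_def)
  then show "v \<in> N d {0\<^sub>v d}" using v unfolding neg_mem by blast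
qed simp

lemma prod_commute:
  assumes "x \<in> space_over F d" "y \<in> space_over F d"
  shows "conjugate x \<bullet> y = conjugate y \<bullet> x"
proof -
  obtain u w where "x = cv d u" "y = cv d w" using assms space_cv by metis
  then show ?thesis by (simp add: cv_prod dot_commute[of d u w])
qed

lemma neg_subspace: "U \<subseteq> space_over F d \<Longrightarrow> lin_subspace F d (N d U)"
  using lin_subspace_orth[OF star_subfield_F] by simp

lemma projection:
  assumes U: "lin_subspace F d U" and v: "v \<in> space_over F d"
  obtains u w where "u \<in> U" "w \<in> N d U" "v = u + w"
proof -
  obtain f where f: "v = cv d f" "\<And>j. j < d \<Longrightarrow> f j \<in> K" using space_cv[OF v] by blast
  have "\<exists>u\<in>{u. cv d u \<in> U}. \<forall>x\<in>{u. cv d u \<in> U}. dot d x (\<lambda>i. f i - u i) = 0"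
  proof (rule orthogonal_projection)
    show "(\<lambda>_. 0) \<in> {u. cv d u \<in> U}" using lin_subspaceD(1)[OF U] cv_zero[of d] by simp
    fix u w assume "u \<in> {u. cv d u \<in> U}" "w \<in> {u. cv d u \<in> U}"
    then show "(\<lambda>i. u i + w i) \<in> {u. cv d u \<in> U}"
      using lin_subspaceD(2)[OF U, of "cv d u" "cv d w"] by (simp add: cv_add)
  next
    fix c u assume "c \<in> K" "u \<in> {u. cv d u \<in> U}"
    then show "(\<lambda>i. c * u i) \<in> {u. cv d u \<in> U}"
      using lin_subspaceD(3)[OF U, of "of_real c" "cv d u"] by (simp add: cv_scale)
  next
    fix u i assume "u \<in> {u. cv d u \<in> U}" "i < d"
    then show "u i \<in> K" using lin_subspace_subset[OF U] cv_space[of d u] by blast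
  qed (rule f(2))
  then obtain u where u: "cv d u \<in> U" "\<And>x. cv d x \<in> U \<Longrightarrow> dot d x (\<lambda>i. f i - u i) = 0" by blast
  have uK: "\<forall>j<d. u j \<in> K" using u(1) lin_subspace_subset[OF U] cv_space by blast
  have "conjugate x \<bullet> cv d (\<lambda>i. f i - u i) = 0" if x: "x \<in> U" for x
  proof -
    have "x \<in> space_over F d" using x lin_subspace_subset[OF U] by blast
    then obtain g where "x = cv d g" using space_cv by blast
    then show ?thesis using u(2)[of g] x by (simp add: cv_prod)
  qed
  then have "cv d (\<lambda>i. f i - u i) \<in> N d U"
    using f(2) uK diff by (simp add: cv_space)
  moreover have "v = cv d u + cv d (\<lambda>i. f i - u i)" by (simp add: f(1) cv_add)
  ultimately show ?thesis using that u(1) by blast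
qed

text \<open>For \<open>v\<close> in the double complement, the component \<open>w\<close> in the
  complement of \<open>U\<close> is orthogonal to \<open>v\<close> and to the component
  \<open>u\<close>, hence to itself, and vanishes by positive definiteness.\<close>

lemma double_neg:
  assumes U: "lin_subspace F d U"
  shows "N d (N d U) = U"
proof (intro equalityI subsetI)
  fix v assume v: "v \<in> N d (N d U)"
  then have vs: "v \<in> space_over F d" by simp
  obtain u w where uw: "u \<in> U" "w \<in> N d U" "v = u + w" by (rule projection[OF U vs])
  have us: "u \<in> space_over F d" and ws: "w \<in> space_over F d"
    using uw lin_subspace_subset[OF U] by auto
  obtain g where g: "w = cv d g" using space_cv[OF ws] by blast
  have "conjugate w \<bullet> v = conjugate w \<bullet> u + conjugate w \<bullet> w"
    unfolding uw(3) by (rule scalar_prod_add_distrib[of _ d])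
      (use us ws in \<open>auto dest!: space_over_carrier\<close>)
  moreover have "conjugate w \<bullet> v = 0" using v uw(2) unfolding neg_mem[of v] by blast
  moreover have "conjugate w \<bullet> u = 0"
    using uw(1,2) prod_commute[OF ws us] unfolding neg_mem by simp
  ultimately have "dot d g g = 0" by (simp add: g cv_prod)
  then have "w = 0\<^sub>v d" unfolding g cv_zero cv_eq by (simp add: dot_self_eq_0)
  then show "v \<in> U" using uw space_over_carrier[OF us] by simp
next
  fix u assume u: "u \<in> U"
  then have us: "u \<in> space_over F d" using lin_subspace_subset[OF U] by blast
  have "conjugate x \<bullet> u = 0" if "x \<in> N d U" for x
  proof -
    have "x \<in> space_over F d" "conjugate u \<bullet> x = 0" using that u unfolding neg_mem by blast+
    then show ?thesis using prod_commute[OF _ us] by simp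
  qed
  then show "u \<in> N d (N d U)" using us unfolding neg_mem[of u] by blast
qed

lemma neg_join:
  assumes U: "lin_subspace F d U" and W: "lin_subspace F d W"
  shows "N d (ol_join (L d) U W) = N d U \<inter> N d W"
proof (intro equalityI subsetI)
  fix y assume y: "y \<in> N d (ol_join (L d) U W)"
  have join: "x + z \<in> ol_join (L d) U W" if "x \<in> U" "z \<in> W" for x z using that by auto
  have c: "x \<in> carrier_vec d" if "x \<in> U \<or> x \<in> W" for x
    using that lin_subspace_carrier[OF U] lin_subspace_carrier[OF W] by blast
  have "x \<in> ol_join (L d) U W" if x: "x \<in> U \<or> x \<in> W" for x
    using x join[of x "0\<^sub>v d"] join[of "0\<^sub>v d" x] c[OF x] lin_subspaceD(1)[OF U] lin_subspaceD(1)[OF W] by auto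
  then show "y \<in> N d U \<inter> N d W" using y unfolding Int_iff neg_mem by blast
next
  fix y assume y: "y \<in> N d U \<inter> N d W"
  have "conjugate x \<bullet> y = 0" if "x \<in> ol_join (L d) U W" for x
  proof -
    obtain u w where uw: "x = u + w" "u \<in> U" "w \<in> W" using \<open>x \<in> ol_join (L d) U W\<close> by auto
    have s: "u \<in> space_over F d" "w \<in> space_over F d" "y \<in> space_over F d"
      using uw lin_subspace_subset[OF U] lin_subspace_subset[OF W] y by auto
    have "conjugate y \<bullet> (u + w) = conjugate y \<bullet> u + conjugate y \<bullet> w"
      by (rule scalar_prod_add_distrib[of _ d]) (use s in \<open>auto dest!: space_over_carrier\<close>)
    moreover have "conjugate y \<bullet> u = 0" "conjugate y \<bullet> w = 0"
      using y uw prod_commute[OF s(3,1)] prod_commute[OF s(3,2)] unfolding Int_iff neg_mem by simp_all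
    ultimately show ?thesis
      using prod_commute[OF space_over_add[OF star_subfield_F s(1,2)] s(3)] by (simp add: uw(1))
  qed
  then show "y \<in> N d (ol_join (L d) U W)" using y unfolding Int_iff neg_mem by blast
qed

text \<open>By duality: \<open>neg_join\<close> for the two complements, with
  \<open>double_neg\<close> inside and outside.\<close>

lemma neg_meet:
  assumes U: "lin_subspace F d U" and W: "lin_subspace F d W"
  shows "N d (U \<inter> W) = ol_join (L d) (N d U) (N d W)"
proof -
  have NU: "lin_subspace F d (N d U)" and NW: "lin_subspace F d (N d W)"
    using neg_subspace lin_subspace_subset U W by blast+
  have S: "lin_subspace F d (ol_join (L d) (N d U) (N d W))"
    using lin_subspace_sum[OF star_subfield_F NU NW] by simp
  have "U \<inter> W = N d (ol_join (L d) (N d U) (N d W))"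
    unfolding neg_join[OF NU NW] double_neg[OF U] double_neg[OF W] ..
  then show ?thesis using double_neg[OF S] by simp
qed

end

section \<open>Weak satisfiability is feasibility\<close>

context real_subfield
begin

lemma splits_closed: "(y, z) \<in> splits K b x \<Longrightarrow> x \<in> K \<Longrightarrow> y \<in> K \<and> z \<in> K"
  by (auto simp: splits_def diff split: if_splits)

lemma lin_closed: "us \<in> lin K b t x \<Longrightarrow> x \<in> K \<Longrightarrow> set us \<subseteq> K"
proof (induction t arbitrary: b x us)
  case (And s t)
  from And.prems(1) obtain y z as bs where "(y, z) \<in> splits K b x" "us = as @ bs" "as \<in> lin K b t y" "bs \<in> lin K b s z"
    by auto
  then show ?case using splits_closed And.prems(2) And.IH(1)[of bs b z] And.IH(2)[of as b y] by auto
next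
  case (Or s t)
  from Or.prems(1) obtain y z as bs where "(y, z) \<in> splits K (\<not> b) x" "us = as @ bs" "as \<in> lin K b t y" "bs \<in> lin K b s z"
    by auto
  then show ?case using splits_closed Or.prems(2) Or.IH(1)[of bs b z] Or.IH(2)[of as b y] by auto
qed (auto split: if_splits)

text \<open>Both ways of passing on a label, copying it and writing it as a sum, survive linear
  combination of coordinates with coefficients in \<open>K\<close>.\<close>

lemma splits_sum:
  assumes "\<And>j. j < d \<Longrightarrow> (y j, z j) \<in> splits K b (r j)" "\<And>j. j < d \<Longrightarrow> c j \<in> K" "\<And>j. j < d \<Longrightarrow> r j \<in> K"
  shows "(dot d c y, dot d c z) \<in> splits K b (dot d c r)"
proof (cases b)
  case True
  then have "dot d c y = dot d c r" "dot d c z = dot d c r"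
    using assms(1) by (auto simp: splits_def intro!: dot_cong)
  then show ?thesis using True by (simp add: splits_def)
next
  case False
  have "dot d c z = dot d c (\<lambda>j. r j - y j)"
    using assms(1) False by (intro dot_cong) (auto simp: splits_def)
  moreover have "dot d c y \<in> K"
    using assms splits_closed by (intro dot) blast+
  ultimately show ?thesis using False by (simp add: splits_def dot_diff_right)
qed

text \<open>The admissible leaf labellings depend linearly on the label of the root; this is what allows
  a change of coordinates.\<close>
lemma vlin_dot:
  assumes "us \<in> vlin K d b t r" "\<And>j. j < d \<Longrightarrow> c j \<in> K" "\<And>j. j < d \<Longrightarrow> r j \<in> K"
  shows "map (dot d c) us \<in> lin K b t (dot d c r)"
  using assms(1,3)
proof (induction t arbitrary: b r us)
  case (Var n)
  then obtain u where "us = [u]" "\<forall>j<d. u j = r j" by (auto simp: vlin_Var)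
  then show ?case by (auto intro!: dot_cong)
next
  case Zero
  then show ?case by (auto simp: vlin_Zero dot_def)
next
  case One
  then show ?case by (auto simp: vlin_One dot_def)
next
  case (Neg t)
  then show ?case by (simp add: vlin_Neg)
next
  case (And s t)
  from And.prems(1)[unfolded vlin_And] obtain y z us1 us2 where
    us: "us = us1 @ us2" "\<forall>j<d. (y j, z j) \<in> splits K b (r j)" "us1 \<in> vlin K d b t y" "us2 \<in> vlin K d b s z"
    by (elim exE conjE) (rule that)
  have yz: "y j \<in> K" "z j \<in> K" if "j < d" for j using us(2) And.prems(2) splits_closed that by blast+
  have "map (dot d c) us1 \<in> lin K b t (dot d c y)" "map (dot d c) us2 \<in> lin K b s (dot d c z)"
    by (rule And.IH(2)[OF us(3) yz(1)], assumption, rule And.IH(1)[OF us(4) yz(2)], assumption)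
  moreover have "(dot d c y, dot d c z) \<in> splits K b (dot d c r)"
    using us(2) assms(2) And.prems(2) by (intro splits_sum) simp_all
  ultimately show ?case unfolding us(1) lin.simps map_append by (intro UN_I[of "(dot d c y, dot d c z)"]) (assumption, unfold prod.case, blast)
next
  case (Or s t)
  from Or.prems(1)[unfolded vlin_Or] obtain y z us1 us2 where
    us: "us = us1 @ us2" "\<forall>j<d. (y j, z j) \<in> splits K (\<not> b) (r j)" "us1 \<in> vlin K d b t y" "us2 \<in> vlin K d b s z"
    by (elim exE conjE) (rule that)
  have yz: "y j \<in> K" "z j \<in> K" if "j < d" for j using us(2) Or.prems(2) splits_closed that by blast+
  have "map (dot d c) us1 \<in> lin K b t (dot d c y)" "map (dot d c) us2 \<in> lin K b s (dot d c z)"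
    by (rule Or.IH(2)[OF us(3) yz(1)], assumption, rule Or.IH(1)[OF us(4) yz(2)], assumption)
  moreover have "(dot d c y, dot d c z) \<in> splits K (\<not> b) (dot d c r)"
    using us(2) assms(2) Or.prems(2) by (intro splits_sum) simp_all
  ultimately show ?case unfolding us(1) lin.simps map_append by (intro UN_I[of "(dot d c y, dot d c z)"]) (assumption, unfold prod.case, blast)
qed

text \<open>The value at a node of the negation normal form: \<open>b\<close> is false below an odd
  number of negations.\<close>

definition ev :: "nat \<Rightarrow> (nat \<Rightarrow> complex vec set) \<Rightarrow> bool \<Rightarrow> oterm \<Rightarrow> complex vec set" where
  "ev d a b t = (if b then eval_term (L d) a t else N d (eval_term (L d) a t))"

lemma eval_subspace:
  assumes a: "\<And>n. lin_subspace F d (a n)"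
  shows "lin_subspace F d (eval_term (L d) a t)"
proof (induction t)
  case (Var n) show ?case using a by simp
next
  case Zero show ?case using lin_subspace_zero[OF star_subfield_F] by simp
next
  case One show ?case using lin_subspace_space[OF star_subfield_F] by simp
next
  case (Neg t) then show ?case using neg_subspace[OF lin_subspace_subset] by simp
next
  case (And s t) then show ?case using lin_subspace_Int by simp
next
  case (Or s t) then show ?case using lin_subspace_sum[OF star_subfield_F] by simp
qed

lemma ev_subspace:
  assumes a: "\<And>n. lin_subspace F d (a n)"
  shows "lin_subspace F d (ev d a b t)"
  unfolding ev_def using eval_subspace[OF a] neg_subspace[OF lin_subspace_subset[OF eval_subspace[OF a]]] by simp

lemma ev_Neg:
  assumes a: "\<And>n. lin_subspace F d (a n)"
  shows "ev d a b (Neg t) = ev d a (\<not> b) t"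
  unfolding ev_def eval_term.simps using double_neg[OF eval_subspace[OF a]] by simp

lemma ev_And:
  assumes a: "\<And>n. lin_subspace F d (a n)"
  shows "ev d a b (And s t) = (if b then ev d a b s \<inter> ev d a b t else ol_join (L d) (ev d a b t) (ev d a b s))"
proof (cases b)
  case False
  have "N d (eval_term (L d) a t \<inter> eval_term (L d) a s) = ol_join (L d) (ev d a b t) (ev d a b s)"
    unfolding ev_def using False neg_meet[OF eval_subspace[OF a] eval_subspace[OF a]] by simp
  then show ?thesis using False by (simp add: ev_def Int_commute)
qed (simp add: ev_def)

lemma join_commute:
  assumes "lin_subspace F d U" "lin_subspace F d W"
  shows "ol_join (L d) U W = ol_join (L d) W U"
proof -
  have "u + w = w + u" if "u \<in> U" "w \<in> W" for u w
    using comm_add_vec[OF lin_subspace_carrier[OF assms(1) that(1)] lin_subspace_carrier[OF assms(2) that(2)]] .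
  then show ?thesis unfolding subspace_lattice_simps by (intro Collect_cong) metis
qed

lemma ev_Or:
  assumes a: "\<And>n. lin_subspace F d (a n)"
  shows "ev d a b (Or s t) = (if \<not> b then ev d a b s \<inter> ev d a b t else ol_join (L d) (ev d a b t) (ev d a b s))"
proof (cases b)
  case True
  then show ?thesis using join_commute[OF eval_subspace[OF a] eval_subspace[OF a]] by (simp add: ev_def)
next
  case False
  then show ?thesis using neg_join[OF eval_subspace[OF a] eval_subspace[OF a]] by (simp add: ev_def)
qed

text \<open>The parameter makes one statement serve both connectives: conjunctions use it at
  \<open>b\<close>, disjunctions at \<open>\<not> b\<close>.\<close>

lemma meet_splits:
  assumes "\<forall>j<d. r j \<in> K" "lin_subspace F d U" "lin_subspace F d W"
  shows "cv d r \<in> (if b then W \<inter> U else ol_join (L d) U W) \<longleftrightarrow>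
    (\<exists>y z. (\<forall>j<d. (y j, z j) \<in> splits K b (r j)) \<and> cv d y \<in> U \<and> cv d z \<in> W)"
proof (cases b)
  case True
  show ?thesis
  proof
    assume "cv d r \<in> (if b then W \<inter> U else ol_join (L d) U W)"
    then show "\<exists>y z. (\<forall>j<d. (y j, z j) \<in> splits K b (r j)) \<and> cv d y \<in> U \<and> cv d z \<in> W"
      using True by (intro exI[of _ r]) (simp add: splits_def)
  next
    assume "\<exists>y z. (\<forall>j<d. (y j, z j) \<in> splits K b (r j)) \<and> cv d y \<in> U \<and> cv d z \<in> W"
    then obtain y z where yz: "\<forall>j<d. (y j, z j) \<in> splits K b (r j)" "cv d y \<in> U" "cv d z \<in> W" by blast
    then have "cv d y = cv d r" "cv d z = cv d r" unfolding cv_eq using True by (auto simp: splits_def)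
    then show "cv d r \<in> (if b then W \<inter> U else ol_join (L d) U W)" using True yz by simp
  qed
next
  case False
  show ?thesis
  proof
    assume "cv d r \<in> (if b then W \<inter> U else ol_join (L d) U W)"
    then obtain u w where uw: "cv d r = u + w" "u \<in> U" "w \<in> W" using False by auto
    have "u \<in> space_over F d" using uw(2) lin_subspace_subset[OF assms(2)] by blast
    then obtain y where y: "u = cv d y" "\<And>j. j < d \<Longrightarrow> y j \<in> K" using space_cv by blast
    have "w \<in> space_over F d" using uw(3) lin_subspace_subset[OF assms(3)] by blast
    then obtain z where z: "w = cv d z" using space_cv by blast
    have "\<forall>j<d. r j = y j + z j" using uw(1) unfolding y(1) z cv_add cv_eq .
    then have "\<forall>j<d. (y j, z j) \<in> splits K b (r j)" using False y(2) by (simp add: splits_def)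
    then show "\<exists>y z. (\<forall>j<d. (y j, z j) \<in> splits K b (r j)) \<and> cv d y \<in> U \<and> cv d z \<in> W"
      using uw y(1) z by blast
  next
    assume "\<exists>y z. (\<forall>j<d. (y j, z j) \<in> splits K b (r j)) \<and> cv d y \<in> U \<and> cv d z \<in> W"
    then obtain y z where yz: "\<forall>j<d. (y j, z j) \<in> splits K b (r j)" "cv d y \<in> U" "cv d z \<in> W" by blast
    then have "cv d r = cv d y + cv d z" unfolding cv_add cv_eq using False by (auto simp: splits_def)
    then show "cv d r \<in> (if b then W \<inter> U else ol_join (L d) U W)" using False yz by auto
  qed
qed

lemma split_list_all2:
  assumes "\<And>y us. us \<in> A y \<Longrightarrow> length us = length L1"
  shows "(\<exists>y z. Q y z \<and> (\<exists>us. us \<in> A y \<and> list_all2 P L1 us) \<and> (\<exists>us. us \<in> B z \<and> list_all2 P L2 us)) \<longleftrightarrow>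
    (\<exists>us. (\<exists>y z us1 us2. us = us1 @ us2 \<and> Q y z \<and> us1 \<in> A y \<and> us2 \<in> B z) \<and> list_all2 P (L1 @ L2) us)"
  (is "?lhs \<longleftrightarrow> ?rhs")
proof
  assume ?lhs
  then obtain y z us1 us2 where "Q y z" "us1 \<in> A y" "list_all2 P L1 us1" "us2 \<in> B z" "list_all2 P L2 us2"
    by blast
  then show ?rhs using list_all2_appendI[of P L1 us1 L2 us2] by blast
next
  assume ?rhs
  then obtain y z us1 us2 where u: "Q y z" "us1 \<in> A y" "us2 \<in> B z" "list_all2 P (L1 @ L2) (us1 @ us2)"
    by blast
  then have "list_all2 P L1 us1" "list_all2 P L2 us2"
    using list_all2_append[of L1 us1 P L2 us2] assms[OF u(2)] by simp_all
  then show ?lhs using u by blast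
qed

text \<open>De Morgan, in \<open>ev_And\<close> and \<open>ev_Or\<close>, makes every inner node a
  meet or a join, so membership can be pushed down by induction with \<open>meet_splits\<close>.
  Afterwards the assignment enters only through conditions on the leaf vectors.\<close>

lemma ev_iff:
  assumes a: "\<And>n. lin_subspace F d (a n)" and r: "\<forall>j<d. r j \<in> K"
  shows "cv d r \<in> ev d a b t \<longleftrightarrow>
    (\<exists>us\<in>vlin K d b t r. list_all2 (\<lambda>(n, c) u. cv d u \<in> ev d a c (Var n)) (lits b t) us)"
  using r
proof (induction t arbitrary: b r)
  case (Var n)
  show ?case
  proof
    assume "cv d r \<in> ev d a b (Var n)"
    then show "\<exists>us\<in>vlin K d b (Var n) r. list_all2 (\<lambda>(n, c) u. cv d u \<in> ev d a c (Var n)) (lits b (Var n)) us"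
      by (intro bexI[of _ "[r]"]) (simp_all add: vlin_Var)
  next
    assume "\<exists>us\<in>vlin K d b (Var n) r. list_all2 (\<lambda>(n, c) u. cv d u \<in> ev d a c (Var n)) (lits b (Var n)) us"
    then obtain u where "\<forall>j<d. u j = r j" "cv d u \<in> ev d a b (Var n)" by (auto simp: vlin_Var)
    moreover from this(1) have "cv d u = cv d r" unfolding cv_eq .
    ultimately show "cv d r \<in> ev d a b (Var n)" by simp
  qed
next
  case Zero
  show ?case using Zero
    by (simp only: vlin_Zero ev_def eval_term.simps subspace_lattice_simps(5) neg_zero)
      (auto simp: vlin_Zero cv_zero cv_eq cv_space)
next
  case One
  have "N d (space_over F d) = {0\<^sub>v d}"
    using double_neg[OF lin_subspace_zero[OF star_subfield_F], of d] unfolding neg_zero .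
  then show ?case using One
    by (simp only: vlin_One ev_def eval_term.simps subspace_lattice_simps(6))
      (auto simp: vlin_One cv_zero cv_eq cv_space)
next
  case (Neg t)
  have "vlin K d b (Neg t) r = vlin K d (\<not> b) t r" using vlin_Neg by blast
  then show ?case using Neg.IH[OF Neg.prems, of "\<not> b"] by (simp add: ev_Neg[OF a])
next
  case (And s t)
  have IH: "(\<forall>j<d. (y j, z j) \<in> splits K b (r j)) \<and> cv d y \<in> ev d a b t \<and> cv d z \<in> ev d a b s \<longleftrightarrow>
      (\<forall>j<d. (y j, z j) \<in> splits K b (r j)) \<and>
      (\<exists>us\<in>vlin K d b t y. list_all2 (\<lambda>(n, c) u. cv d u \<in> ev d a c (Var n)) (lits b t) us) \<and>
      (\<exists>us\<in>vlin K d b s z. list_all2 (\<lambda>(n, c) u. cv d u \<in> ev d a c (Var n)) (lits b s) us)" for y z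
  proof (intro conj_cong refl)
    assume s: "\<forall>j<d. (y j, z j) \<in> splits K b (r j)"
    show "cv d y \<in> ev d a b t \<longleftrightarrow>
      (\<exists>us\<in>vlin K d b t y. list_all2 (\<lambda>(n, c) u. cv d u \<in> ev d a c (Var n)) (lits b t) us)"
      by (rule And.IH(2)) (use s And.prems splits_closed in blast)
    show "cv d z \<in> ev d a b s \<longleftrightarrow>
      (\<exists>us\<in>vlin K d b s z. list_all2 (\<lambda>(n, c) u. cv d u \<in> ev d a c (Var n)) (lits b s) us)"
      by (rule And.IH(1)) (use s And.prems splits_closed in blast)
  qed
  show ?case
    unfolding ev_And[OF a] meet_splits[OF And.prems ev_subspace[OF a] ev_subspace[OF a]] IH Bex_def vlin_And lits.simps
    by (rule split_list_all2) (simp add: vlin_def)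
next
  case (Or s t)
  have IH: "(\<forall>j<d. (y j, z j) \<in> splits K (\<not> b) (r j)) \<and> cv d y \<in> ev d a b t \<and> cv d z \<in> ev d a b s \<longleftrightarrow>
      (\<forall>j<d. (y j, z j) \<in> splits K (\<not> b) (r j)) \<and>
      (\<exists>us\<in>vlin K d b t y. list_all2 (\<lambda>(n, c) u. cv d u \<in> ev d a c (Var n)) (lits b t) us) \<and>
      (\<exists>us\<in>vlin K d b s z. list_all2 (\<lambda>(n, c) u. cv d u \<in> ev d a c (Var n)) (lits b s) us)" for y z
  proof (intro conj_cong refl)
    assume s: "\<forall>j<d. (y j, z j) \<in> splits K (\<not> b) (r j)"
    show "cv d y \<in> ev d a b t \<longleftrightarrow>
      (\<exists>us\<in>vlin K d b t y. list_all2 (\<lambda>(n, c) u. cv d u \<in> ev d a c (Var n)) (lits b t) us)"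
      by (rule Or.IH(2)) (use s Or.prems splits_closed in blast)
    show "cv d z \<in> ev d a b s \<longleftrightarrow>
      (\<exists>us\<in>vlin K d b s z. list_all2 (\<lambda>(n, c) u. cv d u \<in> ev d a c (Var n)) (lits b s) us)"
      by (rule Or.IH(1)) (use s Or.prems splits_closed in blast)
  qed
  show ?case
    unfolding ev_Or[OF a] meet_splits[OF Or.prems ev_subspace[OF a] ev_subspace[OF a]] IH Bex_def vlin_Or lits.simps
    by (rule split_list_all2) (simp add: vlin_def)
qed

text \<open>Expanding the finitely many vectors of a solution in an orthonormal basis of their span
  preserves all conditions and bounds the dimension; normalisation needs square roots of sums of
  squares.\<close>
lemma weakly_sat_imp_feasible:
  assumes pyth: "\<And>d v. (\<And>i. i < d \<Longrightarrow> v i \<in> K) \<Longrightarrow> \<exists>c\<in>K. dot d v v = c\<^sup>2"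
    and sat: "weakly_sat F t" and n: "length (lits True t) < n"
  shows "feasible K n t"
proof -
  let ?m = "length (lits True t)"
  obtain d a where a: "range a \<subseteq> carrier (L d)" "eval_term (L d) a t \<noteq> ol_bot (L d)"
    using sat unfolding weakly_sat_def weakly_sat_in_def by blast
  have sub: "lin_subspace F d (a k)" for k using a(1) by auto
  have ev: "lin_subspace F d (ev d a b s)" for b s by (rule ev_subspace[OF sub])
  have "0\<^sub>v d \<in> ev d a True t" by (rule lin_subspaceD(1)[OF ev])
  then obtain v where v: "v \<in> ev d a True t" "v \<noteq> 0\<^sub>v d" using a(2) by (auto simp: ev_def)
  have "v \<in> space_over F d" using v(1) lin_subspace_subset[OF ev] by blast
  then obtain r where r: "v = cv d r" "\<And>j. j < d \<Longrightarrow> r j \<in> K" using space_cv by blast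
  have "cv d r \<in> ev d a True t" "\<forall>j<d. r j \<in> K" using v(1) r by auto
  then obtain us where us: "us \<in> vlin K d True t r"
    "list_all2 (\<lambda>(n, c) u. cv d u \<in> ev d a c (Var n)) (lits True t) us"
    using ev_iff[where a = a and b = True and t = t and d = d and r = r, OF sub] by blast
  have len: "length us = ?m" using us(1) by (simp add: vlin_def)
  have leaf: "cv d (us ! p) \<in> ev d a (snd (lits True t ! p)) (Var (fst (lits True t ! p)))" if "p < ?m" for p
    using list_all2_nthD[OF us(2) that] by (simp add: split_beta)
  have usK: "u j \<in> K" if u: "u \<in> set us" and j: "j < d" for u j
  proof -
    obtain p where p: "p < ?m" "u = us ! p" using u len by (metis in_set_conv_nth)
    have "cv d u \<in> space_over F d" using leaf[OF p(1)] p(2) lin_subspace_subset[OF ev] by blast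
    then show ?thesis using j cv_space by blast
  qed
  have orth: "dot d (us ! p) (us ! q) = 0"
    if pq: "p < ?m" "q < ?m" "conflict (lits True t ! p) (lits True t ! q)" for p q
  proof -
    have *: "dot d (us ! p) (us ! q) = 0"
      if "p < ?m" "q < ?m" "fst (lits True t ! p) = fst (lits True t ! q)" "snd (lits True t ! p)" "\<not> snd (lits True t ! q)" for p q
    proof -
      have "cv d (us ! p) \<in> a (fst (lits True t ! q))" "cv d (us ! q) \<in> N d (a (fst (lits True t ! q)))"
        using leaf[OF that(1)] leaf[OF that(2)] that(3-5) by (simp_all add: ev_def)
      then have "conjugate (cv d (us ! p)) \<bullet> cv d (us ! q) = 0" unfolding neg_mem by blast
      then show ?thesis by (simp add: cv_prod)
    qed
    show ?thesis
    proof (cases "snd (lits True t ! p)")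
      case True
      then show ?thesis using *[of p q] pq by (simp add: conflict_def)
    next
      case False
      then show ?thesis using *[of q p] pq by (simp add: conflict_def dot_commute)
    qed
  qed
  \<comment> \<open>The root vector joins the leaf vectors, since it has to be expanded in the same
    basis to remain visibly nonzero.\<close>
  have vs: "w j \<in> K" if "w \<in> set (r # us)" "j < d" for w j using that r(2) usK by auto
  have "\<exists>e. (\<forall>i. \<forall>j<d. e i j \<in> K) \<and>
    (\<forall>i<length (r # us). \<forall>k<length (r # us). i \<noteq> k \<longrightarrow> dot d (e i) (e k) = 0) \<and>
    (\<forall>i<length (r # us). dot d (e i) (e i) = 1 \<or> (\<forall>j<d. e i j = 0)) \<and>
    (\<forall>w\<in>set (r # us). \<forall>j<d. w j = (\<Sum>i<length (r # us). dot d (e i) w * e i j))"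
  proof (rule gram_schmidt)
    fix w :: "nat \<Rightarrow> real" assume "\<And>i. i < d \<Longrightarrow> w i \<in> K"
    then show "\<exists>c\<in>K. dot d w w = c\<^sup>2" by (rule pyth)
  next
    fix w j assume "w \<in> set (r # us)" "j < d"
    then show "w j \<in> K" by (rule vs)
  qed
  then obtain e0 where e0: "\<forall>i. \<forall>j<d. e0 i j \<in> K"
    "\<forall>w\<in>set (r # us). \<forall>j<d. w j = (\<Sum>i<length (r # us). dot d (e0 i) w * e0 i j)"
    by (elim exE conjE) (rule that)
  define e where "e i = (if i < length (r # us) then e0 i else (\<lambda>_. 0))" for i
  have eK: "e i j \<in> K" if "j < d" for i j using e0(1) that zero by (simp add: e_def)
  have expand: "w j = (\<Sum>i<n. dot d (e i) w * e i j)" if w: "w \<in> set (r # us)" and j: "j < d" for w j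
  proof -
    have "w j = (\<Sum>i<length (r # us). dot d (e0 i) w * e0 i j)" using e0(2) w j by blast
    also have "\<dots> = (\<Sum>i<n. dot d (e i) w * e i j)"
      using n len by (intro sum.mono_neutral_cong_left) (auto simp: e_def)
    finally show ?thesis .
  qed
  \<comment> \<open>Parseval's identity, by which the orthogonality conditions can be read off the
    new coordinates.\<close>
  have dot_e: "dot d u w = (\<Sum>i<n. dot d (e i) u * dot d (e i) w)" if "w \<in> set (r # us)" for u w
  proof -
    have "dot d u w = dot d u (\<lambda>j. \<Sum>i<n. dot d (e i) w * e i j)"
      by (rule dot_cong) (use expand[OF that] in auto)
    also have "\<dots> = (\<Sum>i<n. dot d (e i) w * dot d u (e i))" by (rule dot_sum_right)
    finally show ?thesis by (simp add: dot_commute[of d u] mult.commute)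
  qed
  define r' where "r' i = dot d (e i) r" for i
  define us' where "us' = map (\<lambda>u i. dot d (e i) u) us"
  \<comment> \<open>Taking the new coordinate \<open>i\<close> is the linear functional
    \<open>dot d (e i)\<close>, and \<open>vlin_dot\<close> says that such functionals turn
    labellings into labellings.\<close>
  have "map (\<lambda>u. u i) us' \<in> lin K True t (r' i)" for i
    using vlin_dot[OF us(1), of "e i"] eK r(2) by (simp add: us'_def r'_def comp_def)
  then have "us' \<in> vlin K n True t r'" by (simp add: vlin_def us'_def len)
  moreover have "\<forall>i<n. r' i \<in> K" using eK r(2) by (auto simp: r'_def intro!: dot)
  moreover have "\<exists>i<n. r' i \<noteq> 0"
  proof (rule ccontr)
    assume "\<not> (\<exists>i<n. r' i \<noteq> 0)"
    then have "r j = 0" if "j < d" for j using expand[of r j] that by (simp add: r'_def)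
    then have "cv d r = 0\<^sub>v d" unfolding cv_zero cv_eq by blast
    then show False using v(2) r(1) by simp
  qed
  moreover have "dot n (us' ! p) (us' ! q) = 0"
    if "p < length us'" "q < length us'" "conflict (lits True t ! p) (lits True t ! q)" for p q
  proof -
    have pq: "p < ?m" "q < ?m" using that len by (simp_all add: us'_def)
    have "dot n (us' ! p) (us' ! q) = dot d (us ! p) (us ! q)"
      using dot_e[of "us ! q" "us ! p"] pq len by (simp add: us'_def dot_def[of n])
    then show ?thesis using orth[OF pq that(3)] by simp
  qed
  ultimately show ?thesis unfolding feasible_iff by blast
qed

text \<open>A variable \<open>k\<close> is sent to the orthocomplement of the vectors
  \<open>T k\<close> at its negated leaves. Vectors at its positive leaves lie there by the
  orthogonality conditions, and \<open>T k\<close> lies in its own double complement, so all leaf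
  conditions of \<open>ev_iff\<close> hold.\<close>

lemma feasible_imp_weakly_sat:
  assumes "feasible K d t"
  shows "weakly_sat F t"
proof -
  let ?m = "length (lits True t)" and ?L = "lits True t"
  obtain r us where r: "\<forall>j<d. r j \<in> K" and us: "us \<in> vlin K d True t r" and nz: "\<exists>j<d. r j \<noteq> 0"
    and orth: "\<forall>p<length us. \<forall>q<length us. conflict (?L ! p) (?L ! q) \<longrightarrow> dot d (us ! p) (us ! q) = 0"
    using assms unfolding feasible_iff by blast
  have len: "length us = ?m" using us by (simp add: vlin_def)
  have usK: "cv d (us ! p) \<in> space_over F d" if "p < ?m" for p
    unfolding cv_space
  proof (intro allI impI)
    fix j assume "j < d"
    \<comment> \<open>Guesses range over \<open>K\<close>, so a root label in \<open>K\<close>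
      forces all leaf labels into \<open>K\<close>.\<close>
    then have "set (map (\<lambda>u. u j) us) \<subseteq> K" using us r by (intro lin_closed) (auto simp: vlin_def)
    moreover have "us ! p \<in> set us" using that len by simp
    ultimately show "(us ! p) j \<in> K" by auto
  qed
  define T where "T k = {cv d (us ! p) | p. p < ?m \<and> ?L ! p = (k, False)}" for k
  define a where "a k = N d (T k)" for k
  have T: "T k \<subseteq> space_over F d" for k using usK by (auto simp: T_def)
  have sub: "lin_subspace F d (a k)" for k unfolding a_def by (rule neg_subspace[OF T])
  have "cv d (us ! p) \<in> ev d a (snd (?L ! p)) (Var (fst (?L ! p)))" if p: "p < ?m" for p
  proof (cases "snd (?L ! p)")
    case True
    have "conjugate x \<bullet> cv d (us ! p) = 0" if x: "x \<in> T (fst (?L ! p))" for x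
    proof -
      obtain q where q: "x = cv d (us ! q)" "q < ?m" "?L ! q = (fst (?L ! p), False)"
        using x unfolding T_def by blast
      then have "dot d (us ! q) (us ! p) = 0" using orth p True len by (auto simp: conflict_def)
      then show ?thesis by (simp add: q(1) cv_prod)
    qed
    then have "cv d (us ! p) \<in> N d (T (fst (?L ! p)))" using usK[OF p] unfolding neg_mem by blast
    then show ?thesis using True by (simp only: ev_def a_def eval_term.simps if_True)
  next
    case False
    then have "cv d (us ! p) \<in> T (fst (?L ! p))" using p unfolding T_def by (auto intro!: exI[of _ p] prod_eqI)
    then have "conjugate x \<bullet> cv d (us ! p) = 0" if x: "x \<in> N d (T (fst (?L ! p)))" for x
      using x prod_commute[OF _ usK[OF p], of x] unfolding neg_mem by auto
    then have "cv d (us ! p) \<in> N d (N d (T (fst (?L ! p))))"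
      using usK[OF p] unfolding neg_mem[of "cv d (us ! p)"] by blast
    then show ?thesis using False by (simp only: ev_def a_def eval_term.simps if_False)
  qed
  then have "list_all2 (\<lambda>(n, c) u. cv d u \<in> ev d a c (Var n)) ?L us"
    using len by (simp add: list_all2_conv_all_nth split_beta)
  then have "cv d r \<in> eval_term (L d) a t"
    using ev_iff[where a = a and b = True and t = t and d = d and r = r, OF sub r] us by (auto simp: ev_def)
  moreover have "cv d r \<noteq> 0\<^sub>v d" unfolding cv_zero cv_eq using nz by simp
  ultimately have "eval_term (L d) a t \<noteq> ol_bot (L d)" by auto
  moreover have "range a \<subseteq> carrier (L d)" using sub by auto
  moreover have "1 \<le> d" using nz by auto
  ultimately show ?thesis unfolding weakly_sat_def weakly_sat_in_def by blast
qed

lemma program_over_prog: "program_over K prog"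
  unfolding program_over_def prog_def using zero one by simp

text \<open>The language of \<open>prog\<close> over all of \<open>K\<close> is in
  \<open>NP_over K\<close> by the time bound alone; what it contains has to be known only on bit
  strings, where \<open>passes_feasible\<close> applies. With \<open>length xs\<close> as dimension,
  \<open>length_lits_less\<close> meets the bound in \<open>weakly_sat_imp_feasible\<close>.\<close>

lemma sat_lang_BP:
  assumes pyth: "\<And>d v. (\<And>i. i < d \<Longrightarrow> v i \<in> K) \<Longrightarrow> \<exists>c\<in>K. dot d v v = c\<^sup>2"
  shows "sat_lang F \<in> BP (NP_over K)"
proof -
  let ?A = "{xs \<in> lists K. accepts K prog xs}"
  have "?A \<in> NP_over K"
    unfolding NP_over_def using program_over_prog poly_time_prog by blast
  moreover have "sat_lang F = ?A \<inter> lists {0, 1}"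
  proof (intro equalityI subsetI)
    fix xs assume "xs \<in> sat_lang F"
    then obtain t where t: "xs = encode t" "weakly_sat F t" unfolding sat_lang_def by blast
    have s: "set xs \<subseteq> {0, 1}" unfolding t(1) by (rule set_encode)
    moreover have "feasible K (length xs) t"
      by (rule weakly_sat_imp_feasible[OF pyth t(2)]) (simp_all add: t(1) length_lits_less)
    then have "accepts K prog xs" unfolding accepts_prog passes_feasible[OF s] using t(1) by blast
    ultimately show "xs \<in> ?A \<inter> lists {0, 1}" using zero one by (auto simp: lists_eq_set)
  next
    fix xs assume xs: "xs \<in> ?A \<inter> lists {0, 1}"
    then have s: "set xs \<subseteq> {0, 1}" by (auto simp: lists_eq_set)
    have "accepts K prog xs" using xs by simp
    then obtain t where "xs = encode t" "feasible K (length xs) t"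
      unfolding accepts_prog passes_feasible[OF s] by blast
    then show "xs \<in> sat_lang F" unfolding sat_lang_def using feasible_imp_weakly_sat by blast
  qed
  ultimately show ?thesis unfolding BP_def by blast
qed

end

section \<open>Instances: Pythagorean fields, the reals and the complex numbers\<close>

lemma sum_list_squares:
  "(\<Sum>x\<leftarrow>map (\<lambda>j. complex_of_real (v j)) [0..<d]. x\<^sup>2) = of_real (dot d v v)"
  by (induction d) (simp_all add: dot_def power2_eq_square)

lemma pythagorean_dot:
  assumes pyth: "pythagorean F" and F: "complex_of_real ` K = F \<inter> \<real>" and v: "\<And>i. i < d \<Longrightarrow> v i \<in> K"
  shows "\<exists>c\<in>K. dot d v v = c\<^sup>2"
proof -
  let ?xs = "map (\<lambda>j. complex_of_real (v j)) [0..<d]"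
  have "set ?xs \<subseteq> F \<inter> \<real>" unfolding F[symmetric] using v by auto
  then obtain c where c: "c \<in> F \<inter> \<real>" "(\<Sum>x\<leftarrow>?xs. x\<^sup>2) = c\<^sup>2"
    using pyth unfolding pythagorean_def by blast
  obtain k where k: "k \<in> K" "c = of_real k" using c(1) unfolding F[symmetric] by blast
  have "complex_of_real (dot d v v) = of_real (k\<^sup>2)" using c(2) unfolding sum_list_squares k(2) by simp
  then have "dot d v v = k\<^sup>2" unfolding of_real_eq_iff .
  then show ?thesis using k(1) by blast
qed

lemma real_subfield_Re_field:
  assumes "admissible_field F"
  shows "real_subfield (Re_field F)" "complex_of_real ` Re_field F = F \<inter> \<real>"
proof -
  have sub: "star_subfield F" using assms unfolding admissible_field_def by (rule conjunct1)
  have "star_subfield (complex_of_real ` Re_field F) \<and> complex_of_real ` Re_field F = F \<inter> \<real>"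
    using assms
  proof (cases rule: admissible_cases)
    case 1
    then show ?thesis using sub by (simp add: Int_absorb2)
  next
    case 2
    then show ?thesis using complex_field.subK[OF 2(1)] by simp
  qed
  then show "real_subfield (Re_field F)" "complex_of_real ` Re_field F = F \<inter> \<real>"
    using star_subfield_imp_real_subfield by blast+
qed

lemma sat_lang_Re_field:
  assumes "admissible_field F"
  shows "sat_lang F = sat_lang (complex_of_real ` Re_field F)"
    and "SAT_lang F = SAT_lang (complex_of_real ` Re_field F)"
proof -
  have "weakly_sat F = weakly_sat (complex_of_real ` Re_field F)"
    "strongly_sat F = strongly_sat (complex_of_real ` Re_field F)"
    by (rule ext, rule sat_Re_field[OF assms])+
  then show "sat_lang F = sat_lang (complex_of_real ` Re_field F)"
    "SAT_lang F = SAT_lang (complex_of_real ` Re_field F)"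
    unfolding sat_lang_def SAT_lang_def by (simp_all only:)
qed

lemma sat_lang_Reals: "sat_lang \<real> \<in> BP (NP_over UNIV)"
proof -
  have "real_subfield UNIV" by unfold_locales simp_all
  moreover have "\<exists>c\<in>UNIV. dot d v v = c\<^sup>2" for d v
    by (intro bexI[of _ "sqrt (dot d v v)"]) (simp_all add: dot_def sum_nonneg)
  ultimately show ?thesis unfolding Reals_def by (intro real_subfield.sat_lang_BP) simp_all
qed

lemma admissible_UNIV: "admissible_field UNIV"
proof -
  have "z \<in> {x + \<i> * y | x y. x \<in> UNIV \<inter> \<real> \<and> y \<in> UNIV \<inter> \<real>}" for z
    using complex_eq[of z] by (intro CollectI exI[of _ "of_real (Re z)"] exI[of _ "of_real (Im z)"]) simp
  then have "UNIV = {x + \<i> * y | x y. x \<in> UNIV \<inter> \<real> \<and> y \<in> UNIV \<inter> \<real>}" by (rule UNIV_eq_I)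
  then show ?thesis unfolding admissible_field_def star_subfield_def by simp
qed

theorem theorem6p2:
  fixes F :: "complex set"
  assumes "admissible_field F"
  shows
    "(pythagorean F \<longrightarrow> sat_lang F \<in> BP (NP_over (Re_field F)))
     \<and> sat_lang \<real> \<in> BP (NP_over (UNIV :: real set))
     \<and> sat_lang UNIV \<in> BP (NP_over (UNIV :: real set))
     \<and> (\<forall>t. weakly_sat F t \<longleftrightarrow> weakly_sat (complex_of_real ` Re_field F) t)
     \<and> (\<forall>t. strongly_sat F t \<longleftrightarrow> strongly_sat (complex_of_real ` Re_field F) t)
     \<and> SAT_lang F = SAT_lang (complex_of_real ` Re_field F)
     \<and> sat_lang F = sat_lang (complex_of_real ` Re_field F)"
proof (intro conjI impI allI)
  assume pyth: "pythagorean F"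
  have "sat_lang (complex_of_real ` Re_field F) \<in> BP (NP_over (Re_field F))"
    by (rule real_subfield.sat_lang_BP[OF real_subfield_Re_field(1)[OF assms]])
      (rule pythagorean_dot[OF pyth real_subfield_Re_field(2)[OF assms]])
  then show "sat_lang F \<in> BP (NP_over (Re_field F))" unfolding sat_lang_Re_field(1)[OF assms] .
next
  \<comment> \<open>The complex case is the real one, transported by part (b) for the field of all
    complex numbers.\<close>
  have "complex_of_real ` Re_field UNIV = \<real>" using real_subfield_Re_field(2)[OF admissible_UNIV] by simp
  then show "sat_lang UNIV \<in> BP (NP_over (UNIV :: real set))"
    using sat_lang_Re_field(1)[OF admissible_UNIV] sat_lang_Reals by simp
qed (fact sat_lang_Reals sat_Re_field[OF assms] sat_lang_Re_field[OF assms])+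

end
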